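(* Let $\mu$ be a log-concave probability measure supported on a convex body $K\subset\mathbb{R}^n$, and let $\|\cdot\|$ be an arbitrary norm on $\mathbb{R}^n$. Then for every measurable set $S\subset K$ with $0<\mu(S)\le 1/2$, $$(\operatorname{diam} K)\,\mu^+(S)\;\ge\;\mu(S)\,G\!\left(1/\mu(S)\right),$$ where $\operatorname{diam}K$ and $\mu^+$ are taken with respect to $\|\cdot\|$ and $G$ is the function defined in the context. Moreover, the bound is sharp: for every $x\in(0,1/2]$, every $D>0$, every dimension $n\ge1$ and every norm $\|\cdot\|$ on $\mathbb{R}^n$, the infimum of $(\operatorname{diam}K)\,\mu^+(S)/\mu(S)$ over all such triples $(\mu,K,S)$ with $\mu(S)=x$ and $\operatorname{diam}K=D$ equals $G(1/x)$.
   Context: A convex body is a closed, bounded convex set. A measure $\mu$ on $\mathbb{R}^n$ is log-concave if it has a density $F\ge 0$ (i.e. $\mu(A)=\int_A F$) with $\log F$ concave on the support of $F$; equivalently $\mu(tA+(1-t)B)\ge\mu(A)^t\mu(B)^{1-t}$ for all measurable $A,B$ and $t\in[0,1]$. For a norm $\|\cdot\|$, $\operatorname{diam}K=\sup\{\|a-b\|:a,b\in K\}$, and for $h>0$, $S_h=\{y:\exists s\in S,\ \|y-s\|\le h\}$. The generalized Minkowski measure is $\mu^+(S)=\lim_{h\to0^+}\mu(S_h\setminus S)/h$ (with respect to $\|\cdot\|$). The function $G:[2,\infty)\to\mathbb{R}$ is defined by $G(2)=2$ and, for $x\in(0,1/2)$, $G(1/x)=\dfrac{\gamma^2e^{\gamma}}{e^{\gamma}(\gamma-1)+1}$,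 where $\gamma>0$ is the unique solution of $x=\dfrac{e^{\gamma}(\gamma-1)+1}{(e^{\gamma}-1)^2}$ (the map $\gamma\mapsto \frac{e^{\gamma}(\gamma-1)+1}{(e^{\gamma}-1)^2}$ is a bijection from $(0,\infty)$ onto $(0,1/2)$). *)

theory Defs
  imports "HOL-Analysis.Analysis"
begin

definition is_norm :: "('a::euclidean_space \<Rightarrow> real) \<Rightarrow> bool" where
  "is_norm N \<longleftrightarrow> (\<forall>x. 0 \<le> N x) \<and> (\<forall>x. N x = 0 \<longleftrightarrow> x = 0) \<and>
     (\<forall>c x. N (c *\<^sub>R x) = \<bar>c\<bar> * N x) \<and> (\<forall>x y. N (x + y) \<le> N x + N y)"

definition convex_body :: "'a::euclidean_space set \<Rightarrow> bool" where
  "convex_body K \<longleftrightarrow> closed K \<and> bounded K \<and> convex K"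

definition log_concave_fun :: "('a::euclidean_space \<Rightarrow> real) \<Rightarrow> bool" where
  "log_concave_fun F \<longleftrightarrow> (\<forall>x. 0 \<le> F x) \<and>
     (\<forall>x y t. 0 \<le> t \<and> t \<le> 1 \<longrightarrow>
        F x powr t * F y powr (1 - t) \<le> F (t *\<^sub>R x + (1 - t) *\<^sub>R y))"

definition mu :: "('a::euclidean_space \<Rightarrow> real) \<Rightarrow> 'a set \<Rightarrow> real" where
  "mu F A = (LINT x:A|lebesgue. F x)"

definition logconcave_prob_on :: "('a::euclidean_space \<Rightarrow> real) \<Rightarrow> 'a set \<Rightarrow> bool" where
  "logconcave_prob_on F K \<longleftrightarrow> F \<in> borel_measurable lebesgue \<and> integrable lebesgue F \<and>
     log_concave_fun F \<and> (LINT x|lebesgue. F x) = 1 \<and> (\<forall>x. x \<notin> K \<longrightarrow> F x = 0)"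

definition diamN :: "('a \<Rightarrow> real) \<Rightarrow> 'a::real_normed_vector set \<Rightarrow> real" where
  "diamN N K = Sup {N (a - b) | a b. a \<in> K \<and> b \<in> K}"

definition nbhd :: "('a \<Rightarrow> real) \<Rightarrow> 'a::real_normed_vector set \<Rightarrow> real \<Rightarrow> 'a set" where
  "nbhd N S h = {y. \<exists>s\<in>S. N (y - s) \<le> h}"

definition has_minkowski :: "('a::euclidean_space \<Rightarrow> real) \<Rightarrow> ('a \<Rightarrow> real) \<Rightarrow> 'a set \<Rightarrow> real \<Rightarrow> bool" where
  "has_minkowski N F S m \<longleftrightarrow>
     ((\<lambda>h. mu F (nbhd N S h - S) / h) \<longlongrightarrow> m) (at_right 0)"

definition gaux :: "real \<Rightarrow> real" where
  "gaux \<gamma> = (exp \<gamma> * (\<gamma> - 1) + 1) / (exp \<gamma> - 1)\<^sup>2"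

definition G :: "real \<Rightarrow> real" where
  "G y = (if y = 2 then 2 else
     (let \<gamma> = (THE \<gamma>. \<gamma> > 0 \<and> gaux \<gamma> = 1 / y)
      in \<gamma>\<^sup>2 * exp \<gamma> / (exp \<gamma> * (\<gamma> - 1) + 1)))"

end

theory Submission
  imports Defs "HOL-Real_Asymp.Real_Asymp"
begin

text \<open>The right hand side \<open>x G(1/x)\<close> is the infimum \<open>iso_prof x\<close> over \<open>\<gamma> \<noteq> 0\<close> of the affine functions
  \<open>\<gamma> x + \<gamma> / (e\<^sup>\<gamma> - 1)\<close>, the boundary densities of the exponential measures with rate \<open>\<gamma>\<close> on the
  unit interval; in particular it is concave and symmetric about \<open>1/2\<close>.

  The lower bound is a localization argument without limits. A measurable \<open>S\<close> of mass \<open>x\<close> and the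
  complement \<open>T\<close> of its \<open>h\<close>-neighbourhood are at distance at least \<open>h\<close>. Given a coordinate flat of
  codimension two, some hyperplane through it cuts a convex piece so that both halves
  contain the same proportion \<open>x\<close> of \<open>S\<close>. Cutting through every flat of a fine finite grid leaves pieces in which
  all triangles have tiny projected area, so each piece is close to a line. Chopping such a
  piece into short slabs yields, by the Prekopa-Leindler inequality, a log-concave sequence, for which
  the isoperimetric inequality is elementary. Letting the grid shrink gives a bound for
  fixed \<open>h\<close>, and \<open>h \<rightarrow> 0\<close> along radii with measurable neighbourhood gives the theorem.

  Near-extremal examples are exponential densities on thin cylinders around a segment whose direction is
  normed by a dual functional, cut along a level set of that functional.\<close>

section \<open>The isoperimetric profile\<close>

text \<open>The pieces can be treated separately because bisection keeps the proportion of
  \<open>S\<close> at the same \<open>x\<close> on every piece: the inequality to be summed is then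
  linear in the measures of the piece and of its part of \<open>T\<close>, with one constant
  throughout. A limiting needle would call for the trace of a merely measurable set on a segment; a
  piece of positive thickness retains its Lebesgue measure, and of the geometry only the distance
  between \<open>S\<close> and \<open>T\<close> has to survive projection. These traces may
  interleave in any way along the piece, so the one-dimensional inequality is needed for arbitrary
  separated families and not just for two intervals; concavity and symmetry of the profile reduce it
  to at most two gaps. For a given number of slabs the separation hypothesis is strict, hence one
  sufficiently fine finite grid absorbs the thickness error completely. The number of slabs then
  tends to infinity, which leaves the factor \<open>1 - 2 * (h / D)\<close>, and this tends to 1
  with \<open>h\<close>.\<close>

text \<open>For the density proportional to \<open>exp (\<gamma> * t)\<close> on the unit interval,
  the initial interval of mass \<open>x\<close> ends where
  \<open>exp (\<gamma> * t) = 1 + x * (exp \<gamma> - 1)\<close>; the normalised density there is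
  this expression.\<close>

definition affine_prof :: "real \<Rightarrow> real \<Rightarrow> real" where
  "affine_prof \<gamma> x = \<gamma> * x + \<gamma> / (exp \<gamma> - 1)"

definition iso_prof :: "real \<Rightarrow> real" where
  "iso_prof x = (INF \<gamma>\<in>-{0}. affine_prof \<gamma> x)"

text \<open>Reflection of the unit interval: the rate changes sign and the mass on one side of the
  cut becomes the mass on the other.\<close>

lemma affine_prof_minus:
  assumes "\<gamma> \<noteq> 0"
  shows "affine_prof (-\<gamma>) x = affine_prof \<gamma> (1 - x)"
proof -
  have "exp \<gamma> \<noteq> 1" using assms by simp
  moreover have "exp (-\<gamma>) = 1 / exp \<gamma>" by (simp add: exp_minus field_simps)
  ultimately show ?thesis
    by (simp add: affine_prof_def divide_simps) (simp add: algebra_simps)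
qed

lemma affine_prof_nonneg:
  assumes "\<gamma> \<noteq> 0" "0 \<le> x" "x \<le> 1"
  shows "0 \<le> affine_prof \<gamma> x"
proof -
  have *: "0 \<le> affine_prof g y" if "g > 0" "0 \<le> y" for g y :: real
    using that by (simp add: affine_prof_def)
  show ?thesis
  proof (cases "\<gamma> > 0")
    case False
    then have "affine_prof \<gamma> x = affine_prof (-\<gamma>) (1 - x)"
      using affine_prof_minus[of "-\<gamma>" x] assms by simp
    then show ?thesis using *[of "-\<gamma>" "1 - x"] False assms by simp
  qed (use * assms in auto)
qed

lemma affine_prof_bdd_below:
  assumes "0 \<le> x" "x \<le> 1"
  shows "bdd_below ((\<lambda>\<gamma>. affine_prof \<gamma> x) ` (-{0}))"
  using affine_prof_nonneg assms by (intro bdd_belowI[of _ 0]) auto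

lemma iso_prof_le:
  assumes "\<gamma> \<noteq> 0" "0 \<le> x" "x \<le> 1"
  shows "iso_prof x \<le> affine_prof \<gamma> x"
  unfolding iso_prof_def using assms by (intro cINF_lower affine_prof_bdd_below) auto

lemma iso_prof_greatest:
  assumes "\<And>\<gamma>. \<gamma> \<noteq> 0 \<Longrightarrow> c \<le> affine_prof \<gamma> x"
  shows "c \<le> iso_prof x"
proof -
  have "(1::real) \<in> -{0}" by simp
  then have "-{0::real} \<noteq> {}" by blast
  then show ?thesis unfolding iso_prof_def using assms by (intro cINF_greatest) auto
qed

lemma iso_prof_nonneg: "0 \<le> x \<Longrightarrow> x \<le> 1 \<Longrightarrow> 0 \<le> iso_prof x"
  by (intro iso_prof_greatest affine_prof_nonneg)

lemma iso_prof_reflect: 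
  assumes "0 \<le> x" "x \<le> 1"
  shows "iso_prof (1 - x) = iso_prof x"
proof -
  have *: "iso_prof y \<le> iso_prof (1 - y)" if "0 \<le> y" "y \<le> 1" for y
  proof (rule iso_prof_greatest)
    fix g :: real assume "g \<noteq> 0"
    then show "iso_prof y \<le> affine_prof g (1 - y)"
      using iso_prof_le[of "-g" y] affine_prof_minus[of g y] that by simp
  qed
  show ?thesis using *[of x] *[of "1 - x"] assms by simp
qed

lemma iso_prof_concave:
  assumes "0 \<le> a" "a \<le> 1" "0 \<le> b" "b \<le> 1" "0 \<le> t" "t \<le> 1"
  shows "(1 - t) * iso_prof a + t * iso_prof b \<le> iso_prof ((1 - t) * a + t * b)"
proof (rule iso_prof_greatest)
  fix g :: real assume g: "g \<noteq> 0"
  have "(1 - t) * iso_prof a + t * iso_prof b \<le> (1 - t) * affine_prof g a + t * affine_prof g b"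
    using g assms by (intro add_mono mult_left_mono iso_prof_le) auto
  also have "\<dots> = affine_prof g ((1 - t) * a + t * b)"
  proof -
    obtain c where "\<And>y. affine_prof g y = g * y + c" by (simp add: affine_prof_def)
    then show ?thesis by (simp add: algebra_simps)
  qed
  finally show "(1 - t) * iso_prof a + t * iso_prof b \<le> affine_prof g ((1 - t) * a + t * b)" .
qed

text \<open>The rate tends to 0, that is, to the uniform measure, whose boundary density is
  1.\<close>

lemma iso_prof_le_1:
  assumes "0 \<le> x" "x \<le> 1"
  shows "iso_prof x \<le> 1"
proof -
  have "((\<lambda>g. affine_prof g x) \<longlongrightarrow> 1) (at_right 0)"
    unfolding affine_prof_def by real_asymp
  moreover have "eventually (\<lambda>g. iso_prof x \<le> affine_prof g x) (at_right 0)"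
    using assms by (auto simp: eventually_at_right_less intro!: iso_prof_le eventually_at_rightI[of 0 1])
  ultimately show ?thesis by (intro tendsto_lowerbound) auto
qed

lemma iso_prof_0: "iso_prof 0 = 0"
proof -
  have "((\<lambda>g. affine_prof g 0) \<longlongrightarrow> 0) at_top"
    unfolding affine_prof_def by real_asymp
  moreover have "eventually (\<lambda>g. iso_prof 0 \<le> affine_prof g 0) at_top"
    using eventually_gt_at_top[of 0] by eventually_elim (auto intro: iso_prof_le)
  ultimately have "iso_prof 0 \<le> 0" by (intro tendsto_lowerbound) auto
  then show ?thesis using iso_prof_nonneg[of 0] by simp
qed

lemma iso_prof_1: "iso_prof 1 = 0"
  using iso_prof_reflect[of 0] iso_prof_0 by simp

lemma iso_prof_scale:
  assumes "0 \<le> a" "a \<le> 1" "0 \<le> t" "t \<le> 1"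
  shows "t * iso_prof a \<le> iso_prof (t * a)"
  using iso_prof_concave[of 0 a t] assms iso_prof_0 by simp

text \<open>Both summands are compared with the chord from 0 to \<open>a + b\<close>. This lets the
  bounds for the parts of a set on either side of a point be added.\<close>

lemma iso_prof_subadd:
  assumes "0 \<le> a" "0 \<le> b" "a + b \<le> 1"
  shows "iso_prof (a + b) \<le> iso_prof a + iso_prof b"
proof (cases "a + b = 0")
  case True
  then have "a = 0" "b = 0" using assms by auto
  then show ?thesis by (simp add: iso_prof_0)
next
  case False
  define s where "s = a + b"
  have s: "s > 0" using False assms by (simp add: s_def)
  have "(a / s) * iso_prof s \<le> iso_prof ((a / s) * s)" "(b / s) * iso_prof s \<le> iso_prof ((b / s) * s)"
    using assms s by (intro iso_prof_scale; simp add: s_def)+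
  moreover have "(a / s) * iso_prof s + (b / s) * iso_prof s = iso_prof s"
    using s by (simp add: add_divide_distrib[symmetric] distrib_right[symmetric] s_def)
  ultimately show ?thesis using s by (simp add: s_def)
qed

text \<open>\<open>u\<close> is a convex combination of \<open>v\<close> and \<open>1 - v\<close>,
  where the profile takes the same value.\<close>

lemma iso_prof_mono_central:
  assumes "0 \<le> v" "v \<le> u" "u \<le> 1 - v"
  shows "iso_prof v \<le> iso_prof u"
proof (cases "v = 1 - v")
  case True
  then have "u = v" using assms by linarith
  then show ?thesis by simp
next
  case False
  then have l: "1 - 2 * v > 0" using assms by auto
  define t where "t = (u - v) / (1 - 2 * v)"
  have t: "0 \<le> t" "t \<le> 1" using assms l by (auto simp: t_def)
  have "(1 - t) * v + t * (1 - v) = v + t * (1 - 2 * v)" by (simp add: algebra_simps)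
  also have "\<dots> = u" using l by (simp add: t_def)
  finally have "u = (1 - t) * v + t * (1 - v)" by simp
  moreover have "(1 - t) * iso_prof v + t * iso_prof (1 - v) \<le> iso_prof ((1 - t) * v + t * (1 - v))"
    using assms t by (intro iso_prof_concave) auto
  moreover have "(1 - t) * iso_prof v + t * iso_prof (1 - v) = iso_prof v"
    using iso_prof_reflect[of v] assms by (simp add: algebra_simps)
  ultimately show ?thesis by simp
qed

text \<open>Over a length \<open>t\<close> the chord from \<open>x\<close> to 1, where the profile
  vanishes, falls by at most the fraction \<open>2 * t\<close>, since \<open>1 - x\<close> is at
  least 1/2. This exchanges the profile at an unknown mass just above \<open>x\<close> for the
  profile at \<open>x\<close>.\<close>

lemma iso_prof_shift:
  assumes "0 \<le> x" "x \<le> 1/2" "x \<le> y" "y \<le> x + t" "y \<le> 1"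
  shows "(1 - 2 * t) * iso_prof x \<le> iso_prof y"
proof -
  define s where "s = (y - x) / (1 - x)"
  have s: "0 \<le> s" "s \<le> 1" using assms by (auto simp: s_def)
  have "s * (1 - x) = y - x" using assms by (simp add: s_def)
  then have y: "y = (1 - s) * x + s * 1" by (simp add: algebra_simps)
  have "s \<le> 2 * (y - x)"
    using assms mult_left_mono[of "1/2" "1 - x" "2 * (y - x)"] by (simp add: s_def divide_simps)
  then have "s \<le> 2 * t" using assms by auto
  then have "(1 - 2 * t) * iso_prof x \<le> (1 - s) * iso_prof x"
    using iso_prof_nonneg[of x] assms by (intro mult_right_mono) auto
  also have "\<dots> \<le> iso_prof y"
    using iso_prof_concave[of x 1 s] assms s y iso_prof_1 by simp
  finally show ?thesis .
qed

section \<open>Optimal rates and the function \<open>G\<close>\<close>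

text \<open>The derivative \<open>(x - 1) * exp x + 1\<close> is positive because
  \<open>1 - x < exp (-x)\<close>. The expression decides both the sign of the derivative of
  \<open>gaux\<close> and the comparison at mass 1/2.\<close>

lemma exp_cubic_remainder_pos: assumes "x > (0::real)" shows "(x - 2) * exp x + x + 2 > 0"
proof -
  let ?f = "\<lambda>x::real. (x - 2) * exp x + x + 2" and ?g = "\<lambda>x::real. (x - 1) * exp x + 1"
  have g: "?g y > 0" if "y > 0" for y :: real
  proof -
    have "1 - y < exp (-y)" using that exp_minus_greater[of y] by auto
    then have "(1 - y) * exp y < exp (-y) * exp y" by (intro mult_strict_right_mono) auto
    then show ?thesis by (simp add: exp_minus algebra_simps)
  qed
  have "\<exists>D. (?f has_real_derivative D) (at y) \<and> D > 0" if "0 < y" "y < x" for y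
    using g[OF that(1)] 
    by (intro exI[of _ "(y - 1) * exp y + 1"]) (auto intro!: derivative_eq_intros simp: algebra_simps)
  then have "?f 0 < ?f x" 
    using assms by (intro DERIV_pos_imp_increasing_open[of 0 x ?f]) (auto intro!: continuous_intros)
  then show ?thesis by simp
qed

lemma gaux_deriv: 
  assumes "x > 0"
  shows "(gaux has_real_derivative - (exp x * ((x - 2) * exp x + x + 2) / (exp x - 1) ^ 3)) (at x)"
proof -
  define u where "u = exp x - 1"
  have u: "u \<noteq> 0" using assms by (simp add: u_def)
  have "((\<lambda>x. (exp x * (x - 1) + 1) / (exp x - 1)\<^sup>2) has_real_derivative
     ((exp x * (x - 1) + exp x) * (exp x - 1)\<^sup>2 - (exp x * (x - 1) + 1) * (2 * (exp x - 1) * exp x)) 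
       / ((exp x - 1)\<^sup>2 * (exp x - 1)\<^sup>2)) (at x)"
    using u unfolding u_def by (auto intro!: derivative_eq_intros)
  also have "(exp x * (x - 1) + exp x) * (exp x - 1)\<^sup>2 - (exp x * (x - 1) + 1) * (2 * (exp x - 1) * exp x)
     = u * (- (exp x * ((x - 2) * exp x + x + 2)))"
    by (simp add: u_def algebra_simps power2_eq_square)
  also have "(exp x - 1)\<^sup>2 * (exp x - 1)\<^sup>2 = u * u ^ 3"
    by (simp add: u_def power2_eq_square power3_eq_cube)
  also have "u * (- (exp x * ((x - 2) * exp x + x + 2))) / (u * u ^ 3)
     = - (exp x * ((x - 2) * exp x + x + 2) / (exp x - 1) ^ 3)"
    using u by (simp add: u_def)
  finally show ?thesis unfolding gaux_def[abs_def] .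
qed

lemma gaux_decreasing: assumes "0 < a" "a < b" shows "gaux b < gaux a"
proof (rule DERIV_neg_imp_decreasing[OF assms(2)])
  fix x assume "a \<le> x" "x \<le> b"
  then have x: "x > 0" using assms by auto
  then show "\<exists>y. (gaux has_real_derivative y) (at x) \<and> y < 0"
    using exp_cubic_remainder_pos[OF x] x 
    by (intro exI[of _ "- (exp x * ((x - 2) * exp x + x + 2) / (exp x - 1) ^ 3)"] conjI gaux_deriv[OF x]) simp
qed

lemma gaux_exists: assumes "0 < x" "x < 1/2" shows "\<exists>g>0. gaux g = x"
proof -
  have l0: "(gaux \<longlongrightarrow> 1/2) (at_right 0)" unfolding gaux_def[abs_def] by real_asymp
  have l1: "(gaux \<longlongrightarrow> 0) at_top" unfolding gaux_def[abs_def] by real_asymp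
  from order_tendstoD(1)[OF l0, of x] assms obtain b where b: "b > 0" "\<And>y. 0 < y \<Longrightarrow> y < b \<Longrightarrow> x < gaux y"
    by (auto simp: eventually_at_right_field)
  from order_tendstoD(2)[OF l1, of x] assms obtain B where B: "\<And>y. y \<ge> B \<Longrightarrow> gaux y < x"
    by (auto simp: eventually_at_top_linorder)
  define B' where "B' = max B (b/2)"
  have "\<exists>g\<ge>b/2. g \<le> B' \<and> gaux g = x"
  proof (rule IVT2)
    show "gaux B' \<le> x" using B[of B'] by (simp add: B'_def)
    show "x \<le> gaux (b/2)" using b by (intro less_imp_le b) auto
    show "b / 2 \<le> B'" by (simp add: B'_def)
    show "\<forall>t. b / 2 \<le> t \<and> t \<le> B' \<longrightarrow> isCont gaux t"
      using b by (auto intro!: DERIV_isCont[OF gaux_deriv])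
  qed
  then show ?thesis using b by (metis half_gt_zero less_le_trans)
qed

text \<open>This explains \<open>gaux\<close>: the equation \<open>gaux g = x\<close> is the
  stationarity condition for the rate, so the \<gamma> in the definition of \<open>G\<close> is the
  optimal rate. Since \<open>gaux\<close> decreases, the stationary point is a minimum.\<close>

lemma affine_prof_deriv:
  assumes "g > 0"
  shows "((\<lambda>g. affine_prof g x) has_real_derivative (x - gaux g)) (at g)"
proof -
  have "exp g - 1 > 0" using assms by simp
  then show ?thesis unfolding affine_prof_def gaux_def
    apply (auto intro!: derivative_eq_intros)
    apply (simp add: divide_simps power2_eq_square)
    apply (simp add: algebra_simps)
    done
qed

lemma affine_prof_min:
  assumes "0 < g" "gaux g = x" "0 < h"
  shows "affine_prof g x \<le> affine_prof h x"
proof -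
  consider "g = h" | "g < h" | "h < g" by linarith
  then show ?thesis
  proof cases
    case 2
    show ?thesis
    proof (rule DERIV_nonneg_imp_nondecreasing[of g h "\<lambda>g. affine_prof g x"])
      show "g \<le> h" using 2 by simp
      fix y assume "g \<le> y" "y \<le> h"
      then show "\<exists>D. ((\<lambda>g. affine_prof g x) has_real_derivative D) (at y) \<and> 0 \<le> D"
        using assms gaux_decreasing[of g y] by (cases "y = g") (auto intro!: exI affine_prof_deriv)
    qed
  next
    case 3
    show ?thesis
    proof (rule DERIV_nonpos_imp_nonincreasing[of h g "\<lambda>g. affine_prof g x"])
      show "h \<le> g" using 3 by simp
      fix y assume "h \<le> y" "y \<le> g"
      then show "\<exists>D. ((\<lambda>g. affine_prof g x) has_real_derivative D) (at y) \<and> D \<le> 0"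
        using assms gaux_decreasing[of y g] by (cases "y = g") (auto intro!: exI affine_prof_deriv)
    qed
  qed auto
qed

text \<open>At mass 1/2 the infimum 1 is only approached, as the rate tends to 0. No stationary rate
  exists there, which matches the separate value \<open>G 2 = 2\<close>.\<close>

lemma affine_prof_ge_half: assumes "g > 0" shows "1 \<le> affine_prof g (1/2)"
proof -
  have "(g - 2) * exp g + g + 2 > 0" using exp_cubic_remainder_pos[OF assms] .
  moreover have "exp g - 1 > 0" using assms by simp
  ultimately show ?thesis by (simp add: affine_prof_def divide_simps) (simp add: algebra_simps)
qed

text \<open>For masses up to 1/2 negative rates never beat positive ones, so the minimum over
  positive rates, which \<open>G\<close> encodes, is the whole infimum.\<close>

lemma affine_prof_le_minus: 
  assumes "0 < g" "x \<le> 1/2" 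
  shows "affine_prof g x \<le> affine_prof (-g) x"
proof -
  have "g * x \<le> g * (1 - x)" using assms by (intro mult_left_mono) auto
  then show ?thesis using affine_prof_minus[of g x] assms(1) by (simp add: affine_prof_def)
qed

lemma iso_prof_eq_G:
  assumes "0 < x" "x \<le> 1/2"
  shows "iso_prof x = x * G (1 / x)"
proof (cases "x = 1/2")
  case True
  have "1 \<le> iso_prof (1/2)"
  proof (rule iso_prof_greatest)
    fix g :: real assume "g \<noteq> 0"
    then consider "g > 0" | "-g > 0" by linarith
    then show "1 \<le> affine_prof g (1/2)"
      by cases (use affine_prof_ge_half[of g] affine_prof_ge_half[of "-g"] 
         affine_prof_le_minus[of "-g" "1/2"] in auto)
  qed
  moreover have "iso_prof (1/2) \<le> 1" by (intro iso_prof_le_1) auto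
  ultimately have "iso_prof x = 1" unfolding True by (rule antisym[rotated])
  moreover have "1 / x = 2" unfolding True by simp
  ultimately show ?thesis unfolding G_def by (simp add: True)
next
  case False
  then obtain g where g: "g > 0" "gaux g = x" using gaux_exists[of x] assms by auto
  have the: "(THE \<gamma>. \<gamma> > 0 \<and> gaux \<gamma> = 1 / (1 / x)) = g"
    using g gaux_decreasing by (intro the_equality) (auto, metis less_irrefl linorder_neqE_linordered_idom)
  have "iso_prof x \<ge> affine_prof g x"
  proof (rule iso_prof_greatest)
    fix h :: real assume "h \<noteq> 0"
    then consider "h > 0" | "-h > 0" by linarith
    then show "affine_prof g x \<le> affine_prof h x"
      by cases (use affine_prof_min[OF g] affine_prof_le_minus[of "-h" x] assms in fastforce)+
  qed
  then have I: "iso_prof x = affine_prof g x" using iso_prof_le[of g x] g assms by auto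
  have e: "exp g - 1 > 0" using g by simp
  have e2: "exp g * (g - 1) + 1 > 0" 
    using g(2) assms(1) e by (auto simp: gaux_def zero_less_divide_iff)
  have "1/x \<noteq> 2" using False assms by (simp add: field_simps)
  then have G: "G (1/x) = g\<^sup>2 * exp g / (exp g * (g - 1) + 1)" unfolding G_def the Let_def by simp
  have "affine_prof g x = x * (g\<^sup>2 * exp g / (exp g * (g - 1) + 1))"
    unfolding g(2)[symmetric] using e e2
    by (simp add: affine_prof_def gaux_def divide_simps power2_eq_square) (simp add: algebra_simps)
  then show ?thesis using I G by simp
qed

section \<open>Log-concave sequences\<close>

text \<open>The third clause forbids internal zeros. It does not follow from the quadratic
  inequality, which 1, 0, 0, 1 satisfies, and the comparison of ratios depends on it.\<close>

definition log_concave_seq :: "nat \<Rightarrow> (nat \<Rightarrow> real) \<Rightarrow> bool" where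
  "log_concave_seq n c \<longleftrightarrow> (\<forall>i<n. 0 \<le> c i) \<and>
     (\<forall>i. Suc (Suc i) < n \<longrightarrow> c i * c (Suc (Suc i)) \<le> (c (Suc i))\<^sup>2) \<and>
     (\<forall>i j l. i < j \<longrightarrow> j < l \<longrightarrow> l < n \<longrightarrow> 0 < c i \<longrightarrow> 0 < c l \<longrightarrow> 0 < c j)"

lemma log_concave_seqD:
  assumes "log_concave_seq n c"
  shows "i < n \<Longrightarrow> 0 \<le> c i"
    and "Suc (Suc i) < n \<Longrightarrow> c i * c (Suc (Suc i)) \<le> (c (Suc i))\<^sup>2"
    and "i < j \<Longrightarrow> j < l \<Longrightarrow> l < n \<Longrightarrow> 0 < c i \<Longrightarrow> 0 < c l \<Longrightarrow> 0 < c j"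
  using assms unfolding log_concave_seq_def by blast+

lemma log_concave_seq_reflect:
  assumes "log_concave_seq n c"
  shows "log_concave_seq n (\<lambda>i. c (n - Suc i))"
  unfolding log_concave_seq_def
proof (intro conjI allI impI)
  fix i assume "i < n" then show "0 \<le> c (n - Suc i)"
    using log_concave_seqD(1)[OF assms] by simp
next
  fix i assume i: "Suc (Suc i) < n"
  define j where "j = n - Suc (Suc (Suc i))"
  have "n - Suc i = Suc (Suc j)" "n - Suc (Suc i) = Suc j" "Suc (Suc j) < n"
    using i by (auto simp: j_def)
  then show "c (n - Suc i) * c (n - Suc (Suc (Suc i))) \<le> (c (n - Suc (Suc i)))\<^sup>2"
    using log_concave_seqD(2)[OF assms, of j] by (simp add: j_def mult.commute)
next
  fix i j l assume "i < j" "j < l" "l < n" "0 < c (n - Suc i)" "0 < c (n - Suc l)"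
  then show "0 < c (n - Suc j)"
    by (intro log_concave_seqD(3)[OF assms, of "n - Suc l" "n - Suc j" "n - Suc i"]) auto
qed

text \<open>Successive ratios of a log-concave sequence do not increase, so a bound \<open>q\<close>
  on the ratio at \<open>k\<close> persists and gives geometric domination beyond
  \<open>k\<close>.\<close>

lemma log_concave_seq_forward:
  assumes lc: "log_concave_seq n c" and ck: "0 < c k" and q: "0 < q"
    and base: "Suc k < n \<Longrightarrow> c (Suc k) \<le> q * c k"
  shows "k + j < n \<Longrightarrow> c (k + j) \<le> q ^ j * c k"
proof -
  have step: "c (Suc (k + j)) \<le> q * c (k + j)" if "Suc (k + j) < n" for j
    using that
  proof (induction j)
    case 0 then show ?case using base by simp
  next
    case (Suc j)
    have IH: "c (Suc (k + j)) \<le> q * c (k + j)" using Suc by simp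
    let ?i = "k + j"
    have n: "Suc (Suc ?i) < n" using Suc.prems by simp
    have nn: "0 \<le> c ?i" "0 \<le> c (Suc ?i)" "0 \<le> c (Suc (Suc ?i))"
      using n log_concave_seqD(1)[OF lc] by auto
    show ?case
    proof (cases "c ?i = 0")
      case True
      \<comment> \<open>There is no ratio to compare here; a zero beyond \<open>k\<close> cannot be
        followed by a positive term, since it would be internal.\<close>
      then have "j \<noteq> 0" using ck by (intro notI) auto
      then have "\<not> 0 < c (Suc (Suc ?i))"
        using log_concave_seqD(3)[OF lc, of k ?i "Suc (Suc ?i)"] ck True n by auto
      then show ?thesis using nn q by simp
    next
      case False
      have "c ?i * c (Suc (Suc ?i)) \<le> c (Suc ?i) * c (Suc ?i)"
        using log_concave_seqD(2)[OF lc n] by (simp add: power2_eq_square)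
      also have "\<dots> \<le> (q * c ?i) * c (Suc ?i)" using IH nn by (intro mult_right_mono) auto
      finally have "c ?i * c (Suc (Suc ?i)) \<le> c ?i * (q * c (Suc ?i))" by (simp add: ac_simps)
      then show ?thesis using False nn by (simp add: mult_le_cancel_left)
    qed
  qed
  show "k + j < n \<Longrightarrow> c (k + j) \<le> q ^ j * c k"
  proof (induction j)
    case (Suc j)
    have "c (Suc (k + j)) \<le> q * c (k + j)" using Suc.prems by (intro step) simp
    also have "\<dots> \<le> q * (q ^ j * c k)" using Suc q by (intro mult_left_mono) auto
    finally show ?case by simp
  qed simp
qed

lemma log_concave_seq_backward:
  assumes lc: "log_concave_seq n c" and ck: "0 < c k" and q: "0 < q" and k: "k < n"
    and base: "0 < k \<Longrightarrow> c (k - 1) * q \<le> c k"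
    and i: "i \<le> k"
  shows "c i * q ^ (k - i) \<le> c k"
proof -
  let ?k = "n - Suc k"
  have "c (n - Suc (?k + (k - i))) \<le> (1 / q) ^ (k - i) * c (n - Suc ?k)"
  proof (rule log_concave_seq_forward[OF log_concave_seq_reflect[OF lc]])
    show "0 < c (n - Suc ?k)" "0 < 1 / q" "?k + (k - i) < n" using ck q k i by auto
    assume "Suc ?k < n"
    then have "0 < k" "n - Suc (Suc ?k) = k - 1" "n - Suc ?k = k" using k by auto
    then show "c (n - Suc (Suc ?k)) \<le> 1 / q * c (n - Suc ?k)"
      using base q by (simp add: field_simps)
  qed
  moreover have "n - Suc (?k + (k - i)) = i" "n - Suc ?k = k" using k i by auto
  ultimately have "c i \<le> (1 / q) ^ (k - i) * c k" by metis
  then show ?thesis using q by (simp add: power_one_over field_simps)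
qed

text \<open>The extremal sequence is geometric with ratio \<open>q\<close>. Dominating the cells on
  both sides of \<open>k\<close> by it gives two inequalities, for \<open>u\<close> and for
  \<open>1 - u\<close>; eliminating between them compares \<open>c k\<close> with the boundary
  density of the exponential measure with \<open>exp \<gamma> = q ^ n\<close>. For
  \<open>1 \<le> q\<close> the smallest density of the cell is at its left end, which is why the
  partial sum stops before \<open>k\<close>.\<close>

lemma cell_bound_increasing:
  assumes lc: "log_concave_seq n c" and sum1: "(\<Sum>i<n. c i) = 1"
    and k: "k < n" and ck: "0 < c k" and q: "1 \<le> q" 
    and up: "Suc k < n \<Longrightarrow> c (Suc k) \<le> q * c k"
    and down: "0 < k \<Longrightarrow> c (k - 1) * q \<le> c k"
  shows "iso_prof (\<Sum>i<k. c i) \<le> n * c k"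
proof -
  define u where "u = (\<Sum>i<k. c i)"
  have split: "{..<n} = {..<k} \<union> {k..<n}" using k by auto
  have w: "1 - u = (\<Sum>i=k..<n. c i)"
    unfolding u_def sum1[symmetric] split by (subst sum.union_disjoint) auto
  have nn: "\<And>i. i < n \<Longrightarrow> 0 \<le> c i" using log_concave_seqD(1)[OF lc] .
  have u0: "0 \<le> u" unfolding u_def using nn k by (intro sum_nonneg) auto
  have "0 \<le> 1 - u" unfolding w using nn by (intro sum_nonneg) auto
  then have u1: "u \<le> 1" by simp
  have "(\<Sum>i<k. c i * q ^ k) \<le> (\<Sum>i<k. c k * q ^ i)"
  proof (rule sum_mono)
    fix i assume i: "i \<in> {..<k}"
    have "c i * q ^ (k - i) * q ^ i \<le> c k * q ^ i"
      using i q by (intro mult_right_mono log_concave_seq_backward[OF lc ck _ k down]) auto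
    then show "c i * q ^ k \<le> c k * q ^ i"
      using i by (simp add: mult.assoc power_add[symmetric])
  qed
  then have U: "u * q ^ k \<le> c k * (\<Sum>i<k. q ^ i)"
    by (simp add: u_def sum_distrib_right sum_distrib_left)
  have "(\<Sum>i=k..<n. c i) = (\<Sum>j<n - k. c (k + j))"
    using k by (intro sum.reindex_bij_witness[of _ "\<lambda>j. k + j" "\<lambda>i. i - k"]) auto
  also have "\<dots> \<le> (\<Sum>j<n - k. q ^ j * c k)"
    using q by (intro sum_mono log_concave_seq_forward[OF lc ck _ up]) auto
  finally have W: "1 - u \<le> c k * (\<Sum>i<n - k. q ^ i)"
    unfolding w by (simp add: sum_distrib_left mult.commute)
  show ?thesis
  proof (cases "q = 1")
    case True
    then have "u \<le> c k * k" "1 - u \<le> c k * (n - k)" using U W k by (simp_all add: of_nat_diff)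
    then have "1 \<le> n * c k" using k by (simp add: of_nat_diff algebra_simps)
    then show ?thesis using iso_prof_le_1[OF u0 u1] by (simp add: u_def)
  next
    case False
    then have q1: "q > 1" using q by simp
    \<comment> \<open>Chosen so that \<open>c k\<close> times a geometric sum becomes
      \<open>\<phi> * (q ^ j - 1)\<close>.\<close>
    define \<phi> where "\<phi> = c k / (q - 1)"
    have \<phi>: "\<phi> > 0" "c k = \<phi> * (q - 1)" using ck q1 by (auto simp: \<phi>_def)
    have geo: "c k * (\<Sum>i<j. q ^ i) = \<phi> * (q ^ j - 1)" for j
      using q1 \<phi>(2) geometric_sum[of q j] by simp
    have "u * q ^ k \<le> \<phi> * (q ^ k - 1)" using U by (simp add: geo)
    then have 1: "\<phi> \<le> q ^ k * (\<phi> - u)" by (simp add: algebra_simps)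
    have "\<phi> + (1 - u) \<le> \<phi> * q ^ (n - k)" using W unfolding geo by (simp add: algebra_simps)
    also have "\<dots> \<le> (q ^ k * (\<phi> - u)) * q ^ (n - k)" using 1 q by (intro mult_right_mono) auto
    also have "\<dots> = q ^ n * (\<phi> - u)" using k by (simp add: power_add[symmetric] mult.assoc mult.left_commute)
    finally have 2: "1 + u * (q ^ n - 1) \<le> \<phi> * (q ^ n - 1)" by (simp add: algebra_simps)
    have n0: "n > 0" using k by simp
    have qn: "q ^ n - 1 > 0" using q1 n0 by (simp add: one_less_power)
    \<comment> \<open>A cell has length \<open>1 / n\<close>, so the ratio \<open>q\<close> per cell
      corresponds to the rate \<open>n * ln q\<close>. Replacing \<open>ln q\<close> by
      \<open>q - 1\<close> later goes in the right direction because \<phi> is positive.\<close>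
    define \<gamma> where "\<gamma> = n * ln q"
    have \<gamma>: "\<gamma> > 0" "exp \<gamma> = q ^ n" using q1 n0 by (auto simp: \<gamma>_def exp_of_nat_mult)
    have "u + 1 / (q ^ n - 1) \<le> \<phi>" using 2 qn by (simp add: field_simps)
    then have "affine_prof \<gamma> u \<le> \<gamma> * \<phi>" 
      using \<gamma> mult_left_mono[of "u + 1 / (q ^ n - 1)" \<phi> \<gamma>] 
      by (simp add: affine_prof_def distrib_left)
    also have "\<gamma> \<le> n * (q - 1)" using ln_le_minus_one[of q] q1 by (simp add: \<gamma>_def mult_left_mono)
    then have "\<gamma> * \<phi> \<le> n * (q - 1) * \<phi>" using \<phi> by (intro mult_right_mono) auto
    also have "\<dots> = n * c k" using \<phi> by simp
    finally show ?thesis using iso_prof_le[of \<gamma> u] \<gamma> u0 u1 by (simp add: u_def)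
  qed
qed

text \<open>The smallest density within a cell sits at its left end if the sequence rises there and
  at its right end if it falls; hence the minimum over the two partial sums.\<close>

lemma cell_bound:
  assumes lc: "log_concave_seq n c" and sum1: "(\<Sum>i<n. c i) = 1" and k: "k < n"
  shows "min (iso_prof (\<Sum>i<k. c i)) (iso_prof (\<Sum>i<Suc k. c i)) \<le> n * c k"
proof -
  have nn: "\<And>i. i < n \<Longrightarrow> 0 \<le> c i" using log_concave_seqD(1)[OF lc] .
  have split: "{..<n} = {..<Suc k} \<union> {Suc k..<n}" using k by auto
  have w: "1 = (\<Sum>i<Suc k. c i) + (\<Sum>i=Suc k..<n. c i)"
    unfolding sum1[symmetric] split by (subst sum.union_disjoint) auto
  show ?thesis
  proof (cases "c k = 0")
    case True
    \<comment> \<open>Around an empty cell all mass lies on one side, and the profile vanishes at 0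
      and at 1.\<close>
    have "(\<Sum>i<k. c i) = 0 \<or> (\<Sum>i=Suc k..<n. c i) = 0"
    proof (rule ccontr)
      assume "\<not> ?thesis"
      then have "\<not> (\<forall>i\<in>{..<k}. c i = 0)" "\<not> (\<forall>l\<in>{Suc k..<n}. c l = 0)"
        using sum.neutral[of "{..<k}" c] sum.neutral[of "{Suc k..<n}" c] by blast+
      then obtain i l where "i < k" "c i \<noteq> 0" "Suc k \<le> l" "l < n" "c l \<noteq> 0" by auto
      then have "0 < c k" using nn[of i] nn[of l] k by (intro log_concave_seqD(3)[OF lc, of i k l]) auto
      then show False using True by simp
    qed
    then show ?thesis using w True iso_prof_0 iso_prof_1 by (auto simp del: sum.lessThan_Suc)
  next
    case False
    then have ck: "0 < c k" using nn[OF k] by simp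
    \<comment> \<open>Any \<open>q\<close> between the ratios on the two sides of \<open>k\<close>
      serves. A vanishing neighbour imposes no condition, and if both vanish \<open>q = 1\<close>
      will do.\<close>
    have "\<exists>q>0. (Suc k < n \<longrightarrow> c (Suc k) \<le> q * c k) \<and> (0 < k \<longrightarrow> c (k - 1) * q \<le> c k)"
    proof (cases "Suc k < n \<and> 0 < c (Suc k)")
      case True
      have "c (k - 1) * (c (Suc k) / c k) \<le> c k" if "0 < k"
        using log_concave_seqD(2)[OF lc, of "k - 1"] that True ck
        by (simp add: divide_simps power2_eq_square)
      then show ?thesis using True ck by (intro exI[of _ "c (Suc k) / c k"]) auto
    next
      case up: False
      then have up: "Suc k < n \<Longrightarrow> c (Suc k) = 0" using nn[of "Suc k"] by auto
      show ?thesis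
      proof (cases "0 < k \<and> 0 < c (k - 1)")
        case True
        then show ?thesis using ck up by (intro exI[of _ "c k / c (k - 1)"]) auto
      next
        case False
        then have "0 < k \<Longrightarrow> c (k - 1) = 0" using nn[of "k - 1"] k by auto
        then show ?thesis using ck up by (intro exI[of _ 1]) auto
      qed
    qed
    then obtain q where q: "q > 0" and up: "Suc k < n \<Longrightarrow> c (Suc k) \<le> q * c k"
      and down: "0 < k \<Longrightarrow> c (k - 1) * q \<le> c k" by blast
    show ?thesis
    proof (cases "1 \<le> q")
      case True
      then show ?thesis using cell_bound_increasing[OF lc sum1 k ck True up down] by auto
    next
      case False
      \<comment> \<open>Falling case: in the reversed sequence the partial sum up to
        \<open>?k\<close> is the mass after cell \<open>k\<close>, the complement of the partial sum
        up to \<open>Suc k\<close>.\<close>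
      let ?k = "n - Suc k"
      have kk: "n - Suc ?k = k" using k by simp
      have "iso_prof (\<Sum>i<?k. c (n - Suc i)) \<le> n * c (n - Suc ?k)"
      proof (rule cell_bound_increasing[OF log_concave_seq_reflect[OF lc]])
        show "(\<Sum>i<n. c (n - Suc i)) = 1" unfolding sum1[symmetric] by (rule sum.nat_diff_reindex)
        show "1 \<le> 1 / q" using q False by simp
        show "?k < n" "0 < c (n - Suc ?k)" using k ck by auto
      next
        assume "Suc ?k < n"
        then have "0 < k" "n - Suc (Suc ?k) = k - 1" using k by auto
        then show "c (n - Suc (Suc ?k)) \<le> 1 / q * c (n - Suc ?k)" 
          using down q kk by (simp add: field_simps)
      next
        assume "0 < ?k"
        then have "Suc k < n" "n - Suc (?k - 1) = Suc k" using k by auto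
        then show "c (n - Suc (?k - 1)) * (1 / q) \<le> c (n - Suc ?k)"
          using up q kk by (simp add: field_simps)
      qed
      moreover have "(\<Sum>i<?k. c (n - Suc i)) = (\<Sum>i=Suc k..<n. c i)"
        using k by (intro sum.reindex_bij_witness[of _ "\<lambda>i. n - Suc i" "\<lambda>i. n - Suc i"]) auto
      moreover have nonneg: "0 \<le> (\<Sum>i<Suc k. c i)" "0 \<le> (\<Sum>i=Suc k..<n. c i)"
        using nn k by (auto intro!: sum_nonneg simp del: sum.lessThan_Suc)
      have e: "(\<Sum>i=Suc k..<n. c i) = 1 - (\<Sum>i<Suc k. c i)" using w by linarith
      have "iso_prof (\<Sum>i=Suc k..<n. c i) = iso_prof (\<Sum>i<Suc k. c i)"
        unfolding e using nonneg e by (intro iso_prof_reflect) linarith+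
      ultimately show ?thesis using kk by (simp del: sum.lessThan_Suc)
    qed
  qed
qed


section \<open>Separated families of cells\<close>

text \<open>Every cut inside the gap leaves mass at least \<open>v\<close> on both sides, so the
  profile there is at least its value at \<open>v\<close>. Each of the cells in the gap, at least
  \<open>m\<close> in number, contributes this much.\<close>

lemma gap_bound:
  fixes c :: "nat \<Rightarrow> real" and m n g g' :: nat
  assumes nn: "\<And>i. i < n \<Longrightarrow> 0 \<le> c i" and sum1: "(\<Sum>i<n. c i) = 1"
    and cell: "\<And>k. k < n \<Longrightarrow> min (iso_prof (\<Sum>i<k. c i)) (iso_prof (\<Sum>i<Suc k. c i)) \<le> n * c k"
    and g: "g + m \<le> g'" "g' \<le> n" and v: "0 \<le> v" "v \<le> (\<Sum>i<g. c i)" "(\<Sum>i<g'. c i) \<le> 1 - v"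
  shows "m * iso_prof v \<le> n * sum c {g..<g'}"
proof -
  have mono: "(\<Sum>i<a. c i) \<le> (\<Sum>i<b. c i)" if "a \<le> b" "b \<le> n" for a b
    using that nn by (intro sum_mono2) auto
  have *: "iso_prof v \<le> iso_prof (\<Sum>i<k. c i)" if "g \<le> k" "k \<le> g'" for k
    using mono[of g k] mono[of k g'] that v g by (intro iso_prof_mono_central) auto
  have "v \<le> 1" using v mono[of g g'] g by linarith
  have "m * iso_prof v \<le> real (g' - g) * iso_prof v"
    using g v iso_prof_nonneg[of v] \<open>v \<le> 1\<close> by (intro mult_right_mono) auto
  also have "\<dots> = (\<Sum>k=g..<g'. iso_prof v)" by simp
  also have "\<dots> \<le> (\<Sum>k=g..<g'. n * c k)"
  proof (rule sum_mono)
    fix k assume k: "k \<in> {g..<g'}"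
    then have "iso_prof v \<le> min (iso_prof (\<Sum>i<k. c i)) (iso_prof (\<Sum>i<Suc k. c i))"
      using *[of k] *[of "Suc k"] by (simp del: sum.lessThan_Suc)
    also have "\<dots> \<le> n * c k" using k g by (intro cell) auto
    finally show "iso_prof v \<le> n * c k" .
  qed
  also have "\<dots> = n * sum c {g..<g'}" by (simp add: sum_distrib_left)
  finally show ?thesis .
qed

text \<open>The element \<open>z\<close> plays the role of a median: every gap between neighbouring elements of
  opposite kind lying left of \<open>z\<close> has less mass on its left than on its right, and conversely
  right of \<open>z\<close>.\<close>

lemma separated_one_side:
  fixes c :: "nat \<Rightarrow> real" and m n :: nat
  assumes nn: "\<And>i. i < n \<Longrightarrow> 0 \<le> c i" and sum1: "(\<Sum>i<n. c i) = 1"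
    and cell: "\<And>k. k < n \<Longrightarrow> min (iso_prof (\<Sum>i<k. c i)) (iso_prof (\<Sum>i<Suc k. c i)) \<le> n * c k"
    and AB: "A \<subseteq> {..<n}" "B \<subseteq> {..<n}" "\<And>i j. i \<in> A \<Longrightarrow> j \<in> B \<Longrightarrow> i + m < j \<or> j + m < i"
    and z: "z \<in> A"
    and L: "\<And>a d. a \<in> A \<Longrightarrow> d \<in> B \<Longrightarrow> d < a \<Longrightarrow> a \<le> z \<Longrightarrow> {d<..<a} \<inter> (A \<union> B) = {} \<Longrightarrow>
              (\<Sum>i<Suc d. c i) + (\<Sum>i<a. c i) \<le> 1"
    and R: "\<And>a d. a \<in> A \<Longrightarrow> d \<in> B \<Longrightarrow> z \<le> a \<Longrightarrow> a < d \<Longrightarrow> {a<..<d} \<inter> (A \<union> B) = {} \<Longrightarrow>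
              1 \<le> (\<Sum>i<Suc a. c i) + (\<Sum>i<d. c i)"
  shows "m * iso_prof (sum c B) \<le> n * sum c ({..<n} - A - B)"
proof -
  let ?C = "{..<n} - A - B"
  have fin: "finite A" "finite B" using AB(1,2) finite_subset by blast+
  have sub_le: "sum c X \<le> sum c Y" if "X \<subseteq> Y" "Y \<subseteq> {..<n}" for X Y
    using that nn finite_subset[of Y "{..<n}"] by (intro sum_mono2) auto
  have zB: "z \<notin> B" using AB(3)[of z z] z by auto
  \<comment> \<open>\<open>d\<close> is the last element of \<open>B\<close> before \<open>z\<close>
    and \<open>a\<close> the first element of \<open>A\<close> after \<open>d\<close>. The gap
    between them has all of \<open>B\<close> before \<open>z\<close> on its left and, by
    \<open>L\<close>, at least as much mass on its right.\<close>
  have left: "m * iso_prof (sum c (B \<inter> {..<z})) \<le> n * sum c (?C \<inter> {..<z})"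
  proof (cases "B \<inter> {..<z} = {}")
    case True
    then show ?thesis using nn by (auto simp: iso_prof_0 intro!: mult_nonneg_nonneg sum_nonneg)
  next
    case False
    define d where "d = Max (B \<inter> {..<z})"
    have d: "d \<in> B" "d < z" using Max_in[of "B \<inter> {..<z}"] False fin by (auto simp: d_def)
    have dmax: "e \<le> d" if "e \<in> B" "e < z" for e using that fin by (auto simp: d_def)
    define a where "a = Min (A \<inter> {d<..})"
    have Ane: "A \<inter> {d<..} \<noteq> {}" using z d by auto
    have a: "a \<in> A" "d < a" using Min_in[OF _ Ane] fin by (auto simp: a_def)
    have amin: "a \<le> e" if "e \<in> A" "d < e" for e using that fin by (auto simp: a_def)
    have az: "a \<le> z" using amin z d by auto
    have emp: "{d<..<a} \<inter> (A \<union> B) = {}" using amin dmax az by fastforce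
    have sep: "d + m < a" using AB(3)[of a d] a d by auto
    have "m * iso_prof (sum c (B \<inter> {..<z})) \<le> n * sum c {Suc d..<a}"
    proof (rule gap_bound[OF nn sum1 cell])
      show "Suc d + m \<le> a" "a \<le> n" using sep a AB by auto
      show "0 \<le> sum c (B \<inter> {..<z})" using AB nn by (intro sum_nonneg) auto
      show *: "sum c (B \<inter> {..<z}) \<le> (\<Sum>i<Suc d. c i)"
        using dmax d AB by (intro sub_le) (auto simp: less_Suc_eq_le)
      show "(\<Sum>i<a. c i) \<le> 1 - sum c (B \<inter> {..<z})"
        using L[OF a(1) d(1) a(2) az emp] * by linarith
    qed
    moreover have "{Suc d..<a} \<subseteq> ?C \<inter> {..<z}"
    proof
      fix k assume "k \<in> {Suc d..<a}"
      then have "k \<in> {d<..<a}" "k < a" by auto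
      moreover have "a < n" using a AB(1) by blast
      ultimately show "k \<in> ?C \<inter> {..<z}" using emp az by auto
    qed
    then have "n * sum c {Suc d..<a} \<le> n * sum c (?C \<inter> {..<z})"
      by (intro mult_left_mono sub_le) auto
    ultimately show ?thesis by linarith
  qed
  have right: "m * iso_prof (sum c (B \<inter> {z<..})) \<le> n * sum c (?C \<inter> {z<..})"
  proof (cases "B \<inter> {z<..} = {}")
    case True
    then show ?thesis using nn by (auto simp: iso_prof_0 intro!: mult_nonneg_nonneg sum_nonneg)
  next
    case False
    define d where "d = Min (B \<inter> {z<..})"
    have d: "d \<in> B" "z < d" using Min_in[of "B \<inter> {z<..}"] False fin by (auto simp: d_def)
    have dmin: "d \<le> e" if "e \<in> B" "z < e" for e using that fin by (auto simp: d_def)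
    define a where "a = Max (A \<inter> {..<d})"
    have Ane: "A \<inter> {..<d} \<noteq> {}" using z d by auto
    have a: "a \<in> A" "a < d" using Max_in[OF _ Ane] fin by (auto simp: a_def)
    have amax: "e \<le> a" if "e \<in> A" "e < d" for e using that fin by (auto simp: a_def)
    have az: "z \<le> a" using amax z d by auto
    have emp: "{a<..<d} \<inter> (A \<union> B) = {}" using amax dmin az by fastforce
    have sep: "a + m < d" using AB(3)[of a d] a d by auto
    have dn: "d < n" using d AB by auto
    have "m * iso_prof (sum c (B \<inter> {z<..})) \<le> n * sum c {Suc a..<d}"
    proof (rule gap_bound[OF nn sum1 cell])
      show "Suc a + m \<le> d" "d \<le> n" using sep dn by auto
      show "0 \<le> sum c (B \<inter> {z<..})" using AB nn by (intro sum_nonneg) auto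
      have "(\<Sum>i<d. c i) + sum c (B \<inter> {z<..}) = sum c ({..<d} \<union> (B \<inter> {z<..}))"
      proof (intro sum.union_disjoint[symmetric])
        show "{..<d} \<inter> (B \<inter> {z<..}) = {}" using dmin leD by blast
      qed (use fin in auto)
      also have "\<dots> \<le> 1" unfolding sum1[symmetric] using AB dn by (intro sub_le) auto
      finally show *: "(\<Sum>i<d. c i) \<le> 1 - sum c (B \<inter> {z<..})" by simp
      show "sum c (B \<inter> {z<..}) \<le> (\<Sum>i<Suc a. c i)"
        using R[OF a(1) d(1) az a(2) emp] * by linarith
    qed
    moreover have "{Suc a..<d} \<subseteq> ?C \<inter> {z<..}"
    proof
      fix k assume "k \<in> {Suc a..<d}"
      then have "k \<in> {a<..<d}" "k < d" "a < k" by auto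
      then show "k \<in> ?C \<inter> {z<..}" using emp az dn by auto
    qed
    then have "n * sum c {Suc a..<d} \<le> n * sum c (?C \<inter> {z<..})"
      by (intro mult_left_mono sub_le) auto
    ultimately show ?thesis by linarith
  qed
  \<comment> \<open>The element \<open>z\<close> of \<open>A\<close> splits \<open>B\<close> in two
    and separates the two gaps, so subadditivity of the profile combines both bounds.\<close>
  have Bs: "sum c (B \<inter> {..<z}) + sum c (B \<inter> {z<..}) = sum c B"
  proof -
    have "B = (B \<inter> {..<z}) \<union> (B \<inter> {z<..})" 
      using zB by (force simp: not_less_iff_gr_or_eq)
    then have "sum c B = sum c ((B \<inter> {..<z}) \<union> (B \<inter> {z<..}))" by simp
    also have "\<dots> = sum c (B \<inter> {..<z}) + sum c (B \<inter> {z<..})"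
      using fin by (intro sum.union_disjoint) auto
    finally show ?thesis ..
  qed
  have "sum c B \<le> 1" unfolding sum1[symmetric] using AB by (intro sub_le) auto
  then have "iso_prof (sum c B) \<le> iso_prof (sum c (B \<inter> {..<z})) + iso_prof (sum c (B \<inter> {z<..}))"
    unfolding Bs[symmetric] using AB nn by (intro iso_prof_subadd sum_nonneg) auto
  then have "m * iso_prof (sum c B) \<le> m * (iso_prof (sum c (B \<inter> {..<z})) + iso_prof (sum c (B \<inter> {z<..})))"
    by (intro mult_left_mono) auto
  also have "\<dots> \<le> n * (sum c (?C \<inter> {..<z}) + sum c (?C \<inter> {z<..}))"
    using left right by (simp add: distrib_left)
  also have "sum c (?C \<inter> {..<z}) + sum c (?C \<inter> {z<..}) = sum c ((?C \<inter> {..<z}) \<union> (?C \<inter> {z<..}))"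
    by (subst sum.union_disjoint) auto
  also have "n * sum c ((?C \<inter> {..<z}) \<union> (?C \<inter> {z<..})) \<le> n * sum c ?C" by (intro mult_left_mono sub_le) auto
  finally show ?thesis .
qed

text \<open>A median element exists in \<open>A \<union> B\<close>; the family that does not contain
  it is the one whose mass enters the bound. This accounts for the disjunction.\<close>

lemma separated_sets_bound:
  fixes c :: "nat \<Rightarrow> real" and m n :: nat
  assumes lc: "log_concave_seq n c" and sum1: "(\<Sum>i<n. c i) = 1"
    and AB: "A \<subseteq> {..<n}" "B \<subseteq> {..<n}" "\<And>i j. i \<in> A \<Longrightarrow> j \<in> B \<Longrightarrow> i + m < j \<or> j + m < i"
    and ne: "A \<noteq> {}"
  shows "m * iso_prof (sum c A) \<le> n * sum c ({..<n} - A - B) \<or>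
         m * iso_prof (sum c B) \<le> n * sum c ({..<n} - A - B)"
proof -
  note nn = log_concave_seqD(1)[OF lc] and cell = cell_bound[OF lc sum1]
  define E where "E = A \<union> B"
  define U where "U k = (\<Sum>i<k. c i)" for k
  have mono: "U a \<le> U b" if "a \<le> b" "b \<le> n" for a b
    unfolding U_def using that nn by (intro sum_mono2) auto
  have fin: "finite E" using AB(1,2) finite_subset[of _ "{..<n}"] by (auto simp: E_def)
  have En: "e < n" if "e \<in> E" for e using that AB by (auto simp: E_def)
  \<comment> \<open>Elements whose preceding gap, if there is one, has no more mass on its left than
    on its right. The smallest element qualifies vacuously, and the largest qualifying one is the
    median.\<close>
  define Z where "Z = {e \<in> E. \<forall>d\<in>E. d < e \<longrightarrow> {d<..<e} \<inter> E = {} \<longrightarrow> U (Suc d) + U e \<le> 1}"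
  have "E \<noteq> {}" using ne by (simp add: E_def)
  then have "Min E \<in> E" using Min_in[of E] fin by simp
  moreover have "\<not> d < Min E" if "d \<in> E" for d using Min_le[OF fin that] by simp
  ultimately have "Min E \<in> Z" unfolding Z_def by blast
  then have Zne: "Z \<noteq> {}" by auto
  define z where "z = Max Z"
  have Zfin: "finite Z" using fin by (auto simp: Z_def)
  have z: "z \<in> Z" "\<And>e. e \<in> Z \<Longrightarrow> e \<le> z" using Zne Zfin by (auto simp: z_def)
  then have zE: "z \<in> E" by (auto simp: Z_def)
  \<comment> \<open>Gaps further to the left inherit the inequality because partial sums
    increase.\<close>
  have L: "U (Suc d) + U a \<le> 1" if "a \<in> E" "d \<in> E" "d < a" "a \<le> z" "{d<..<a} \<inter> E = {}" for a d
  proof (cases "a = z")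
    case True
    then show ?thesis using z that by (auto simp: Z_def)
  next
    case False
    define p where "p = Max (E \<inter> {..<z})"
    have "E \<inter> {..<z} \<noteq> {}" using that False by auto
    then have p: "p \<in> E" "p < z" "\<And>e. e \<in> E \<Longrightarrow> e < z \<Longrightarrow> e \<le> p"
      using Max_in[of "E \<inter> {..<z}"] fin by (auto simp: p_def)
    have "{p<..<z} \<inter> E = {}" using p(3) by fastforce
    then have "U (Suc p) + U z \<le> 1" using z p by (auto simp: Z_def)
    moreover have "U (Suc d) \<le> U (Suc p)" "U a \<le> U z"
      using that False p(3)[of a] p(1,2) En[of z] zE by (auto intro!: mono)
    ultimately show ?thesis by simp
  qed
  \<comment> \<open>The right end of a gap beyond \<open>z\<close> exceeds the maximum of
    \<open>Z\<close> and therefore violates its condition, which can only be due to this very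
    gap.\<close>
  have R: "1 \<le> U (Suc a) + U d" if "a \<in> E" "d \<in> E" "z \<le> a" "a < d" "{a<..<d} \<inter> E = {}" for a d
  proof -
    have "d \<notin> Z" using z(2)[of d] that by auto
    with \<open>d \<in> E\<close> obtain e where e: "e \<in> E" "e < d" "{e<..<d} \<inter> E = {}" "\<not> U (Suc e) + U d \<le> 1"
      unfolding Z_def by blast
    have "e = a" 
    proof (rule ccontr)
      assume "e \<noteq> a"
      then have "e \<in> {a<..<d} \<or> a \<in> {e<..<d}" using e that by auto
      then show False using e that by blast
    qed
    then show ?thesis using e by simp
  qed
  show ?thesis
  proof (cases "z \<in> A")
    case True
    have "m * iso_prof (sum c B) \<le> n * sum c ({..<n} - A - B)"
    proof (rule separated_one_side[OF nn sum1 cell AB True])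
      fix a d assume ad: "a \<in> A" "d \<in> B"
      then have E: "a \<in> E" "d \<in> E" by (auto simp: E_def)
      show "(\<Sum>i<Suc d. c i) + (\<Sum>i<a. c i) \<le> 1" if "d < a" "a \<le> z" "{d<..<a} \<inter> (A \<union> B) = {}"
        using L[OF E that[folded E_def]] by (simp only: U_def)
      show "1 \<le> (\<Sum>i<Suc a. c i) + (\<Sum>i<d. c i)" if "z \<le> a" "a < d" "{a<..<d} \<inter> (A \<union> B) = {}"
        using R[OF E that[folded E_def]] by (simp only: U_def)
    qed
    then show ?thesis ..
  next
    case False
    then have zB: "z \<in> B" using zE by (auto simp: E_def)
    have "m * iso_prof (sum c A) \<le> n * sum c ({..<n} - B - A)"
    proof (rule separated_one_side[OF nn sum1 cell AB(2,1) _ zB])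
      show "i + m < j \<or> j + m < i" if "i \<in> B" "j \<in> A" for i j using AB(3)[OF that(2,1)] by blast
    next
      fix a d assume ad: "a \<in> B" "d \<in> A"
      then have E: "a \<in> E" "d \<in> E" by (auto simp: E_def)
      have BA: "B \<union> A = E" by (auto simp: E_def)
      show "(\<Sum>i<Suc d. c i) + (\<Sum>i<a. c i) \<le> 1" if "d < a" "a \<le> z" "{d<..<a} \<inter> (B \<union> A) = {}"
        using L[OF E that[unfolded BA]] by (simp only: U_def)
      show "1 \<le> (\<Sum>i<Suc a. c i) + (\<Sum>i<d. c i)" if "z \<le> a" "a < d" "{a<..<d} \<inter> (B \<union> A) = {}"
        using R[OF E that[unfolded BA]] by (simp only: U_def)
    qed
    moreover have "{..<n} - B - A = {..<n} - A - B" by auto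
    ultimately show ?thesis by simp
  qed
qed

text \<open>The masses of \<open>A\<close> and \<open>B\<close> are only bounded from below, because
  the cells that meet a set cover more than the set. The profile is thus controlled at some
  \<open>y\<close> between \<open>x\<close> and \<open>1 - b\<close>, where for \<open>B\<close> the
  reflected mass is taken. If that interval has length at least \<open>m / n\<close>, the claim
  follows from the profile being at most 1; otherwise \<open>y\<close> is within
  \<open>m / n\<close> of \<open>x\<close>.\<close>

lemma discrete_isoperimetry:
  fixes c :: "nat \<Rightarrow> real" and m n :: nat
  assumes lc: "log_concave_seq n c" and sum1: "(\<Sum>i<n. c i) = 1"
    and AB: "A \<subseteq> {..<n}" "B \<subseteq> {..<n}" "\<And>i j. i \<in> A \<Longrightarrow> j \<in> B \<Longrightarrow> i + m < j \<or> j + m < i"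
    and x: "0 < x" "x \<le> 1/2" "x \<le> sum c A" and b: "b \<le> sum c B"
  shows "(m / n) * (1 - 2 * (m / n)) * iso_prof x \<le> 1 - x - b"
proof -
  note nn = log_concave_seqD(1)[OF lc]
  define C where "C = {..<n} - A - B"
  have n0: "n > 0" using sum1 by (cases n) auto
  have disj: "A \<inter> B = {}" using AB(3) by fastforce
  have fin: "finite A" "finite B" using AB(1,2) finite_subset by blast+
  have "{..<n} = (A \<union> B) \<union> C" using AB by (auto simp: C_def)
  then have "1 = sum c (A \<union> B) + sum c C"
    unfolding sum1[symmetric] using fin by (simp only:) (rule sum.union_disjoint, auto simp: C_def)
  then have tot: "1 = sum c A + sum c B + sum c C"
    using sum.union_disjoint[OF fin disj, of c] by simp
  have C0: "0 \<le> sum c C" "0 \<le> sum c B" using nn AB by (auto intro!: sum_nonneg simp: C_def)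
  have h0: "0 \<le> m / n" by simp
  have "A \<noteq> {}" using x by auto
  from separated_sets_bound[OF lc sum1 AB this]
  have "\<exists>y\<in>{sum c A, sum c B}. m / n * iso_prof y \<le> sum c C"
    using n0 by (auto simp: C_def field_simps)
  then obtain y where y: "x \<le> y" "y \<le> 1 - b" "y \<le> 1" "m / n * iso_prof y \<le> sum c C"
  proof safe
    assume *: "m / n * iso_prof (sum c A) \<le> sum c C"
    show thesis by (rule that[OF _ _ _ *]) (use x b tot C0 in auto)
  next
    assume *: "m / n * iso_prof (sum c B) \<le> sum c C"
    have "iso_prof (1 - sum c B) = iso_prof (sum c B)"
      using tot C0 x by (intro iso_prof_reflect) auto
    then show thesis using * tot C0 x b by (intro that[of "1 - sum c B"]) auto
  qed
  show ?thesis
  proof (cases "m / n \<le> 1 - x - b")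
    case True
    have "(1 - 2 * (m / n)) * iso_prof x \<le> 1 * iso_prof x"
      using iso_prof_nonneg[of x] x by (intro mult_right_mono) auto
    also have "\<dots> \<le> 1" using iso_prof_le_1[of x] x by simp
    finally have "m / n * ((1 - 2 * (m / n)) * iso_prof x) \<le> m / n * 1"
      by (intro mult_left_mono) auto
    then show ?thesis using True by (simp add: mult.assoc)
  next
    case False
    have "m / n * ((1 - 2 * (m / n)) * iso_prof x) \<le> m / n * iso_prof y"
      using False y x by (intro mult_left_mono iso_prof_shift) auto
    also have "\<dots> \<le> 1 - x - b" using y(4) tot x b by linarith
    finally show ?thesis by (simp add: mult.assoc)
  qed
qed

section \<open>The Prekopa-Leindler inequality\<close>

text \<open>Truncation takes place at points of \<open>A\<close> itself because the one-dimensional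
  Brunn-Minkowski argument glues its two sets at such points.\<close>

lemma emeasure_lborel_initial_part:
  fixes A :: "real set"
  assumes A [measurable]: "A \<in> sets borel" and ne: "A \<noteq> {}" and e: "e < emeasure lborel A"
  shows "\<exists>a\<in>A. e < emeasure lborel (A \<inter> {..a})"
proof (rule ccontr)
  assume "\<not> ?thesis"
  then have le: "emeasure lborel (A \<inter> {..a}) \<le> e" if "a \<in> A" for a using that by (simp add: not_less)
  \<comment> \<open>The cuts increase to \<open>Sup A\<close>, or to infinity when \<open>A\<close>
    is unbounded above. At most the point \<open>Sup A\<close> escapes all of them, and it is
    null.\<close>
  define t :: "nat \<Rightarrow> real" where 
    "t n = (if bdd_above A then Sup A - 1 / Suc n else n)" for n
  have t: "\<exists>a\<in>A. t n \<le> a" for n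
  proof (cases "bdd_above A")
    case True
    then have "t n < Sup A" by (simp add: t_def)
    then show ?thesis using less_cSup_iff[OF ne True, of "t n"] by (auto intro: less_imp_le)
  next
    case False
    then obtain a where "a \<in> A" "\<not> a \<le> real n" unfolding bdd_above_def by blast
    then show ?thesis using False by (intro bexI[of _ a]) (auto simp: t_def)
  qed
  have inc: "incseq (\<lambda>n. A \<inter> {..t n})"
  proof (rule incseq_SucI)
    fix n
    have "t n \<le> t (Suc n)" by (auto simp: t_def frac_le)
    then show "A \<inter> {..t n} \<subseteq> A \<inter> {..t (Suc n)}" by auto
  qed
  have "emeasure lborel (\<Union>n. A \<inter> {..t n}) = (SUP n. emeasure lborel (A \<inter> {..t n}))"
    using inc by (intro SUP_emeasure_incseq[symmetric]) auto
  also have "\<dots> \<le> e"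
  proof (rule SUP_least)
    fix n
    obtain a where a: "a \<in> A" "t n \<le> a" using t by blast
    then have "emeasure lborel (A \<inter> {..t n}) \<le> emeasure lborel (A \<inter> {..a})"
      by (intro emeasure_mono) auto
    then show "emeasure lborel (A \<inter> {..t n}) \<le> e" using le[OF a(1)] by order
  qed
  finally have 1: "emeasure lborel (\<Union>n. A \<inter> {..t n}) \<le> e" .
  have "A \<subseteq> (\<Union>n. A \<inter> {..t n}) \<union> {Sup A}"
  proof
    fix a assume a: "a \<in> A"
    show "a \<in> (\<Union>n. A \<inter> {..t n}) \<union> {Sup A}"
    proof (cases "bdd_above A")
      case True
      then have "a \<le> Sup A" using a by (intro cSup_upper)
      show ?thesis
      proof (cases "a = Sup A")
        case False
        then obtain n where "inverse (of_nat (Suc n)) < Sup A - a" 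
          using \<open>a \<le> Sup A\<close> reals_Archimedean[of "Sup A - a"] by auto
        then have "a \<le> t n" using True by (simp add: t_def inverse_eq_divide)
        then show ?thesis using a by auto
      qed auto
    next
      case False
      then show ?thesis using a real_arch_simple[of a] by (auto simp: t_def)
    qed
  qed
  then have "emeasure lborel A \<le> emeasure lborel ((\<Union>n. A \<inter> {..t n}) \<union> {Sup A})"
    by (intro emeasure_mono) auto
  also have "\<dots> \<le> emeasure lborel (\<Union>n. A \<inter> {..t n}) + emeasure lborel {Sup A}"
    by (intro emeasure_subadditive) auto
  finally show False using 1 e by simp
qed

lemma emeasure_lborel_uminus:
  fixes B :: "real set" assumes [measurable]: "B \<in> sets borel"
  shows "emeasure lborel (uminus -` B) = emeasure lborel B"
proof -
  have "emeasure lborel B = emeasure (distr lborel borel uminus) B" by (simp add: lborel_distr_uminus)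
  then show ?thesis by (simp add: emeasure_distr)
qed

lemma emeasure_lborel_final_part:
  fixes B :: "real set"
  assumes B [measurable]: "B \<in> sets borel" and ne: "B \<noteq> {}" and e: "e < emeasure lborel B"
  shows "\<exists>b\<in>B. e < emeasure lborel (B \<inter> {b..})"
proof -
  have [measurable]: "uminus -` B \<in> sets borel" using measurable_sets_borel[of uminus borel B] by simp
  obtain b where "b \<in> B" by (use ne in auto)
  then have "- b \<in> uminus -` B" by simp
  then have "uminus -` B \<noteq> {}" by blast
  then obtain a where a: "a \<in> uminus -` B" "e < emeasure lborel (uminus -` B \<inter> {..a})"
    using emeasure_lborel_initial_part[of "uminus -` B" e] e by (auto simp: emeasure_lborel_uminus)
  have "uminus -` B \<inter> {..a} = uminus -` (B \<inter> {-a..})" by auto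
  then have "emeasure lborel (uminus -` B \<inter> {..a}) = emeasure lborel (B \<inter> {-a..})"
    using emeasure_lborel_uminus[of "B \<inter> {-a..}"] by simp
  then show ?thesis using a by (intro bexI[of _ "-a"]) auto
qed

lemma emeasure_lborel_shift:
  fixes A :: "real set" assumes [measurable]: "A \<in> sets borel"
  shows "emeasure lborel ((\<lambda>x. b + x) -` A) = emeasure lborel A"
proof -
  have "emeasure lborel A = emeasure (distr lborel borel ((+) b)) A" by (simp add: lborel_distr_plus)
  then show ?thesis by (simp add: emeasure_distr)
qed

text \<open>Translated by \<open>b\<close> and by \<open>a\<close> respectively, the part of
  \<open>A\<close> up to \<open>a\<close> and the part of \<open>B\<close> from \<open>b\<close> on
  meet at most in \<open>a + b\<close>, and both lie in \<open>C\<close> doubled. The suprema over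
  \<open>a\<close> and \<open>b\<close> recover the full measures.\<close>

lemma brunn_minkowski_real:
  fixes A B C :: "real set"
  assumes [measurable]: "A \<in> sets borel" "B \<in> sets borel" "C \<in> sets borel"
    and ne: "A \<noteq> {}" "B \<noteq> {}" and mid: "\<And>a b. a \<in> A \<Longrightarrow> b \<in> B \<Longrightarrow> (a + b) / 2 \<in> C"
  shows "emeasure lborel A + emeasure lborel B \<le> 2 * emeasure lborel C"
proof -
  define C2 where "C2 = (\<lambda>x. x / 2) -` C"
  have C2m [measurable]: "C2 \<in> sets borel" 
    unfolding C2_def using measurable_sets_borel[of "\<lambda>x::real. x / 2" borel C] by simp
  have C2: "emeasure lborel C2 = 2 * emeasure lborel C"
  proof -
    have "emeasure lborel C2 = (\<integral>\<^sup>+x. indicator C2 x \<partial>lborel)" by simp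
    also have "\<dots> = ennreal \<bar>2\<bar> * (\<integral>\<^sup>+x. indicator C2 (0 + 2 * x) \<partial>lborel)"
      by (rule nn_integral_real_affine) auto
    also have "(\<lambda>x. indicator C2 (0 + 2 * x) :: ennreal) = indicator C"
      by (auto simp: C2_def indicator_def)
    finally show ?thesis by simp
  qed
  have key: "emeasure lborel (A \<inter> {..a}) + emeasure lborel (B \<inter> {b..}) \<le> emeasure lborel C2"
    if "a \<in> A" "b \<in> B" for a b
  proof -
    let ?A = "(\<lambda>x. - b + x) -` (A \<inter> {..a})" and ?B = "(\<lambda>x. - a + x) -` (B \<inter> {b..})"
    have [measurable]: "?A \<in> sets borel" "?B \<in> sets borel"
      using measurable_sets_borel[of "\<lambda>x. - b + x" borel "A \<inter> {..a}"] 
        measurable_sets_borel[of "\<lambda>x. - a + x" borel "B \<inter> {b..}"] by simp_all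
    have "?A \<inter> ?B \<subseteq> {a + b}" by auto
    have "emeasure lborel ?B = emeasure lborel (?B - {a + b})"
      by (rule emeasure_Diff_null_set[symmetric]) (auto intro: countable_imp_null_set_lborel)
    moreover have "emeasure lborel ?A + emeasure lborel (?B - {a + b}) = emeasure lborel (?A \<union> (?B - {a + b}))"
      using \<open>?A \<inter> ?B \<subseteq> {a + b}\<close> by (intro plus_emeasure) auto
    moreover have "emeasure lborel (?A \<union> (?B - {a + b})) \<le> emeasure lborel C2"
    proof (rule emeasure_mono)
      show "?A \<union> (?B - {a + b}) \<subseteq> C2"
      proof
        fix x assume "x \<in> ?A \<union> (?B - {a + b})"
        then consider "- b + x \<in> A" | "- a + x \<in> B" by auto
        then show "x \<in> C2"
          by cases (use mid[of "- b + x" b] mid[of a "- a + x"] that in \<open>auto simp: C2_def\<close>)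
      qed
    qed auto
    moreover have "emeasure lborel ?A = emeasure lborel (A \<inter> {..a})" "emeasure lborel ?B = emeasure lborel (B \<inter> {b..})"
      by (rule emeasure_lborel_shift; measurable)+
    ultimately show ?thesis by simp
  qed
  have supA: "emeasure lborel A \<le> (SUP a\<in>A. emeasure lborel (A \<inter> {..a}))"
  proof (rule ccontr)
    assume "\<not> ?thesis"
    then obtain a where "a \<in> A" "(SUP a\<in>A. emeasure lborel (A \<inter> {..a})) < emeasure lborel (A \<inter> {..a})"
      using emeasure_lborel_initial_part[of A] ne by (auto simp: not_le)
    then show False using SUP_upper[of a A "\<lambda>a. emeasure lborel (A \<inter> {..a})"] by (metis leD)
  qed
  have supB: "emeasure lborel B \<le> (SUP b\<in>B. emeasure lborel (B \<inter> {b..}))"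
  proof (rule ccontr)
    assume "\<not> ?thesis"
    then obtain b where "b \<in> B" "(SUP b\<in>B. emeasure lborel (B \<inter> {b..})) < emeasure lborel (B \<inter> {b..})"
      using emeasure_lborel_final_part[of B] ne by (auto simp: not_le)
    then show False using SUP_upper[of b B "\<lambda>b. emeasure lborel (B \<inter> {b..})"] by (metis leD)
  qed
  have "emeasure lborel A + emeasure lborel B \<le> 
      (SUP a\<in>A. emeasure lborel (A \<inter> {..a})) + (SUP b\<in>B. emeasure lborel (B \<inter> {b..}))"
    by (intro add_mono supA supB)
  also have "\<dots> = (SUP b\<in>B. SUP a\<in>A. emeasure lborel (A \<inter> {..a}) + emeasure lborel (B \<inter> {b..}))"
    using ne by (simp add: ennreal_SUP_add_left ennreal_SUP_add_right)
  also have "\<dots> \<le> emeasure lborel C2" by (intro SUP_least key)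
  finally show ?thesis by (simp add: C2)
qed


text \<open>Levels are measured relative to \<open>S\<close>, so that functions with different
  suprema can be compared at the same \<open>r\<close>.\<close>

lemma nn_integral_layer_cake:
  fixes f :: "real \<Rightarrow> real"
  assumes [measurable]: "f \<in> borel_measurable borel" and nn: "\<And>x. 0 \<le> f x" and S: "S > 0"
  shows "(\<integral>\<^sup>+x. ennreal (f x) \<partial>lborel) = 
    ennreal S * (\<integral>\<^sup>+r. indicator {0..} r * emeasure lborel {x. r * S < f x} \<partial>lborel)"
proof -
  have "(\<integral>\<^sup>+x. ennreal (f x) \<partial>lborel) = (\<integral>\<^sup>+x. ennreal S * ennreal (f x / S) \<partial>lborel)"
    using S nn by (simp add: ennreal_mult[symmetric])
  also have "\<dots> = ennreal S * (\<integral>\<^sup>+x. ennreal (f x / S) \<partial>lborel)"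
    by (intro nn_integral_cmult) simp
  also have "(\<integral>\<^sup>+x. ennreal (f x / S) \<partial>lborel) = 
     (\<integral>\<^sup>+x. (\<integral>\<^sup>+r. indicator {0..} r * indicator {z. fst z * S < f (snd z)} (r, x) \<partial>lborel) \<partial>lborel)"
  proof (rule nn_integral_cong)
    fix x
    have "(\<integral>\<^sup>+r. indicator {0..} r * indicator {z. fst z * S < f (snd z)} (r, x) \<partial>lborel)
       = (\<integral>\<^sup>+r. indicator {0..<f x / S} r \<partial>lborel)"
      using S by (intro nn_integral_cong) (auto simp: indicator_def field_simps)
    also have "\<dots> = ennreal (f x / S)" using S nn[of x] by simp
    finally show "ennreal (f x / S) = (\<integral>\<^sup>+r. indicator {0..} r * indicator {z. fst z * S < f (snd z)} (r, x) \<partial>lborel)" ..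
  qed
  also have "\<dots> = (\<integral>\<^sup>+r. (\<integral>\<^sup>+x. indicator {0..} r * indicator {z. fst z * S < f (snd z)} (r, x) \<partial>lborel) \<partial>lborel)"
    by (rule lborel_pair.Fubini'[symmetric]) measurable
  also have "\<dots> = (\<integral>\<^sup>+r. indicator {0..} r * emeasure lborel {x. r * S < f x} \<partial>lborel)"
  proof (rule nn_integral_cong)
    fix r
    have "(\<integral>\<^sup>+x. indicator {0..} r * indicator {z. fst z * S < f (snd z)} (r, x) \<partial>lborel)
      = indicator {0..} r * (\<integral>\<^sup>+x. indicator {z. fst z * S < f (snd z)} (r, x) \<partial>lborel)"
      by (intro nn_integral_cmult) measurable
    also have "(\<integral>\<^sup>+x. indicator {z. fst z * S < f (snd z)} (r, x) \<partial>lborel) = (\<integral>\<^sup>+x. indicator {x. r * S < f x} x \<partial>lborel)"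
      by (intro nn_integral_cong) (auto simp: indicator_def)
    also have "\<dots> = emeasure lborel {x. r * S < f x}"
      by (subst nn_integral_indicator) auto
    finally show "(\<integral>\<^sup>+x. indicator {0..} r * indicator {z. fst z * S < f (snd z)} (r, x) \<partial>lborel) =
      indicator {0..} r * emeasure lborel {x. r * S < f x}" .
  qed
  finally show ?thesis .
qed

lemma ennreal_am_gm:
  fixes a b c :: ennreal
  assumes "a + b \<le> 2 * c"
  shows "a * b \<le> c\<^sup>2"
proof (cases c)
  case top
  then show ?thesis by (simp add: power2_eq_square ennreal_top_mult)
next
  case (real z)
  then have "a + b < top" using assms by (metis ennreal_less_top ennreal_mult_less_top ennreal_numeral le_less_trans)
  then obtain x y where xy: "a = ennreal x" "b = ennreal y" "0 \<le> x" "0 \<le> y"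
    by (cases a; cases b) auto
  have "ennreal (x + y) \<le> ennreal (2 * z)" using assms xy real by (simp add: ennreal_mult)
  then have "x + y \<le> 2 * z" using real by (simp add: ennreal_le_iff)
  then have "(x + y)\<^sup>2 \<le> (2 * z)\<^sup>2" using xy by (intro power_mono) auto
  moreover have "0 \<le> (x - y)\<^sup>2" by simp
  ultimately have "x * y \<le> z\<^sup>2" by (simp add: power2_eq_square algebra_simps)
  then show ?thesis using xy real by (simp add: ennreal_mult[symmetric] ennreal_power ennreal_leI)
qed

text \<open>Normalising \<open>f\<close> and \<open>g\<close> by their suprema makes their level
  sets nonempty for the same \<open>r < 1\<close>, as Brunn-Minkowski requires; \<open>h\<close> is
  normalised by the geometric mean of the suprema. Integrating over \<open>r\<close> gives an
  additive inequality, which the inequality of arithmetic and geometric means turns into the product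
  form.\<close>

lemma prekopa_leindler_real_bounded:
  fixes f g h :: "real \<Rightarrow> real"
  assumes [measurable]: "f \<in> borel_measurable borel" "g \<in> borel_measurable borel" "h \<in> borel_measurable borel"
    and f: "\<And>x. 0 \<le> f x" "\<And>x. f x \<le> k" and g: "\<And>x. 0 \<le> g x" "\<And>x. g x \<le> k" and h: "\<And>x. 0 \<le> h x"
    and mid: "\<And>x y. f x * g y \<le> (h ((x + y) / 2))\<^sup>2"
  shows "(\<integral>\<^sup>+x. ennreal (f x) \<partial>lborel) * (\<integral>\<^sup>+x. ennreal (g x) \<partial>lborel) \<le> (\<integral>\<^sup>+x. ennreal (h x) \<partial>lborel)\<^sup>2"
proof -
  define F where "F = (SUP x. f x)"
  define G where "G = (SUP x. g x)"
  have bdd: "bdd_above (range f)" "bdd_above (range g)" using f(2) g(2) by (auto intro!: bdd_aboveI)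
  have leF: "f x \<le> F" and leG: "g x \<le> G" for x 
    using bdd by (auto simp: F_def G_def intro: cSUP_upper)
  show ?thesis
  proof (cases "F \<le> 0 \<or> G \<le> 0")
    case True
    then have "f = (\<lambda>_. 0) \<or> g = (\<lambda>_. 0)" using f(1) g(1) leF leG by (metis ext order_antisym order_trans)
    then show ?thesis by auto
  next
    case False
    define S where "S = sqrt (F * G)"
    have pos: "F > 0" "G > 0" "S > 0" using False by (auto simp: S_def)
    define a where "a r = indicator {0..} r * emeasure lborel {x. r * F < f x}" for r :: real
    define b where "b r = indicator {0..} r * emeasure lborel {x. r * G < g x}" for r :: real
    define c where "c r = indicator {0..} r * emeasure lborel {x. r * S < h x}" for r :: real
    have level [measurable]: "(\<lambda>r. emeasure lborel {x. r * K < u x}) \<in> borel_measurable borel"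
      if [measurable]: "u \<in> borel_measurable borel" for K :: real and u :: "real \<Rightarrow> real"
    proof (rule lborel.measurable_emeasure)
      show "{z \<in> space (borel \<Otimes>\<^sub>M lborel). snd z \<in> {x. fst z * K < u x}} \<in> sets (borel \<Otimes>\<^sub>M lborel)"
        unfolding mem_Collect_eq by measurable
    qed simp
    have [measurable]: "a \<in> borel_measurable borel" "b \<in> borel_measurable borel" "c \<in> borel_measurable borel"
      unfolding a_def b_def c_def by measurable
    have abc: "a r + b r \<le> 2 * c r" for r
    proof (cases "0 \<le> r \<and> r < 1")
      case True
      have "r * F < F" "r * G < G" using True pos by auto
      then obtain x0 y0 where "r * F < f x0" "r * G < g y0"
        unfolding F_def G_def using less_cSUP_iff[OF _ bdd(1)] less_cSUP_iff[OF _ bdd(2)] by blast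
      then have ne: "{x. r * F < f x} \<noteq> {}" "{x. r * G < g x} \<noteq> {}" by auto
      have "r * S < h ((x + y) / 2)" if "r * F < f x" "r * G < g y" for x y
      proof (rule power2_less_imp_less)
        have "(r * S)\<^sup>2 = (r * F) * (r * G)" using pos by (simp add: S_def power_mult_distrib power2_eq_square)
        also have "\<dots> < f x * g y" using that True pos by (intro mult_strict_mono') auto
        also have "\<dots> \<le> (h ((x + y) / 2))\<^sup>2" by (rule mid)
        finally show "(r * S)\<^sup>2 < (h ((x + y) / 2))\<^sup>2" .
      qed (rule h)
      then have "emeasure lborel {x. r * F < f x} + emeasure lborel {x. r * G < g x} 
         \<le> 2 * emeasure lborel {x. r * S < h x}"
        by (intro brunn_minkowski_real ne) auto
      then show ?thesis using True by (simp add: a_def b_def c_def)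
    next
      case False
      then have "r < 0 \<or> 1 \<le> r" by auto
      then have "a r = 0 \<and> b r = 0"
      proof
        assume "1 \<le> r"
        then have "F \<le> r * F" "G \<le> r * G" using pos by auto
        then have "{x. r * F < f x} = {}" "{x. r * G < g x} = {}" 
          using leF leG by (auto simp: not_less intro: order_trans)
        then show ?thesis by (simp add: a_def b_def)
      qed (simp add: a_def b_def)
      then show ?thesis by simp
    qed
    have "(\<integral>\<^sup>+r. a r \<partial>lborel) + (\<integral>\<^sup>+r. b r \<partial>lborel) = (\<integral>\<^sup>+r. a r + b r \<partial>lborel)"
      by (intro nn_integral_add[symmetric]) auto
    also have "\<dots> \<le> (\<integral>\<^sup>+r. 2 * c r \<partial>lborel)" by (intro nn_integral_mono abc)
    also have "\<dots> = 2 * (\<integral>\<^sup>+r. c r \<partial>lborel)" by (intro nn_integral_cmult) auto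
    finally have *: "(\<integral>\<^sup>+r. a r \<partial>lborel) * (\<integral>\<^sup>+r. b r \<partial>lborel) \<le> (\<integral>\<^sup>+r. c r \<partial>lborel)\<^sup>2"
      by (rule ennreal_am_gm)
    have "(\<integral>\<^sup>+x. ennreal (f x) \<partial>lborel) * (\<integral>\<^sup>+x. ennreal (g x) \<partial>lborel) = 
       (ennreal F * ennreal G) * ((\<integral>\<^sup>+r. a r \<partial>lborel) * (\<integral>\<^sup>+r. b r \<partial>lborel))"
    proof -
      have "(\<integral>\<^sup>+x. ennreal (f x) \<partial>lborel) = ennreal F * (\<integral>\<^sup>+r. a r \<partial>lborel)"
        unfolding a_def by (rule nn_integral_layer_cake[OF assms(1) f(1) pos(1)])
      moreover have "(\<integral>\<^sup>+x. ennreal (g x) \<partial>lborel) = ennreal G * (\<integral>\<^sup>+r. b r \<partial>lborel)"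
        unfolding b_def by (rule nn_integral_layer_cake[OF assms(2) g(1) pos(2)])
      ultimately show ?thesis by (simp only: mult.assoc mult.left_commute)
    qed
    also have "\<dots> \<le> (ennreal F * ennreal G) * (\<integral>\<^sup>+r. c r \<partial>lborel)\<^sup>2" using * by (rule mult_left_mono) simp
    also have "ennreal F * ennreal G = (ennreal S)\<^sup>2"
      using pos by (simp add: S_def ennreal_mult[symmetric] ennreal_power)
    also have "(ennreal S)\<^sup>2 * (\<integral>\<^sup>+r. c r \<partial>lborel)\<^sup>2 = (\<integral>\<^sup>+x. ennreal (h x) \<partial>lborel)\<^sup>2"
      unfolding c_def using h pos by (simp add: nn_integral_layer_cake[of h S] power_mult_distrib)
    finally show ?thesis .
  qed
qed

text \<open>Truncating all three functions at the same \<open>k\<close> preserves the hypothesis,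
  since the truncated product is also at most \<open>k\<close> squared. Monotone convergence removes
  the bound; two different truncations on the left are merged at the larger index.\<close>

lemma prekopa_leindler_real:
  fixes f g h :: "real \<Rightarrow> ennreal"
  assumes [measurable]: "f \<in> borel_measurable borel" "g \<in> borel_measurable borel" "h \<in> borel_measurable borel"
    and mid: "\<And>x y. f x * g y \<le> (h ((x + y) / 2))\<^sup>2"
  shows "(\<integral>\<^sup>+x. f x \<partial>lborel) * (\<integral>\<^sup>+x. g x \<partial>lborel) \<le> (\<integral>\<^sup>+x. h x \<partial>lborel)\<^sup>2"
proof -
  define T where "T k y = min y (of_nat k)" for k :: nat and y :: ennreal
  have T: "T k y = ennreal (enn2real (T k y))" and Tle: "enn2real (T k y) \<le> k" for k y
  proof -
    have "T k y \<le> of_nat k" by (simp add: T_def)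
    then have "T k y < top" by (metis ennreal_of_nat_eq_real_of_nat ennreal_less_top le_less_trans)
    then show "T k y = ennreal (enn2real (T k y))" by simp
    show "enn2real (T k y) \<le> k" using \<open>T k y \<le> of_nat k\<close>
      by (metis enn2real_leI ennreal_of_nat_eq_real_of_nat of_nat_0_le_iff)
  qed
  have [measurable]: "T k \<in> borel_measurable borel" for k unfolding T_def by measurable
  have SUPT: "(SUP k. T k y) = y" for y
  proof (cases y)
    case (real r)
    obtain n :: nat where "r \<le> n" using real_arch_simple by blast
    then have "T n y = y" using real by (simp add: T_def min_absorb1 ennreal_of_nat_eq_real_of_nat ennreal_leI)
    then show ?thesis by (intro antisym SUP_least) (auto simp: T_def intro: SUP_upper2[of n])
  next
    case top
    then show ?thesis by (simp add: T_def ennreal_SUP_of_nat_eq_top)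
  qed
  have incT: "T k y \<le> T l y" if "k \<le> l" for k l y
    using that by (auto simp: T_def min_le_iff_disj intro!: min.mono)
  have INT: "(\<integral>\<^sup>+x. f x \<partial>lborel) = (SUP k. \<integral>\<^sup>+x. T k (f x) \<partial>lborel)" 
    if [measurable]: "f \<in> borel_measurable borel" for f :: "real \<Rightarrow> ennreal"
    using nn_integral_monotone_convergence_SUP[of "\<lambda>k x. T k (f x)" lborel] incT
    by (auto simp: SUPT incseq_def le_fun_def)
  have key: "(\<integral>\<^sup>+x. T k (f x) \<partial>lborel) * (\<integral>\<^sup>+x. T k (g x) \<partial>lborel) \<le> (\<integral>\<^sup>+x. h x \<partial>lborel)\<^sup>2" for k
  proof -
    have "(\<integral>\<^sup>+x. ennreal (enn2real (T k (f x))) \<partial>lborel) * (\<integral>\<^sup>+x. ennreal (enn2real (T k (g x))) \<partial>lborel) 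
       \<le> (\<integral>\<^sup>+x. ennreal (enn2real (T k (h x))) \<partial>lborel)\<^sup>2"
    proof (rule prekopa_leindler_real_bounded[where k = k])
      fix x y
      have "T k (f x) * T k (g y) \<le> (T k (h ((x + y) / 2)))\<^sup>2"
      proof (cases "h ((x + y) / 2) \<le> of_nat k")
        case True
        then have "T k (h ((x + y) / 2)) = h ((x + y) / 2)" by (simp add: T_def)
        moreover have "T k (f x) * T k (g y) \<le> f x * g y" by (intro mult_mono) (auto simp: T_def)
        ultimately show ?thesis using mid[of x y] by simp
      next
        case False
        then have "T k (h ((x + y) / 2)) = of_nat k" by (simp add: T_def min_absorb2)
        moreover have "T k (f x) * T k (g y) \<le> of_nat k * of_nat k" by (intro mult_mono) (auto simp: T_def)
        ultimately show ?thesis by (simp add: power2_eq_square)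
      qed
      then have "ennreal (enn2real (T k (f x)) * enn2real (T k (g y))) \<le> ennreal ((enn2real (T k (h ((x + y) / 2))))\<^sup>2)"
        using T by (simp add: ennreal_mult ennreal_power[symmetric])
      then show "enn2real (T k (f x)) * enn2real (T k (g y)) \<le> (enn2real (T k (h ((x + y) / 2))))\<^sup>2"
        by (simp add: ennreal_le_iff)
    qed (auto simp: Tle)
    also have "\<dots> \<le> (\<integral>\<^sup>+x. h x \<partial>lborel)\<^sup>2"
      by (intro power_mono nn_integral_mono) (auto simp: T[symmetric], simp add: T_def)
    finally show ?thesis by (simp add: T[symmetric])
  qed
  have "(\<integral>\<^sup>+x. f x \<partial>lborel) * (\<integral>\<^sup>+x. g x \<partial>lborel) = 
     (SUP l. SUP k. (\<integral>\<^sup>+x. T k (f x) \<partial>lborel) * (\<integral>\<^sup>+x. T l (g x) \<partial>lborel))"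
    by (simp add: INT[of f] INT[of g] SUP_mult_left_ennreal SUP_mult_right_ennreal)
  also have "\<dots> \<le> (\<integral>\<^sup>+x. h x \<partial>lborel)\<^sup>2"
  proof (intro SUP_least)
    fix k l :: nat
    have "(\<integral>\<^sup>+x. T k (f x) \<partial>lborel) * (\<integral>\<^sup>+x. T l (g x) \<partial>lborel) \<le>
       (\<integral>\<^sup>+x. T (max k l) (f x) \<partial>lborel) * (\<integral>\<^sup>+x. T (max k l) (g x) \<partial>lborel)"
      by (intro mult_mono nn_integral_mono incT) auto
    then show "(\<integral>\<^sup>+x. T k (f x) \<partial>lborel) * (\<integral>\<^sup>+x. T l (g x) \<partial>lborel) \<le> (\<integral>\<^sup>+x. h x \<partial>lborel)\<^sup>2"
      using key[of "max k l"] by order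
  qed
  finally show ?thesis .
qed

text \<open>Induction on the coordinates: by the one-dimensional inequality, integrating out one
  coordinate yields functions that satisfy the hypothesis in the remaining ones. The midpoint is
  restricted because points of the product space are \<open>undefined\<close> off
  \<open>I\<close>.\<close>

lemma prekopa_leindler_PiM:
  fixes f g h :: "('i \<Rightarrow> real) \<Rightarrow> ennreal"
  assumes "finite I"
    and "f \<in> borel_measurable (Pi\<^sub>M I (\<lambda>_. lborel))" "g \<in> borel_measurable (Pi\<^sub>M I (\<lambda>_. lborel))"
      "h \<in> borel_measurable (Pi\<^sub>M I (\<lambda>_. lborel))"
    and "\<And>x y. x \<in> space (Pi\<^sub>M I (\<lambda>_. lborel)) \<Longrightarrow> y \<in> space (Pi\<^sub>M I (\<lambda>_. lborel)) \<Longrightarrow>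
            f x * g y \<le> (h (\<lambda>i\<in>I. (x i + y i) / 2))\<^sup>2"
  shows "(\<integral>\<^sup>+x. f x \<partial>Pi\<^sub>M I (\<lambda>_. lborel)) * (\<integral>\<^sup>+x. g x \<partial>Pi\<^sub>M I (\<lambda>_. lborel)) 
     \<le> (\<integral>\<^sup>+x. h x \<partial>Pi\<^sub>M I (\<lambda>_. lborel))\<^sup>2"
  using assms
proof (induction I arbitrary: f g h rule: finite_induct)
  case empty
  interpret product_sigma_finite "\<lambda>_. lborel :: real measure" by standard
  show ?case using empty(4)[of "\<lambda>_. undefined" "\<lambda>_. undefined"]
    by (simp add: nn_integral_empty space_PiM restrict_def)
next
  case (insert i I)
  interpret product_sigma_finite "\<lambda>_. lborel :: real measure" by standard
  note [measurable] = insert.prems(1-3)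
  let ?M = "Pi\<^sub>M I (\<lambda>_. lborel :: real measure)"
  have upd: "(\<lambda>t. x(i := t)) \<in> measurable borel (Pi\<^sub>M (insert i I) (\<lambda>_. lborel))" if "x \<in> space ?M" for x
    using that by measurable
  show ?case
    unfolding product_nn_integral_insert[OF insert.hyps insert.prems(1)]
      product_nn_integral_insert[OF insert.hyps insert.prems(2)]
      product_nn_integral_insert[OF insert.hyps insert.prems(3)]
  proof (rule insert.IH)
    fix x y assume xy: "x \<in> space ?M" "y \<in> space ?M"
    have m: "(\<lambda>i\<in>I. (x i + y i) / 2) \<in> space ?M" by (auto simp: space_PiM)
    show "(\<integral>\<^sup>+t. f (x(i := t)) \<partial>lborel) * (\<integral>\<^sup>+t. g (y(i := t)) \<partial>lborel) \<le> 
       (\<integral>\<^sup>+t. h ((\<lambda>i\<in>I. (x i + y i) / 2)(i := t)) \<partial>lborel)\<^sup>2"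
    proof (rule prekopa_leindler_real)
      show "(\<lambda>t. f (x(i := t))) \<in> borel_measurable borel" "(\<lambda>t. g (y(i := t))) \<in> borel_measurable borel"
        "(\<lambda>t. h ((\<lambda>i\<in>I. (x i + y i) / 2)(i := t))) \<in> borel_measurable borel"
        using upd[OF xy(1)] upd[OF xy(2)] upd[OF m] by measurable
      fix s t
      have "f (x(i := s)) * g (y(i := t)) \<le> (h (\<lambda>j\<in>insert i I. ((x(i := s)) j + (y(i := t)) j) / 2))\<^sup>2"
        using xy by (intro insert.prems(4)) (auto simp: space_PiM PiE_def extensional_def)
      also have "(\<lambda>j\<in>insert i I. ((x(i := s)) j + (y(i := t)) j) / 2) = (\<lambda>j\<in>I. (x j + y j) / 2)(i := (s + t) / 2)"
        using insert.hyps by (auto simp: fun_eq_iff restrict_def)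
      finally show "f (x(i := s)) * g (y(i := t)) \<le> (h ((\<lambda>j\<in>I. (x j + y j) / 2)(i := (s + t) / 2)))\<^sup>2" .
    qed
  qed measurable
qed

lemma prekopa_leindler:
  fixes f g h :: "'a::euclidean_space \<Rightarrow> ennreal"
  assumes [measurable]: "f \<in> borel_measurable borel" "g \<in> borel_measurable borel" "h \<in> borel_measurable borel"
    and mid: "\<And>x y. f x * g y \<le> (h ((1/2) *\<^sub>R (x + y)))\<^sup>2"
  shows "(\<integral>\<^sup>+x. f x \<partial>lborel) * (\<integral>\<^sup>+x. g x \<partial>lborel) \<le> (\<integral>\<^sup>+x. h x \<partial>lborel)\<^sup>2"
proof -
  let ?\<phi> = "\<lambda>u::'a \<Rightarrow> real. \<Sum>b\<in>Basis. u b *\<^sub>R b"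
  let ?M = "Pi\<^sub>M (Basis :: 'a set) (\<lambda>_. lborel :: real measure)"
  have I: "(\<integral>\<^sup>+x. f x \<partial>lborel) = (\<integral>\<^sup>+u. f (?\<phi> u) \<partial>?M)" 
    if [measurable]: "f \<in> borel_measurable borel" for f :: "'a \<Rightarrow> ennreal"
    by (subst lborel_eq, subst nn_integral_distr) auto
  show ?thesis unfolding I[OF assms(1)] I[OF assms(2)] I[OF assms(3)]
  proof (rule prekopa_leindler_PiM)
    fix u v :: "'a \<Rightarrow> real"
    have "?\<phi> (\<lambda>i\<in>Basis. (u i + v i) / 2) = (1/2) *\<^sub>R (?\<phi> u + ?\<phi> v)"
      by (simp add: scaleR_sum_right sum.distrib[symmetric] scaleR_add_left[symmetric] add_divide_distrib)
    then show "f (?\<phi> u) * g (?\<phi> v) \<le> (h (?\<phi> (\<lambda>i\<in>Basis. (u i + v i) / 2)))\<^sup>2"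
      using mid[of "?\<phi> u" "?\<phi> v"] by simp
  qed auto
qed

section \<open>Cutting convex sets into thin pieces\<close>

lemma AE_hyperplane_avoid:
  fixes a :: "'a::euclidean_space"
  assumes "a \<noteq> 0"
  shows "AE y in lebesgue. a \<bullet> y \<noteq> c"
proof (rule AE_I')
  show "{y. a \<bullet> y = c} \<in> null_sets lebesgue"
    using assms negligible_hyperplane[of a c] negligible_iff_null_sets by blast
qed auto

text \<open>The hyperplane rotates about the flat \<open>y \<bullet> i = p\<close>,
  \<open>y \<bullet> j = q\<close>. It is null in every position, so the integrands converge almost
  everywhere and dominated convergence gives continuity; a half turn exchanges the two
  sides.\<close>

lemma continuous_halfspace_integral:
  fixes w :: "'a::euclidean_space \<Rightarrow> real" and p q :: real
  assumes w: "integrable lebesgue w" and ij: "i \<in> Basis" "j \<in> Basis" "i \<noteq> j"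
  defines "l \<equiv> \<lambda>t y. cos t * (y \<bullet> i - p) + sin t * (y \<bullet> j - q)"
  defines "\<phi> \<equiv> \<lambda>t. LINT y|lebesgue. w y * indicator {y. 0 \<le> l t y} y"
  shows "isCont \<phi> t"
    and "(LINT y|lebesgue. w y) = 0 \<Longrightarrow> \<phi> (t + pi) = - \<phi> t"
proof -
  have lm [measurable]: "l s \<in> borel_measurable borel" for s unfolding l_def by measurable
  have hs: "{y. 0 \<le> l s y} \<in> sets lebesgue" for s
  proof -
    have "{y. 0 \<le> l s y} \<in> sets borel" by measurable
    then show ?thesis by simp
  qed
  have AE0: "AE y in lebesgue. l s y \<noteq> 0" for s
  proof -
    have "(cos s *\<^sub>R i + sin s *\<^sub>R j) \<bullet> i = cos s" "(cos s *\<^sub>R i + sin s *\<^sub>R j) \<bullet> j = sin s"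
      using ij by (auto simp: inner_add_left inner_Basis)
    moreover have "cos s \<noteq> 0 \<or> sin s \<noteq> 0" using sin_cos_squared_add[of s] by (auto simp: power2_eq_square)
    ultimately have "cos s *\<^sub>R i + sin s *\<^sub>R j \<noteq> 0" by (metis inner_zero_left)
    from AE_hyperplane_avoid[OF this, of "cos s * p + sin s * q"] show ?thesis
      by eventually_elim (auto simp: l_def inner_add_left algebra_simps inner_commute)
  qed
  have wm [measurable]: "w \<in> borel_measurable lebesgue" using w by auto
  have int: "integrable lebesgue (\<lambda>y. w y * indicator {y. 0 \<le> l s y} y)" for s
    using integrable_mult_indicator[OF hs w, of s] by (simp add: mult.commute)
  show "isCont \<phi> t"
    unfolding continuous_at_sequentially o_def
  proof safe
    fix X assume X: "X \<longlonglongrightarrow> t"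
    show "(\<lambda>n. \<phi> (X n)) \<longlonglongrightarrow> \<phi> t"
      unfolding \<phi>_def
    proof (rule integral_dominated_convergence[where w = "\<lambda>y. norm (w y)"])
      show "AE y in lebesgue. (\<lambda>n. w y * indicator {y. 0 \<le> l (X n) y} y) \<longlonglongrightarrow> w y * indicator {y. 0 \<le> l t y} y"
        using AE0[of t]
      proof eventually_elim
        case (elim y)
        have lim: "(\<lambda>n. l (X n) y) \<longlonglongrightarrow> l t y" unfolding l_def using X by (intro tendsto_intros)
        have "eventually (\<lambda>n. indicator {y. 0 \<le> l (X n) y} y = (indicator {y. 0 \<le> l t y} y :: real)) sequentially"
        proof (cases "0 < l t y")
          case True
          from order_tendstoD(1)[OF lim True] show ?thesis
            by eventually_elim (use True in \<open>auto simp: indicator_def\<close>)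
        next
          case False
          then have "l t y < 0" using elim by simp
          from order_tendstoD(2)[OF lim this] show ?thesis
            by eventually_elim (use False elim in \<open>auto simp: indicator_def\<close>)
        qed
        then show ?case by (intro tendsto_eventually) (auto elim: eventually_mono)
      qed
    qed (use w int in \<open>auto simp: indicator_def abs_mult borel_measurable_integrable\<close>)
  qed
  assume w0: "(LINT y|lebesgue. w y) = 0"
  have "\<phi> (t + pi) + \<phi> t = (LINT y|lebesgue. w y * indicator {y. 0 \<le> l (t + pi) y} y + w y * indicator {y. 0 \<le> l t y} y)"
    unfolding \<phi>_def by (intro Bochner_Integration.integral_add[symmetric] int)
  also have "\<dots> = (LINT y|lebesgue. w y)"
  proof (rule integral_cong_AE)
    show "AE y in lebesgue. w y * indicator {y. 0 \<le> l (t + pi) y} y + w y * indicator {y. 0 \<le> l t y} y = w y"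
      using AE0[of t]
    proof eventually_elim
      case (elim y)
      have "l (t + pi) y = - l t y" by (simp add: l_def algebra_simps)
      then show ?case using elim by (auto simp: indicator_def)
    qed
  qed (use int in \<open>auto intro!: borel_measurable_add borel_measurable_integrable\<close>)
  finally show "\<phi> (t + pi) = - \<phi> t" using w0 by simp
qed

lemma halfspace_bisection:
  fixes w :: "'a::euclidean_space \<Rightarrow> real" and p q :: real
  assumes w: "integrable lebesgue w" "(LINT y|lebesgue. w y) = 0" 
    and ij: "i \<in> Basis" "j \<in> Basis" "i \<noteq> j"
  obtains \<alpha> \<beta> where "\<alpha>\<^sup>2 + \<beta>\<^sup>2 = 1" 
    "(LINT y|lebesgue. w y * indicator {y. 0 \<le> \<alpha> * (y \<bullet> i - p) + \<beta> * (y \<bullet> j - q)} y) = 0"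
proof -
  define \<phi> where "\<phi> t = (LINT y|lebesgue. w y * indicator {y. 0 \<le> cos t * (y \<bullet> i - p) + sin t * (y \<bullet> j - q)} y)" for t
  have cont: "isCont \<phi> t" for t
    unfolding \<phi>_def using continuous_halfspace_integral(1)[OF w(1) ij] .
  have sgn: "\<phi> (0 + pi) = - \<phi> 0"
    unfolding \<phi>_def using continuous_halfspace_integral(2)[OF w(1) ij w(2)] .
  have "\<exists>t. \<phi> t = 0"
  proof (cases "\<phi> 0 \<le> 0")
    case True
    then show ?thesis using IVT[of \<phi> 0 0 pi] cont sgn by auto
  next
    case False
    then show ?thesis using IVT2[of \<phi> pi 0 0] cont sgn by auto
  qed
  then obtain t where "\<phi> t = 0" by blast
  then show thesis using that[of "cos t" "sin t"] by (simp add: \<phi>_def)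
qed

text \<open>Only the existence of a bounding hyperplane through the flat is recorded. This passes to
  subsets, so later cuts do not destroy it.\<close>

definition cut_by :: "'a::euclidean_space \<times> 'a \<times> real \<times> real \<Rightarrow> 'a set \<Rightarrow> bool" where
  "cut_by = (\<lambda>(i, j, p, q) Q. \<exists>\<alpha> \<beta>. \<alpha>\<^sup>2 + \<beta>\<^sup>2 = 1 \<and> (\<forall>y\<in>Q. 0 \<le> \<alpha> * (y \<bullet> i - p) + \<beta> * (y \<bullet> j - q)))"

lemma cut_by_subset: "cut_by l Q \<Longrightarrow> Q' \<subseteq> Q \<Longrightarrow> cut_by l Q'"
  unfolding cut_by_def by (cases l) blast

text \<open>Along each branch every flat in \<open>L\<close> is used for one cut, into two convex
  pieces on which \<open>w\<close> again has integral 0. The integral of \<open>u\<close> is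
  additive over the pieces, so nonnegativity on the final ones suffices.\<close>

lemma localization_induct:
  fixes w u :: "'a::euclidean_space \<Rightarrow> real"
  assumes w: "integrable lebesgue w" and u: "integrable lebesgue u"
    and fin: "finite L" and L: "\<And>i j p q. (i, j, p, q) \<in> L \<Longrightarrow> i \<in> Basis \<and> j \<in> Basis \<and> i \<noteq> j"
    and base: "\<And>Q. convex Q \<Longrightarrow> Q \<in> sets borel \<Longrightarrow> Q \<subseteq> Q0 \<Longrightarrow> (LINT y|lebesgue. w y * indicator Q y) = 0
       \<Longrightarrow> (\<And>l. l \<in> L \<Longrightarrow> cut_by l Q) \<Longrightarrow> 0 \<le> (LINT y|lebesgue. u y * indicator Q y)"
    and Q0: "convex Q0" "Q0 \<in> sets borel" "(LINT y|lebesgue. w y * indicator Q0 y) = 0"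
  shows "0 \<le> (LINT y|lebesgue. u y * indicator Q0 y)"
  using fin L base Q0
proof (induction L arbitrary: Q0 rule: finite_induct)
  case empty
  then show ?case by blast
next
  case (insert l L)
  note prem = insert.prems
  obtain i j p q where l: "l = (i, j, p, q)" by (cases l)
  have ij: "i \<in> Basis" "j \<in> Basis" "i \<noteq> j" using prem(1)[of i j p q] l by auto
  have intw: "integrable lebesgue (\<lambda>y. w y * indicator Q y)" if "Q \<in> sets borel" for Q
    using integrable_mult_indicator[of Q lebesgue w] that w by (simp add: mult.commute)
  have intu: "integrable lebesgue (\<lambda>y. u y * indicator Q y)" if "Q \<in> sets borel" for Q
    using integrable_mult_indicator[of Q lebesgue u] that u by (simp add: mult.commute)
  obtain \<alpha> \<beta> where ab: "\<alpha>\<^sup>2 + \<beta>\<^sup>2 = 1"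
    "(LINT y|lebesgue. (w y * indicator Q0 y) * indicator {y. 0 \<le> \<alpha> * (y \<bullet> i - p) + \<beta> * (y \<bullet> j - q)} y) = 0"
    using halfspace_bisection[OF intw[OF prem(4)] prem(5) ij] by blast
  define a where "a = \<alpha> *\<^sub>R i + \<beta> *\<^sub>R j"
  define c where "c = \<alpha> * p + \<beta> * q"
  have a: "\<alpha> * (y \<bullet> i - p) + \<beta> * (y \<bullet> j - q) = a \<bullet> y - c" for y
    by (simp add: a_def c_def inner_add_left inner_commute algebra_simps)
  define Q1 where "Q1 = Q0 \<inter> {y. c \<le> a \<bullet> y}"
  define Q2 where "Q2 = Q0 \<inter> {y. a \<bullet> y < c}"
  have borel: "Q1 \<in> sets borel" "Q2 \<in> sets borel"
    using prem(4) unfolding Q1_def Q2_def by (auto intro!: sets.Int borel_closed closed_halfspace_ge borel_open open_halfspace_lt)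
  have conv: "convex Q1" "convex Q2"
    using prem(3) unfolding Q1_def Q2_def by (auto intro!: convex_Int convex_halfspace_ge convex_halfspace_lt)
  have split: "indicator Q0 y = (indicator Q1 y + indicator Q2 y :: real)" for y
    by (auto simp: Q1_def Q2_def indicator_def)
  have w1: "(LINT y|lebesgue. w y * indicator Q1 y) = 0"
  proof -
    have "w y * indicator Q1 y = (w y * indicator Q0 y) * indicator {y. 0 \<le> \<alpha> * (y \<bullet> i - p) + \<beta> * (y \<bullet> j - q)} y" for y
      by (auto simp: Q1_def indicator_def a)
    then show ?thesis using ab(2) by (simp only:)
  qed
  have "(LINT y|lebesgue. w y * indicator Q0 y) = (LINT y|lebesgue. w y * indicator Q1 y) + (LINT y|lebesgue. w y * indicator Q2 y)"
    using borel by (subst Bochner_Integration.integral_add[symmetric]) (auto simp: split distrib_left intro!: intw)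
  then have w2: "(LINT y|lebesgue. w y * indicator Q2 y) = 0" using w1 prem(5) by simp
  have cut1: "cut_by l Q1" unfolding cut_by_def l prod.case using ab(1) by (intro exI[of _ \<alpha>] exI[of _ \<beta>]) (auto simp: Q1_def a)
  have "\<forall>y\<in>Q2. 0 \<le> - \<alpha> * (y \<bullet> i - p) + - \<beta> * (y \<bullet> j - q)"
  proof
    fix y assume "y \<in> Q2"
    then have "\<alpha> * (y \<bullet> i - p) + \<beta> * (y \<bullet> j - q) < 0" unfolding a by (simp add: Q2_def)
    then show "0 \<le> - \<alpha> * (y \<bullet> i - p) + - \<beta> * (y \<bullet> j - q)" by simp
  qed
  then have cut2: "cut_by l Q2" unfolding cut_by_def l prod.case using ab(1) by (intro exI[of _ "-\<alpha>"] exI[of _ "-\<beta>"]) simp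
  have *: "0 \<le> (LINT y|lebesgue. u y * indicator Q y)"
    if Q: "convex Q" "Q \<in> sets borel" "(LINT y|lebesgue. w y * indicator Q y) = 0" "cut_by l Q" "Q \<subseteq> Q0" for Q
  proof (rule insert.IH)
    show "i \<in> Basis \<and> j \<in> Basis \<and> i \<noteq> j" if "(i, j, p, q) \<in> L" for i j p q
      using prem(1)[of i j p q] that by simp
    show "0 \<le> (LINT y|lebesgue. u y * indicator Q' y)"
      if "convex Q'" "Q' \<in> sets borel" "Q' \<subseteq> Q" "(LINT y|lebesgue. w y * indicator Q' y) = 0"
        "\<And>l. l \<in> L \<Longrightarrow> cut_by l Q'" for Q'
      using that Q(4,5) cut_by_subset[of l Q Q'] by (intro prem(2)) auto
  qed (use Q in auto)
  have "0 \<le> (LINT y|lebesgue. u y * indicator Q1 y)" "0 \<le> (LINT y|lebesgue. u y * indicator Q2 y)"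
    using *[OF conv(1) borel(1) w1 cut1] *[OF conv(2) borel(2) w2 cut2] by (auto simp: Q1_def Q2_def)
  moreover have "(LINT y|lebesgue. u y * indicator Q0 y) = (LINT y|lebesgue. u y * indicator Q1 y) + (LINT y|lebesgue. u y * indicator Q2 y)"
    using borel by (subst Bochner_Integration.integral_add[symmetric]) (auto simp: split distrib_left intro!: intu)
  ultimately show ?case by simp
qed

section \<open>Thinness of the pieces\<close>

text \<open>In the coordinates \<open>i\<close> and \<open>j\<close> the hyperplane passes near the
  centroid of the triangle \<open>a\<close>, \<open>b\<close>, \<open>c\<close>, and the vertices
  lie on one side of it. Three nonnegative numbers with a small mean are all small, so the projected
  triangle sits in a thin strip and has small area.\<close>

lemma minor_bound:
  fixes a b c :: "'a::euclidean_space"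
  assumes cut: "cut_by (i, j, p, q) Q" and abc: "a \<in> Q" "b \<in> Q" "c \<in> Q" and Q: "Q \<subseteq> cball 0 R"
    and ij: "i \<in> Basis" "j \<in> Basis"
    and p: "\<bar>((a + b + c) \<bullet> i) / 3 - p\<bar> \<le> r" and q: "\<bar>((a + b + c) \<bullet> j) / 3 - q\<bar> \<le> r"
  shows "\<bar>((b - a) \<bullet> i) * ((c - a) \<bullet> j) - ((b - a) \<bullet> j) * ((c - a) \<bullet> i)\<bar> \<le> 48 * r * R"
proof -
  obtain \<alpha> \<beta> where ab: "\<alpha>\<^sup>2 + \<beta>\<^sup>2 = 1" "\<And>y. y \<in> Q \<Longrightarrow> 0 \<le> \<alpha> * (y \<bullet> i - p) + \<beta> * (y \<bullet> j - q)"
    using cut by (auto simp: cut_by_def)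
  have le1: "\<bar>\<alpha>\<bar> \<le> 1" "\<bar>\<beta>\<bar> \<le> 1" 
    using ab(1) zero_le_power2[of \<alpha>] zero_le_power2[of \<beta>] unfolding abs_square_le_1[symmetric] by linarith+
  define l where "l y = \<alpha> * (y \<bullet> i) + \<beta> * (y \<bullet> j)" for y
  define m where "m = (l a + l b + l c) / 3"
  have "m = \<alpha> * (((a + b + c) \<bullet> i) / 3) + \<beta> * (((a + b + c) \<bullet> j) / 3)"
    by (simp add: m_def l_def inner_add_left field_simps)
  then have "m - (\<alpha> * p + \<beta> * q) = \<alpha> * (((a + b + c) \<bullet> i) / 3 - p) + \<beta> * (((a + b + c) \<bullet> j) / 3 - q)"
    by (simp add: algebra_simps)
  also have "\<dots> \<le> \<bar>\<alpha> * (((a + b + c) \<bullet> i) / 3 - p)\<bar> + \<bar>\<beta> * (((a + b + c) \<bullet> j) / 3 - q)\<bar>" by simp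
  also have "\<dots> \<le> 1 * r + 1 * r" unfolding abs_mult using le1 p q by (intro add_mono mult_mono) auto
  finally have m: "m \<le> \<alpha> * p + \<beta> * q + 2 * r" by simp
  have ge: "\<alpha> * p + \<beta> * q \<le> l y" if "y \<in> Q" for y using ab(2)[OF that] by (simp add: l_def algebra_simps)
  \<comment> \<open>The three values have mean \<open>m\<close>, so being at least
    \<open>m - 2 * r\<close> they are at most \<open>m + 4 * r\<close>, and they differ by at most
    \<open>6 * r\<close>.\<close>
  have dev: "m - 2 * r \<le> l a" "m - 2 * r \<le> l b" "m - 2 * r \<le> l c" using ge abc m by force+
  define P where "P = b - a"
  define W where "W = c - a"
  have "l P = l b - l a" "l W = l c - l a" by (simp_all add: l_def P_def W_def inner_diff_left algebra_simps)
  then have lPW: "\<bar>l P\<bar> \<le> 6 * r" "\<bar>l W\<bar> \<le> 6 * r" using dev m_def by (auto simp: abs_le_iff field_simps)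
  have nn: "norm y \<le> R" if "y \<in> Q" for y using that Q by auto
  have "norm P \<le> 2 * R" "norm W \<le> 2 * R"
    unfolding P_def W_def using nn[OF abc(1)] nn[OF abc(2)] nn[OF abc(3)] 
      norm_triangle_ineq4[of b a] norm_triangle_ineq4[of c a] by linarith+
  then have co: "\<bar>P \<bullet> k\<bar> \<le> 2 * R" "\<bar>W \<bullet> k\<bar> \<le> 2 * R" if "k \<in> Basis" for k
    using Basis_le_norm[OF that] by (auto intro: order_trans)
  have r0: "0 \<le> r" using p by linarith
  have R0: "0 \<le> R" using nn[OF abc(1)] norm_ge_zero[of a] by linarith
  \<comment> \<open>Twice the signed area of the projected triangle. After multiplication by
    \<alpha> or \<beta> one coordinate can be eliminated in favour of \<open>l\<close>; each product
    is at most \<open>24 * r * R\<close>, which gives the constant 48.\<close>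
  define d where "d = (P \<bullet> i) * (W \<bullet> j) - (P \<bullet> j) * (W \<bullet> i)"
  have 1: "\<bar>\<alpha> * d\<bar> \<le> 6 * r * (2 * R) + (2 * R) * (6 * r)"
  proof -
    have "\<alpha> * d = l P * (W \<bullet> j) - (P \<bullet> j) * l W" by (simp add: d_def l_def algebra_simps)
    also have "\<bar>\<dots>\<bar> \<le> \<bar>l P\<bar> * \<bar>W \<bullet> j\<bar> + \<bar>P \<bullet> j\<bar> * \<bar>l W\<bar>" by (simp add: abs_mult[symmetric] abs_triangle_ineq4)
    also have "\<dots> \<le> 6 * r * (2 * R) + (2 * R) * (6 * r)"
      using lPW co ij r0 R0 by (intro add_mono mult_mono) (auto intro: order_trans[OF abs_ge_zero])
    finally show ?thesis .
  qed
  have 2: "\<bar>\<beta> * d\<bar> \<le> 6 * r * (2 * R) + (2 * R) * (6 * r)"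
  proof -
    have "\<beta> * d = (P \<bullet> i) * l W - l P * (W \<bullet> i)" by (simp add: d_def l_def algebra_simps)
    also have "\<bar>\<dots>\<bar> \<le> \<bar>P \<bullet> i\<bar> * \<bar>l W\<bar> + \<bar>l P\<bar> * \<bar>W \<bullet> i\<bar>" by (simp add: abs_mult[symmetric] abs_triangle_ineq4)
    also have "\<dots> \<le> (2 * R) * (6 * r) + 6 * r * (2 * R)"
      using lPW co ij r0 R0 by (intro add_mono mult_mono) (auto intro: order_trans[OF abs_ge_zero])
    finally show ?thesis by simp
  qed
  have "1 \<le> \<bar>\<alpha>\<bar> + \<bar>\<beta>\<bar>"
  proof -
    have "\<alpha>\<^sup>2 \<le> \<bar>\<alpha>\<bar>" "\<beta>\<^sup>2 \<le> \<bar>\<beta>\<bar>" 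
      using le1 mult_left_le_one_le[of "\<bar>\<alpha>\<bar>" "\<bar>\<alpha>\<bar>"] mult_left_le_one_le[of "\<bar>\<beta>\<bar>" "\<bar>\<beta>\<bar>"] by (auto simp: power2_eq_square)
    then show ?thesis using ab(1) by simp
  qed
  then have "1 * \<bar>d\<bar> \<le> (\<bar>\<alpha>\<bar> + \<bar>\<beta>\<bar>) * \<bar>d\<bar>" by (intro mult_right_mono) auto
  also have "\<dots> = \<bar>\<alpha> * d\<bar> + \<bar>\<beta> * d\<bar>" by (simp add: abs_mult distrib_right)
  also have "\<dots> \<le> 48 * r * R" using 1 2 by (simp add: mult.commute mult.left_commute)
  finally show ?thesis by (simp add: d_def P_def W_def)
qed

lemma norm_orthogonal_part_le:
  fixes v w :: "'a::euclidean_space"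
  assumes "norm v = 1"
  shows "norm (w - (v \<bullet> w) *\<^sub>R v) \<le> norm w"
proof -
  have "v \<bullet> v = 1" using assms by (simp add: dot_square_norm)
  then have "(w - (v \<bullet> w) *\<^sub>R v) \<bullet> (w - (v \<bullet> w) *\<^sub>R v) = w \<bullet> w - (v \<bullet> w)\<^sup>2"
    by (simp add: inner_diff_left inner_diff_right power2_eq_square inner_commute algebra_simps)
  then show ?thesis unfolding norm_le by simp
qed

text \<open>Small minors mean that \<open>P\<close> and \<open>W\<close> are almost parallel. One
  dimension factor stems from the sum over \<open>j\<close>, the other from bounding the norm by the
  sum of the absolute coordinates.\<close>

lemma orthogonal_part_minors:
  fixes P W :: "'a::euclidean_space"
  assumes minors: "\<And>i j. i \<in> Basis \<Longrightarrow> j \<in> Basis \<Longrightarrow> \<bar>(P \<bullet> i) * (W \<bullet> j) - (P \<bullet> j) * (W \<bullet> i)\<bar> \<le> \<Delta>"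
    and e: "0 < e" "e \<le> norm P"
  shows "norm (W - (sgn P \<bullet> W) *\<^sub>R sgn P) \<le> (real DIM('a))\<^sup>2 * \<Delta> / e"
proof -
  have P: "norm P > 0" using e by linarith
  define E where "E = W - (sgn P \<bullet> W) *\<^sub>R sgn P"
  have \<Delta>: "0 \<le> \<Delta>" using minors[of "SOME i. i \<in> Basis" "SOME i. i \<in> Basis"] SOME_Basis by fastforce
  have comp: "\<bar>E \<bullet> k\<bar> \<le> real DIM('a) * \<Delta> / e" if k: "k \<in> Basis" for k
  proof -
    \<comment> \<open>Lagrange's identity by coordinates: each component of the part of
      \<open>W\<close> orthogonal to \<open>P\<close> is a combination of minors.\<close>
    have "(norm P)\<^sup>2 * (E \<bullet> k) = (norm P)\<^sup>2 * (W \<bullet> k) - (P \<bullet> W) * (P \<bullet> k)"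
      using P by (simp add: E_def inner_diff_left sgn_div_norm power2_eq_square field_simps)
    also have "\<dots> = (\<Sum>j\<in>Basis. (P \<bullet> j) * ((P \<bullet> j) * (W \<bullet> k) - (P \<bullet> k) * (W \<bullet> j)))"
      unfolding power2_norm_eq_inner euclidean_inner[of P P] euclidean_inner[of P W]
      unfolding sum_distrib_right sum_subtractf[symmetric] by (intro sum.cong) (auto simp: algebra_simps)
    also have "\<bar>\<dots>\<bar> \<le> (\<Sum>j\<in>Basis. \<bar>(P \<bullet> j) * ((P \<bullet> j) * (W \<bullet> k) - (P \<bullet> k) * (W \<bullet> j))\<bar>)" by (rule sum_abs)
    also have "\<dots> \<le> (\<Sum>j\<in>(Basis::'a set). norm P * \<Delta>)"
      unfolding abs_mult[of "P \<bullet> _"]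
      using minors k Basis_le_norm by (intro sum_mono mult_mono) auto
    also have "\<dots> = norm P * (real DIM('a) * \<Delta>)" by simp
    finally have "norm P * (norm P * \<bar>E \<bullet> k\<bar>) \<le> norm P * (real DIM('a) * \<Delta>)"
      by (simp add: abs_mult power2_eq_square mult.assoc)
    then have "norm P * \<bar>E \<bullet> k\<bar> \<le> real DIM('a) * \<Delta>" using P by simp
    moreover have "e * \<bar>E \<bullet> k\<bar> \<le> norm P * \<bar>E \<bullet> k\<bar>" using e by (intro mult_right_mono) auto
    ultimately show ?thesis using e by (simp add: field_simps)
  qed
  have "norm E \<le> (\<Sum>k\<in>Basis. \<bar>E \<bullet> k\<bar>)" by (rule norm_le_l1)
  also have "\<dots> \<le> (\<Sum>k\<in>(Basis::'a set). real DIM('a) * \<Delta> / e)" by (intro sum_mono comp)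
  also have "\<dots> = (real DIM('a))\<^sup>2 * \<Delta> / e" by (simp add: power2_eq_square)
  finally show ?thesis by (simp add: E_def)
qed

text \<open>Every triangle in \<open>Q\<close> has, in each pair of coordinates, its centroid near a
  grid point, so all its projected areas are small. Any sufficiently long segment between points of
  \<open>Q\<close> then serves as an axis.\<close>

lemma finite_cuts_make_thin:
  fixes R \<epsilon> :: real
  assumes R: "0 < R" and \<epsilon>: "0 < \<epsilon>"
  obtains L :: "('a::euclidean_space \<times> 'a \<times> real \<times> real) set" where "finite L"
    "\<And>i j p q. (i, j, p, q) \<in> L \<Longrightarrow> i \<in> Basis \<and> j \<in> Basis \<and> i \<noteq> j"
    "\<And>Q. Q \<subseteq> cball 0 R \<Longrightarrow> (\<And>l. l \<in> L \<Longrightarrow> cut_by l Q) \<Longrightarrow>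
       \<exists>v. norm v = 1 \<and> (\<forall>y\<in>Q. \<forall>z\<in>Q. norm (y - z - (v \<bullet> (y - z)) *\<^sub>R v) \<le> \<epsilon>)"
proof -
  \<comment> \<open>Makes the bound from the minors equal to \<open>\<epsilon> / 2\<close>; the
    other half is spent on passing from differences with a base point \<open>a\<close> to arbitrary
    pairs.\<close>
  define r where "r = \<epsilon>\<^sup>2 / (96 * R * (real DIM('a))\<^sup>2)"
  have r: "r > 0" using R \<epsilon> by (simp add: r_def)
  define P where "P = (\<lambda>k::int. r * of_int k) ` {-\<lceil>R / r\<rceil> - 1..\<lceil>R / r\<rceil> + 1}"
  have P: "\<exists>p\<in>P. \<bar>t - p\<bar> \<le> r" if "\<bar>t\<bar> \<le> R" for t
  proof -
    define k where "k = \<lfloor>t / r\<rfloor>"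
    have k: "of_int k \<le> t / r" "t / r < of_int k + 1" by (auto simp: k_def)
    have "t / r \<le> R / r" "- R / r \<le> t / r" using that r by (intro divide_right_mono; linarith)+
    then have "real_of_int k \<le> of_int \<lceil>R / r\<rceil>" "of_int (-\<lceil>R / r\<rceil> - 1) < real_of_int k"
      using k le_of_int_ceiling[of "R / r"] unfolding of_int_diff of_int_minus of_int_1 minus_divide_left[symmetric] 
      by linarith+
    then have "k \<in> {-\<lceil>R / r\<rceil> - 1..\<lceil>R / r\<rceil> + 1}" unfolding of_int_le_iff of_int_less_iff by simp
    moreover have "\<bar>t - r * of_int k\<bar> \<le> r"
    proof -
      have "r * of_int k \<le> t" "t \<le> r * of_int k + r" using k r by (auto simp: field_simps)
      then show ?thesis by (simp add: abs_le_iff)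
    qed
    ultimately show ?thesis unfolding P_def by blast
  qed
  define L :: "('a \<times> 'a \<times> real \<times> real) set" where
    "L = {(i, j, p, q). i \<in> Basis \<and> j \<in> Basis \<and> i \<noteq> j \<and> p \<in> P \<and> q \<in> P}"
  show thesis
  proof (rule that[of L])
    have "finite P" by (simp add: P_def)
    moreover have "L \<subseteq> Basis \<times> Basis \<times> P \<times> P" by (auto simp: L_def)
    ultimately show "finite L" by (meson finite_SigmaI finite_Basis finite_subset)
    show "i \<in> Basis \<and> j \<in> Basis \<and> i \<noteq> j" if "(i, j, p, q) \<in> L" for i j p q
      using that by (simp add: L_def)
    fix Q :: "'a set" assume Q: "Q \<subseteq> cball 0 R" and cut: "\<And>l. l \<in> L \<Longrightarrow> cut_by l Q"
    have minor: "\<bar>((b - a) \<bullet> i) * ((c - a) \<bullet> j) - ((b - a) \<bullet> j) * ((c - a) \<bullet> i)\<bar> \<le> 48 * r * R"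
      if abc: "a \<in> Q" "b \<in> Q" "c \<in> Q" and ij: "i \<in> Basis" "j \<in> Basis" for a b c i j
    proof (cases "i = j")
      case True
      then show ?thesis using r R by simp
    next
      case False
      have "norm a \<le> R" "norm b \<le> R" "norm c \<le> R" using abc Q by auto
      then have "\<bar>((a + b + c) \<bullet> k) / 3\<bar> \<le> R" if "k \<in> Basis" for k
        using Basis_le_norm[OF that, of a] Basis_le_norm[OF that, of b] Basis_le_norm[OF that, of c]
        by (simp add: inner_add_left abs_le_iff)
      then obtain p q where "p \<in> P" "\<bar>((a + b + c) \<bullet> i) / 3 - p\<bar> \<le> r" "q \<in> P" "\<bar>((a + b + c) \<bullet> j) / 3 - q\<bar> \<le> r"
        using P ij by meson
      moreover from this have "cut_by (i, j, p, q) Q" using cut ij False by (simp add: L_def)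
      ultimately show ?thesis using minor_bound abc Q ij by blast
    qed
    show "\<exists>v. norm v = 1 \<and> (\<forall>y\<in>Q. \<forall>z\<in>Q. norm (y - z - (v \<bullet> (y - z)) *\<^sub>R v) \<le> \<epsilon>)"
    \<comment> \<open>A piece of diameter at most \<epsilon> is thin in every direction. Otherwise
      two points further apart give the axis, together with the lower bound on its length by which
      the minors are divided.\<close>
    proof (cases "\<forall>y\<in>Q. \<forall>z\<in>Q. norm (y - z) \<le> \<epsilon>")
      case True
      obtain v :: 'a where "v \<in> Basis" using nonempty_Basis by blast
      then have "norm v = 1" by simp
      then show ?thesis using True norm_orthogonal_part_le[of v] by (meson order_trans)
    next
      case False
      then obtain a b where ab: "a \<in> Q" "b \<in> Q" "\<epsilon> < norm (b - a)" by force
      define v where "v = sgn (b - a)"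
      have v: "norm v = 1" using ab \<epsilon> by (auto simp: v_def norm_sgn)
      have half: "norm (c - a - (v \<bullet> (c - a)) *\<^sub>R v) \<le> \<epsilon> / 2" if "c \<in> Q" for c
      proof -
        have "norm (c - a - (v \<bullet> (c - a)) *\<^sub>R v) \<le> (real DIM('a))\<^sup>2 * (48 * r * R) / \<epsilon>"
          unfolding v_def using ab \<epsilon> that by (intro orthogonal_part_minors minor) auto
        also have "\<dots> = \<epsilon> / 2" using \<epsilon> R by (simp add: r_def power2_eq_square)
        finally show ?thesis .
      qed
      have "norm (y - z - (v \<bullet> (y - z)) *\<^sub>R v) \<le> \<epsilon>" if "y \<in> Q" "z \<in> Q" for y z
      proof -
        have "y - z - (v \<bullet> (y - z)) *\<^sub>R v = (y - a - (v \<bullet> (y - a)) *\<^sub>R v) - (z - a - (v \<bullet> (z - a)) *\<^sub>R v)"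
          by (simp add: inner_diff_right algebra_simps)
        also have "norm \<dots> \<le> \<epsilon> / 2 + \<epsilon> / 2"
          using half[OF that(1)] half[OF that(2)] norm_triangle_ineq4 by (meson add_mono order_trans)
        finally show ?thesis by simp
      qed
      then show ?thesis using v by blast
    qed
  qed
qed

section \<open>Needles\<close>

text \<open>A version of the density that is Borel and midpoint log-concave at every point, so that
  Prekopa-Leindler applies to its products with indicators of Borel sets.\<close>

locale log_concave_density =
  fixes f :: "'a::euclidean_space \<Rightarrow> real"
  assumes borel [measurable]: "f \<in> borel_measurable borel"
    and nonneg: "0 \<le> f x"
    and integrable: "integrable lebesgue f"
    and midpoint: "f x * f y \<le> (f ((1/2) *\<^sub>R (x + y)))\<^sup>2"
begin

definition M :: "'a measure" where "M = density lebesgue (\<lambda>x. ennreal (f x))"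

lemma sets_M [simp]: "sets M = sets lebesgue" by (simp add: M_def)
lemma space_M [simp]: "space M = UNIV" by (simp add: M_def)

lemma emeasure_M:
  assumes "A \<in> sets lebesgue"
  shows "emeasure M A = (\<integral>\<^sup>+y. ennreal (f y) * indicator A y \<partial>lebesgue)"
  unfolding M_def using assms integrable by (intro emeasure_density) auto

sublocale finite_measure M
proof
  have "emeasure M UNIV = (\<integral>\<^sup>+y. ennreal (f y) \<partial>lebesgue)" by (simp add: emeasure_M)
  also have "\<dots> < \<infinity>" using integrable nonneg by (simp add: integrable_iff_bounded)
  finally show "emeasure M (space M) \<noteq> \<infinity>" by simp
qed

lemma measure_M:
  assumes "A \<in> sets lebesgue"
  shows "measure M A = (LINT y|lebesgue. f y * indicator A y)"
proof -
  have "integrable lebesgue (\<lambda>y. f y * indicator A y)"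
    using integrable_mult_indicator[OF assms integrable] by (simp add: mult.commute)
  then have "ennreal (LINT y|lebesgue. f y * indicator A y) = (\<integral>\<^sup>+y. ennreal (f y * indicator A y) \<partial>lebesgue)"
    using nonneg by (intro nn_integral_eq_integral[symmetric]) auto
  also have "\<dots> = emeasure M A"
    unfolding emeasure_M[OF assms] by (intro nn_integral_cong) (auto simp: indicator_def)
  finally show ?thesis
    using nonneg by (simp add: emeasure_eq_measure integral_nonneg_AE)
qed

text \<open>\<open>C\<close> is any Borel set that contains the midpoints, so measurability of a
  Minkowski sum never comes up.\<close>

lemma measure_midpoint:
  assumes "A \<in> sets borel" "B \<in> sets borel" "C \<in> sets borel"
    and mid: "\<And>a b. a \<in> A \<Longrightarrow> b \<in> B \<Longrightarrow> (1/2) *\<^sub>R (a + b) \<in> C"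
  shows "measure M A * measure M B \<le> (measure M C)\<^sup>2"
proof -
  note [measurable] = assms(1-3)
  have em: "ennreal (measure M X) = (\<integral>\<^sup>+y. ennreal (f y) * indicator X y \<partial>lborel)" if "X \<in> sets borel" for X
    using emeasure_M[of X] that by (simp add: emeasure_eq_measure nn_integral_completion)
  have "ennreal (measure M A) * ennreal (measure M B) \<le> (ennreal (measure M C))\<^sup>2"
    unfolding em[OF assms(1)] em[OF assms(2)] em[OF assms(3)]
  proof (rule prekopa_leindler)
    fix x y
    have "ennreal (f x) * ennreal (f y) \<le> (ennreal (f ((1/2) *\<^sub>R (x + y))))\<^sup>2"
      using midpoint[of x y] nonneg by (simp add: ennreal_mult[symmetric] ennreal_power ennreal_leI)
    then show "ennreal (f x) * indicator A x * (ennreal (f y) * indicator B y) \<le>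
       (ennreal (f ((1/2) *\<^sub>R (x + y))) * indicator C ((1/2) *\<^sub>R (x + y)))\<^sup>2"
      using mid[of x y] by (auto simp: indicator_def)
  qed measurable
  then show ?thesis
    by (simp add: ennreal_mult[symmetric] ennreal_power)
qed

definition slab :: "'a set \<Rightarrow> 'a \<Rightarrow> real \<Rightarrow> nat \<Rightarrow> 'a set" where
  "slab Q b s k = {y\<in>Q. real k \<le> b \<bullet> y - s \<and> b \<bullet> y - s < real k + 1}"

lemma slab_borel: "Q \<in> sets borel \<Longrightarrow> {y\<in>Q. u \<le> b \<bullet> y - s \<and> b \<bullet> y - s < v} \<in> sets borel"
proof -
  assume Q: "Q \<in> sets borel"
  have "{y\<in>Q. u \<le> b \<bullet> y - s \<and> b \<bullet> y - s < v} = Q \<inter> {y. b \<bullet> y \<ge> u + s} \<inter> {y. b \<bullet> y < v + s}"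
    by (auto simp: algebra_simps)
  then show ?thesis
    using Q by (simp add: sets.Int borel_closed borel_open closed_halfspace_ge open_halfspace_lt)
qed

text \<open>Midpoints between the slabs \<open>k\<close> and \<open>k + 2\<close> lie in the slab
  \<open>k + 1\<close>. Internal zeros are excluded by the same inequality for longer
  ranges.\<close>

lemma slab_log_concave:
  assumes Q: "convex Q" "Q \<in> sets borel"
  shows "log_concave_seq n (\<lambda>k. measure M (slab Q b s k))"
proof -
  define E where "E u v = {y\<in>Q. u \<le> b \<bullet> y - s \<and> b \<bullet> y - s < v}" for u v :: real
  have E: "E u v \<in> sets borel" for u v unfolding E_def by (rule slab_borel[OF Q(2)])
  have slab: "slab Q b s k = E k (k + 1)" for k by (simp add: slab_def E_def add.commute)
  have mid: "measure M (E u v) * measure M (E u' v') \<le> (measure M (E u'' v''))\<^sup>2"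
    if "2 * u'' \<le> u + u'" "v + v' \<le> 2 * v''" for u v u' v' u'' v''
  proof (rule measure_midpoint[OF E E E])
    fix y z assume yz: "y \<in> E u v" "z \<in> E u' v'"
    then have "(1/2) *\<^sub>R y + (1/2) *\<^sub>R z \<in> Q" by (intro convexD[OF Q(1)]) (auto simp: E_def)
    then show "(1/2) *\<^sub>R (y + z) \<in> E u'' v''"
      using yz that by (auto simp: E_def scaleR_add_right inner_add_right)
  qed
  define c where "c k = measure M (slab Q b s k)" for k
  have c0: "0 \<le> c k" for k by (simp add: c_def)
  have "0 < c j" if ijl: "i < j" "j < l" "0 < c i" "0 < c l" for i j l
  proof (rule ccontr)
    assume "\<not> 0 < c j"
    then have cj: "c j = 0" using c0[of j] by simp
    \<comment> \<open>\<open>p\<close> and \<open>q\<close> are the nearest positive cells around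
      the empty cell \<open>j\<close>. Midpoints between their slabs fall in the range from
      \<open>Suc p\<close> to \<open>q\<close>, which is made up of null slabs.\<close>
    define p where "p = Max {i. i < j \<and> 0 < c i}"
    define q where "q = (LEAST l. j < l \<and> 0 < c l)"
    have "finite {i. i < j \<and> 0 < c i}" "{i. i < j \<and> 0 < c i} \<noteq> {}" using ijl by auto
    from Max_in[OF this] Max_ge[OF this(1)] 
    have p: "p < j" "0 < c p" "\<And>k. k < j \<Longrightarrow> 0 < c k \<Longrightarrow> k \<le> p" by (auto simp: p_def)
    have q: "j < q" "0 < c q" "\<And>k. j < k \<Longrightarrow> 0 < c k \<Longrightarrow> q \<le> k"
      using LeastI[of "\<lambda>l. j < l \<and> 0 < c l" l] ijl Least_le[of "\<lambda>l. j < l \<and> 0 < c l"] by (auto simp: q_def)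
    have z: "c k = 0" if "k \<in> {Suc p..<q}" for k
      using p(3)[of k] q(3)[of k] cj that c0[of k] by (cases k j rule: linorder_cases) force+
    have "E (Suc p) q \<subseteq> (\<Union>k\<in>{Suc p..<q}. slab Q b s k)"
    proof
      fix y assume y: "y \<in> E (Suc p) q"
      define k where "k = nat \<lfloor>b \<bullet> y - s\<rfloor>"
      have k: "real k \<le> b \<bullet> y - s" "b \<bullet> y - s < real k + 1"
        using y by (auto simp: k_def E_def)
      then have "k \<in> {Suc p..<q}" using y by (auto simp: E_def)
      then show "y \<in> (\<Union>k\<in>{Suc p..<q}. slab Q b s k)" using k y by (auto simp: slab_def E_def)
    qed
    then have "measure M (E (Suc p) q) \<le> measure M (\<Union>k\<in>{Suc p..<q}. slab Q b s k)"
      using E by (intro finite_measure_mono) (auto simp: slab)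
    also have "\<dots> \<le> (\<Sum>k\<in>{Suc p..<q}. measure M (slab Q b s k))"
      using E by (intro finite_measure_subadditive_finite) (auto simp: slab)
    also have "\<dots> = 0" using z by (simp add: c_def)
    finally have "measure M (E (Suc p) q) = 0" by (simp add: measure_le_0_iff)
    moreover have "c p * c q \<le> (measure M (E (Suc p) q))\<^sup>2"
      unfolding c_def slab using p(1) q(1) by (intro mid) auto
    moreover have "0 < c p * c q" using p q by simp
    ultimately show False by simp
  qed
  moreover have "c i * c (Suc (Suc i)) \<le> (c (Suc i))\<^sup>2" for i
    unfolding c_def slab by (intro mid) auto
  ultimately show ?thesis using c0 unfolding log_concave_seq_def c_def by blast
qed

text \<open>The two families of cells are the slabs meeting \<open>S\<close> and those meeting
  \<open>T\<close>. The slab width costs one unit: points in slabs \<open>i\<close> and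
  \<open>j\<close> differ by less than the index distance plus 1, so a separation of
  \<open>m + 1\<close> forces an index distance above \<open>m\<close>.\<close>

lemma separated_needle:
  assumes Q: "convex Q" "Q \<in> sets borel" and range: "\<And>y. y \<in> Q \<Longrightarrow> 0 \<le> b \<bullet> y - s \<and> b \<bullet> y - s < real n"
    and ST: "S \<in> sets lebesgue" "T \<in> sets lebesgue"
    and sep: "\<And>y z. y \<in> S \<Longrightarrow> y \<in> Q \<Longrightarrow> z \<in> T \<Longrightarrow> z \<in> Q \<Longrightarrow> real m + 1 \<le> \<bar>b \<bullet> y - b \<bullet> z\<bar>"
    and x: "0 < x" "x \<le> 1/2" "measure M (S \<inter> Q) = x * measure M Q"
  shows "(m / n) * (1 - 2 * (m / n)) * iso_prof x * measure M Q \<le> (1 - x) * measure M Q - measure M (T \<inter> Q)"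
proof (cases "measure M Q = 0")
  case True
  have "measure M (T \<inter> Q) \<le> measure M Q" using Q ST by (intro finite_measure_mono) auto
  then show ?thesis using True by (simp add: measure_le_0_iff)
next
  case False
  define V where "V = measure M Q"
  have V: "V > 0" using False by (simp add: V_def zero_less_measure_iff)
  define D where "D = slab Q b s"
  have Dm [measurable]: "D k \<in> sets lebesgue" for k
    using slab_borel[OF Q(2), of k b s "k + 1"] by (simp add: D_def slab_def add.commute)
  define c where "c k = measure M (D k) / V" for k
  have lc: "log_concave_seq n c"
    using slab_log_concave[OF Q, of n b s] V unfolding log_concave_seq_def c_def D_def
    by (auto simp: field_simps power2_eq_square)
  have cover: "\<exists>k<n. y \<in> D k" if "y \<in> Q" for y
  proof -
    define k where "k = nat \<lfloor>b \<bullet> y - s\<rfloor>"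
    have "real k \<le> b \<bullet> y - s" "b \<bullet> y - s < real k + 1" using range[OF that] by (auto simp: k_def)
    moreover from this have "k < n" using range[OF that] by linarith
    ultimately show ?thesis using that by (auto simp: D_def slab_def)
  qed
  have "disjoint_family_on D {..<n}"
    unfolding disjoint_family_on_def D_def slab_def
  proof (intro ballI impI)
    fix i j :: nat assume "i \<noteq> j"
    then have "real i + 1 \<le> real j \<or> real j + 1 \<le> real i" by linarith
    then show "{y \<in> Q. real i \<le> b \<bullet> y - s \<and> b \<bullet> y - s < real i + 1} \<inter> {y \<in> Q. real j \<le> b \<bullet> y - s \<and> b \<bullet> y - s < real j + 1} = {}"
      by auto
  qed
  then have "(\<Sum>k<n. measure M (D k)) = measure M (\<Union>k<n. D k)"
    by (intro finite_measure_finite_Union[symmetric]) auto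
  also have "(\<Union>k<n. D k) = Q" using cover by (auto simp: D_def slab_def)
  finally have sum1: "(\<Sum>k<n. c k) = 1" using V by (simp add: c_def sum_divide_distrib[symmetric] V_def)
  have cov: "measure M (X \<inter> Q) / V \<le> sum c {k. k < n \<and> D k \<inter> X \<noteq> {}}" if X: "X \<in> sets lebesgue" for X
  proof -
    have "measure M (X \<inter> Q) \<le> measure M (\<Union>k\<in>{k. k < n \<and> D k \<inter> X \<noteq> {}}. D k)"
      using cover by (intro finite_measure_mono) fastforce+
    also have "\<dots> \<le> (\<Sum>k\<in>{k. k < n \<and> D k \<inter> X \<noteq> {}}. measure M (D k))"
      by (intro finite_measure_subadditive_finite) auto
    finally show ?thesis using V by (simp add: c_def sum_divide_distrib[symmetric] divide_right_mono)
  qed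
  have "(m / n) * (1 - 2 * (m / n)) * iso_prof x \<le> 1 - x - measure M (T \<inter> Q) / V"
  proof (rule discrete_isoperimetry[OF lc sum1])
    fix i j assume "i \<in> {k. k < n \<and> D k \<inter> S \<noteq> {}}" "j \<in> {k. k < n \<and> D k \<inter> T \<noteq> {}}"
    then obtain y z where yz: "y \<in> D i" "y \<in> S" "z \<in> D j" "z \<in> T" by auto
    then have "real m + 1 \<le> \<bar>b \<bullet> y - b \<bullet> z\<bar>" by (intro sep) (auto simp: D_def slab_def)
    then have "real m < real i - real j \<or> real m < real j - real i"
      using yz by (auto simp: D_def slab_def abs_if split: if_splits)
    then show "i + m < j \<or> j + m < i" by linarith
  next
    show "x \<le> sum c {k. k < n \<and> D k \<inter> S \<noteq> {}}" using cov[OF ST(1)] x V by (simp add: V_def)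
    show "measure M (T \<inter> Q) / V \<le> sum c {k. k < n \<and> D k \<inter> T \<noteq> {}}" by (rule cov[OF ST(2)])
  qed (use x in auto)
  then have "(m / n) * (1 - 2 * (m / n)) * iso_prof x * V \<le> (1 - x - measure M (T \<inter> Q) / V) * V"
    using V by (intro mult_right_mono) auto
  then show ?thesis using V by (simp add: V_def left_diff_distrib)
qed

end

section \<open>Norms on Euclidean space\<close>

lemma is_normD:
  assumes "is_norm N"
  shows is_norm_nonneg: "0 \<le> N x" and is_norm_eq_0: "N x = 0 \<longleftrightarrow> x = 0" and is_norm_scale: "N (c *\<^sub>R x) = \<bar>c\<bar> * N x"
    and is_norm_triangle: "N (x + y) \<le> N x + N y"
  using assms by (simp_all add: is_norm_def)

lemma is_norm_minus: "is_norm N \<Longrightarrow> N (- x) = N x"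
  using is_norm_scale[of N "-1" x] by simp

lemma is_norm_diff_commute: "is_norm N \<Longrightarrow> N (x - y) = N (y - x)"
  using is_norm_minus[of N "x - y"] by simp

lemma is_norm_upper_bound:
  fixes N :: "'a::euclidean_space \<Rightarrow> real"
  assumes N: "is_norm N"
  obtains C where "C > 0" "\<And>x. N x \<le> C * norm x"
proof
  have sum_le: "N (sum g I) \<le> (\<Sum>i\<in>I. N (g i))" if "finite I" for g :: "'a \<Rightarrow> 'a" and I
    using that
  proof (induction I rule: finite_induct)
    case empty
    then show ?case using is_norm_eq_0[OF N, of 0] by simp
  next
    case (insert i I)
    then show ?case using is_norm_triangle[OF N, of "g i" "sum g I"] by simp
  qed
  have nn: "0 \<le> (\<Sum>b\<in>Basis. N b)" using is_norm_nonneg[OF N] by (intro sum_nonneg) auto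
  then show "1 + (\<Sum>b\<in>Basis. N b) > 0" by simp
  fix x :: 'a
  have "N x = N (\<Sum>b\<in>Basis. (x \<bullet> b) *\<^sub>R b)" by (simp add: euclidean_representation)
  also have "\<dots> \<le> (\<Sum>b\<in>Basis. N ((x \<bullet> b) *\<^sub>R b))" by (intro sum_le) simp
  also have "\<dots> = (\<Sum>b\<in>Basis. \<bar>x \<bullet> b\<bar> * N b)" by (simp add: is_norm_scale[OF N])
  also have "\<dots> \<le> (\<Sum>b\<in>Basis. norm x * N b)"
    using is_norm_nonneg[OF N] Basis_le_norm by (intro sum_mono mult_right_mono) auto
  also have "\<dots> = (\<Sum>b\<in>Basis. N b) * norm x" by (simp add: sum_distrib_left mult.commute)
  also have "\<dots> \<le> (1 + (\<Sum>b\<in>Basis. N b)) * norm x" by (intro mult_right_mono) auto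
  finally show "N x \<le> (1 + (\<Sum>b\<in>Basis. N b)) * norm x" .
qed

lemma is_norm_diff_ineq: "is_norm N \<Longrightarrow> \<bar>N x - N y\<bar> \<le> N (x - y)"
  using is_norm_triangle[of N "x - y" y] is_norm_triangle[of N "y - x" x] is_norm_diff_commute[of N x y] by simp

lemma is_norm_continuous:
  fixes N :: "'a::euclidean_space \<Rightarrow> real"
  assumes N: "is_norm N"
  shows "continuous_on S N"
proof -
  obtain C where C: "C > 0" "\<And>x. N x \<le> C * norm x" using is_norm_upper_bound[OF N] by blast
  have "C-lipschitz_on S N"
  proof (rule lipschitz_onI)
    show "dist (N x) (N y) \<le> C * dist x y" for x y
      using is_norm_diff_ineq[OF N, of x y] C(2)[of "x - y"] by (simp add: dist_norm)
  qed (use C in auto)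
  then show ?thesis by (rule lipschitz_on_continuous_on)
qed

lemma is_norm_lower_bound:
  fixes N :: "'a::euclidean_space \<Rightarrow> real"
  assumes N: "is_norm N"
  obtains c where "c > 0" "\<And>x. c * norm x \<le> N x"
proof -
  obtain b :: 'a where "b \<in> Basis" using nonempty_Basis by blast
  then have "sphere (0::'a) 1 \<noteq> {}" by (auto intro!: exI[of _ b])
  then obtain u where u: "norm u = 1" "\<And>x. norm x = 1 \<Longrightarrow> N u \<le> N x"
    using continuous_attains_inf[OF compact_sphere _ is_norm_continuous[OF N]] by (metis mem_sphere_0)
  show thesis
  proof
    have "u \<noteq> 0" using u(1) by auto
    then show "N u > 0" using is_norm_eq_0[OF N, of u] is_norm_nonneg[OF N, of u] by simp
    show "N u * norm x \<le> N x" for x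
    proof (cases "x = 0")
      case False
      then have "N u \<le> N (sgn x)" by (intro u(2)) (simp add: norm_sgn)
      also have "\<dots> = N x / norm x" by (simp add: sgn_div_norm is_norm_scale[OF N] field_simps)
      finally show ?thesis using False by (simp add: field_simps)
    qed (simp add: is_norm_nonneg[OF N])
  qed
qed

section \<open>Isoperimetry for separated sets\<close>

context log_concave_density
begin

text \<open>In a thin piece differences are almost multiples of \<open>v\<close>, so the linear
  functional \<open>N v * (v \<bullet> y)\<close> reproduces the distances of an arbitrary norm up
  to \<epsilon>. This reduces the norm to slabs orthogonal to \<open>v\<close>.\<close>

lemma thin_piece_bound:
  assumes N: "is_norm N" and C: "\<And>x. N x \<le> C * norm x" "0 < C"
    and Q: "convex Q" "Q \<in> sets borel" and D: "\<And>y z. y \<in> Q \<Longrightarrow> z \<in> Q \<Longrightarrow> N (y - z) \<le> D"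
    and v: "norm v = 1" and thin: "\<And>y z. y \<in> Q \<Longrightarrow> z \<in> Q \<Longrightarrow> norm (y - z - (v \<bullet> (y - z)) *\<^sub>R v) \<le> \<epsilon> / C"
    and ST: "S \<in> sets lebesgue" "T \<in> sets lebesgue"
    and sep: "\<And>y z. y \<in> S \<Longrightarrow> y \<in> Q \<Longrightarrow> z \<in> T \<Longrightarrow> z \<in> Q \<Longrightarrow> h \<le> N (y - z)"
    and x: "0 < x" "x \<le> 1/2" "measure M (S \<inter> Q) = x * measure M Q"
    and n: "0 < n" and mn: "(real m + 1) * (D + 2 * \<epsilon>) \<le> real n * (h - \<epsilon>)" and \<epsilon>: "0 < \<epsilon>" and D0: "0 \<le> D"
  shows "(m / n) * (1 - 2 * (m / n)) * iso_prof x * measure M Q \<le> (1 - x) * measure M Q - measure M (T \<inter> Q)"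
proof (cases "Q = {}")
  case False
  define l where "l y = N v * (v \<bullet> y)" for y
  have l: "\<bar>\<bar>l y - l z\<bar> - N (y - z)\<bar> \<le> \<epsilon>" if "y \<in> Q" "z \<in> Q" for y z
  proof -
    have "\<bar>l y - l z\<bar> = N ((v \<bullet> (y - z)) *\<^sub>R v)"
      using is_norm_nonneg[OF N, of v]
      by (simp add: l_def is_norm_scale[OF N] inner_diff_right right_diff_distrib[symmetric] abs_mult mult.commute)
    then have "\<bar>\<bar>l y - l z\<bar> - N (y - z)\<bar> \<le> N ((v \<bullet> (y - z)) *\<^sub>R v - (y - z))"
      using is_norm_diff_ineq[OF N] by simp
    also have "\<dots> = N (y - z - (v \<bullet> (y - z)) *\<^sub>R v)" by (rule is_norm_diff_commute[OF N])
    also have "\<dots> \<le> C * (\<epsilon> / C)" 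
      using thin[OF that] C by (meson mult_left_mono less_imp_le order_trans)
    finally show ?thesis using C by simp
  qed
  \<comment> \<open>The values of \<open>l\<close> spread over at most
    \<open>D + \<epsilon>\<close>; the second \<epsilon> makes the bound strict, as half-open slabs
    demand. Scaling by \<open>n / L\<close> then fits the piece into \<open>n\<close> slabs of width
    1.\<close>
  define L where "L = D + 2 * \<epsilon>"
  have L: "L > 0" using D0 \<epsilon> by (simp add: L_def)
  define t where "t = Inf (l ` Q)"
  obtain y0 where y0: "y0 \<in> Q" using False by auto
  have lD: "l y \<le> l z + (D + \<epsilon>)" if "y \<in> Q" "z \<in> Q" for y z
    using l[OF that] D[OF that] by linarith
  have bdd: "bdd_below (l ` Q)" using lD[OF y0] by (intro bdd_belowI[of _ "l y0 - (D + \<epsilon>)"]) force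
  have t1: "t \<le> l y" if "y \<in> Q" for y unfolding t_def using that bdd by (intro cINF_lower)
  have t2: "l y - (D + \<epsilon>) \<le> t" if "y \<in> Q" for y 
    unfolding t_def using lD[OF that] False by (intro cINF_greatest) force+
  define b where "b = (n / L * N v) *\<^sub>R v"
  define s where "s = n / L * t"
  have b: "b \<bullet> y = n / L * l y" for y by (simp add: b_def l_def)
  show ?thesis
  proof (rule separated_needle[OF Q _ ST _ x, of b s])
    fix y assume y: "y \<in> Q"
    have "b \<bullet> y - s = n / L * (l y - t)" by (simp add: b s_def right_diff_distrib)
    moreover have "0 \<le> l y - t" "l y - t < L" using t1[OF y] t2[OF y] \<epsilon> by (auto simp: L_def)
    moreover from this have "n / L * (l y - t) < n / L * L" using n L by (intro mult_strict_left_mono) auto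
    ultimately show "0 \<le> b \<bullet> y - s \<and> b \<bullet> y - s < real n" using n L by simp
  next
    fix y z assume yz: "y \<in> S" "y \<in> Q" "z \<in> T" "z \<in> Q"
    have "real m + 1 \<le> n / L * (h - \<epsilon>)" using mn L by (simp add: L_def field_simps)
    also have "\<dots> \<le> n / L * \<bar>l y - l z\<bar>"
      using sep[OF yz] l[OF yz(2,4)] L by (intro mult_left_mono) auto
    also have "\<dots> = \<bar>n / L * (l y - l z)\<bar>" using L by (simp only: abs_mult) simp
    also have "\<dots> = \<bar>b \<bullet> y - b \<bullet> z\<bar>" by (simp only: b right_diff_distrib)
    finally show "real m + 1 \<le> \<bar>b \<bullet> y - b \<bullet> z\<bar>" .
  qed
qed simp

lemma integral_indicator_combination:
  assumes "A \<in> sets lebesgue" "B \<in> sets lebesgue"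
  shows "integrable lebesgue (\<lambda>y. (a - b * indicator A y) * f y)"
    and "(LINT y|lebesgue. (a - b * indicator A y) * f y * indicator B y) = a * measure M B - b * measure M (A \<inter> B)"
proof -
  have int: "integrable lebesgue (\<lambda>y. f y * indicator X y)" if "X \<in> sets lebesgue" for X
    using integrable_mult_indicator[OF that integrable] by (simp add: mult.commute)
  have "integrable lebesgue (\<lambda>y. a * f y - b * (f y * indicator A y))"
    using integrable int[OF assms(1)] by (intro Bochner_Integration.integrable_diff integrable_mult_right) auto
  then show "integrable lebesgue (\<lambda>y. (a - b * indicator A y) * f y)"
    by (simp add: algebra_simps)
  have "(LINT y|lebesgue. (a - b * indicator A y) * f y * indicator B y)
    = (LINT y|lebesgue. a * (f y * indicator B y) - b * (f y * indicator (A \<inter> B) y))"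
    by (intro Bochner_Integration.integral_cong) (auto simp: indicator_def algebra_simps)
  also have "\<dots> = a * measure M B - b * measure M (A \<inter> B)"
    using assms int[of B] int[of "A \<inter> B"] by (subst Bochner_Integration.integral_diff) (auto simp: measure_M)
  finally show "(LINT y|lebesgue. (a - b * indicator A y) * f y * indicator B y) = a * measure M B - b * measure M (A \<inter> B)" .
qed

text \<open>Localization with the constraint weight \<open>(x - indicator S y) * f y\<close> and the
  conclusion weight \<open>(1 - x - \<kappa> - indicator T y) * f y\<close>: a zero integral of the
  first says that \<open>S\<close> has proportion \<open>x\<close>, a nonnegative integral of the
  second is the needle inequality.\<close>

lemma separated_sets_grid_bound:
  assumes N: "is_norm N" and K: "convex K" "K \<in> sets borel" "bounded K" 
    and D: "\<And>y z. y \<in> K \<Longrightarrow> z \<in> K \<Longrightarrow> N (y - z) \<le> D" "0 \<le> D"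
    and ST: "S \<in> sets lebesgue" "T \<in> sets lebesgue"
    and sep: "\<And>y z. y \<in> S \<Longrightarrow> y \<in> K \<Longrightarrow> z \<in> T \<Longrightarrow> z \<in> K \<Longrightarrow> h \<le> N (y - z)"
    and x: "0 < x" "x \<le> 1/2" "measure M (S \<inter> K) = x * measure M K"
    and mn: "(real m + 1) * D < real n * h"
  shows "(m / n) * (1 - 2 * (m / n)) * iso_prof x * measure M K \<le> (1 - x) * measure M K - measure M (T \<inter> K)"
proof -
  have n: "n > 0" using mn D(2) by (cases n) (auto simp: mult_less_0_iff)
  \<comment> \<open>The solution of
    \<open>(m + 1) * (D + 2 * \<epsilon>) = n * (h - \<epsilon>)\<close>, positive exactly because
    the hypothesis on \<open>m\<close> and \<open>n\<close> is strict.\<close>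
  define \<epsilon> where "\<epsilon> = (real n * h - (real m + 1) * D) / (2 * (real m + 1) + real n)"
  have \<epsilon>: "\<epsilon> > 0" using mn by (simp add: \<epsilon>_def)
  have "\<epsilon> * (2 * (real m + 1) + real n) = real n * h - (real m + 1) * D" by (simp add: \<epsilon>_def)
  then have mn': "(real m + 1) * (D + 2 * \<epsilon>) \<le> real n * (h - \<epsilon>)" by (simp add: algebra_simps)
  obtain C where C: "C > 0" "\<And>x. N x \<le> C * norm x" using is_norm_upper_bound[OF N] by blast
  obtain R where R: "R > 0" "K \<subseteq> cball 0 R" 
    using K(3) unfolding bounded_pos by (metis mem_cball_0 subsetI)
  obtain L :: "('a \<times> 'a \<times> real \<times> real) set" where L: "finite L"
    "\<And>i j p q. (i, j, p, q) \<in> L \<Longrightarrow> i \<in> Basis \<and> j \<in> Basis \<and> i \<noteq> j"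
    "\<And>Q. Q \<subseteq> cball 0 R \<Longrightarrow> (\<And>l. l \<in> L \<Longrightarrow> cut_by l Q) \<Longrightarrow>
       \<exists>v. norm v = 1 \<and> (\<forall>y\<in>Q. \<forall>z\<in>Q. norm (y - z - (v \<bullet> (y - z)) *\<^sub>R v) \<le> \<epsilon> / C)"
    using finite_cuts_make_thin[OF R(1), of "\<epsilon> / C"] \<epsilon> C(1) by (metis divide_pos_pos)
  define \<kappa> where "\<kappa> = (m / n) * (1 - 2 * (m / n)) * iso_prof x"
  have "0 \<le> (LINT y|lebesgue. (((1 - x - \<kappa>) - 1 * indicator T y) * f y) * indicator K y)"
  proof (rule localization_induct[OF integral_indicator_combination(1)[OF ST(1) ST(1), of x 1]
        integral_indicator_combination(1)[OF ST(2) ST(2)] L(1,2) _ K(1,2)])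
    show "(LINT y|lebesgue. (x - 1 * indicator S y) * f y * indicator K y) = 0"
      using K x ST by (subst integral_indicator_combination(2)) auto
    fix Q assume Q: "convex Q" "Q \<in> sets borel" "Q \<subseteq> K" 
      "(LINT y|lebesgue. (x - 1 * indicator S y) * f y * indicator Q y) = 0" "\<And>l. l \<in> L \<Longrightarrow> cut_by l Q"
    have "Q \<subseteq> cball 0 R" using Q(3) R(2) by blast
    then obtain v where v: "norm v = 1" "\<And>y z. y \<in> Q \<Longrightarrow> z \<in> Q \<Longrightarrow> norm (y - z - (v \<bullet> (y - z)) *\<^sub>R v) \<le> \<epsilon> / C"
      using L(3)[of Q] Q(5) by blast
    have xQ: "measure M (S \<inter> Q) = x * measure M Q"
      using Q(2,4) ST by (subst (asm) integral_indicator_combination(2)) auto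
    have "\<kappa> * measure M Q \<le> (1 - x) * measure M Q - measure M (T \<inter> Q)"
      unfolding \<kappa>_def using Q(3) D sep
      by (intro thin_piece_bound[OF N C(2) C(1) Q(1,2) _ v ST _ x(1,2) xQ n mn' \<epsilon> D(2)]) blast+
    moreover have "(LINT y|lebesgue. ((1 - x - \<kappa>) - 1 * indicator T y) * f y * indicator Q y) 
       = (1 - x - \<kappa>) * measure M Q - 1 * measure M (T \<inter> Q)"
      using Q(2) ST by (intro integral_indicator_combination(2)) auto
    ultimately show "0 \<le> (LINT y|lebesgue. ((1 - x - \<kappa>) - 1 * indicator T y) * f y * indicator Q y)"
      by (simp add: algebra_simps)
  qed
  moreover have "(LINT y|lebesgue. ((1 - x - \<kappa>) - 1 * indicator T y) * f y * indicator K y) 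
       = (1 - x - \<kappa>) * measure M K - 1 * measure M (T \<inter> K)"
    using K(2) ST by (intro integral_indicator_combination(2)) auto
  ultimately show ?thesis by (simp add: \<kappa>_def algebra_simps)
qed

lemma separated_sets_isoperimetry:
  assumes N: "is_norm N" and K: "convex K" "K \<in> sets borel" "bounded K" 
    and D: "\<And>y z. y \<in> K \<Longrightarrow> z \<in> K \<Longrightarrow> N (y - z) \<le> D" "0 < D"
    and ST: "S \<in> sets lebesgue" "T \<in> sets lebesgue"
    and sep: "\<And>y z. y \<in> S \<Longrightarrow> y \<in> K \<Longrightarrow> z \<in> T \<Longrightarrow> z \<in> K \<Longrightarrow> h \<le> N (y - z)"
    and x: "0 < x" "x \<le> 1/2" "measure M (S \<inter> K) = x * measure M K" and h: "0 < h"
  shows "(h / D) * (1 - 2 * (h / D)) * iso_prof x * measure M K \<le> (1 - x) * measure M K - measure M (T \<inter> K)"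
proof -
  define \<theta> where "\<theta> = h / D"
  have \<theta>: "\<theta> > 0" using h D by (simp add: \<theta>_def)
  \<comment> \<open>Subtracting 2 after rounding leaves room for the strict inequality
    \<open>(m n + 1) * D < n * h\<close> and does not affect the limit of
    \<open>m n / n\<close>.\<close>
  define m where "m n = nat (\<lfloor>\<theta> * real n\<rfloor> - 2)" for n :: nat
  have ev: "eventually (\<lambda>n. 3 \<le> \<theta> * real n) sequentially" using \<theta> by real_asymp
  have lim: "(\<lambda>n. real (m n) / real n) \<longlonglongrightarrow> \<theta>"
  proof (rule tendsto_sandwich)
    show "(\<lambda>n. \<theta> - 3 / real n) \<longlonglongrightarrow> \<theta>" by real_asymp
    show "(\<lambda>n. \<theta>) \<longlonglongrightarrow> \<theta>" by simp
    show "eventually (\<lambda>n. \<theta> - 3 / real n \<le> real (m n) / real n) sequentially"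
      using ev eventually_gt_at_top[of 0]
    proof eventually_elim
      case (elim n)
      have "\<theta> * real n - 3 \<le> real (m n)" using elim unfolding m_def by linarith
      then have "(\<theta> * real n - 3) / real n \<le> real (m n) / real n" by (intro divide_right_mono) auto
      then show ?case using elim by (simp add: diff_divide_distrib)
    qed
    show "eventually (\<lambda>n. real (m n) / real n \<le> \<theta>) sequentially"
      using ev eventually_gt_at_top[of 0]
    proof eventually_elim
      case (elim n)
      have "real (m n) \<le> \<theta> * real n" using elim unfolding m_def by linarith
      then show ?case using elim by (simp add: field_simps)
    qed
  qed
  have "(\<lambda>n. (m n / n) * (1 - 2 * (m n / n)) * iso_prof x * measure M K) \<longlonglongrightarrow> \<theta> * (1 - 2 * \<theta>) * iso_prof x * measure M K"
    by (intro tendsto_intros lim)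
  moreover have "eventually (\<lambda>n. (m n / n) * (1 - 2 * (m n / n)) * iso_prof x * measure M K \<le> 
      (1 - x) * measure M K - measure M (T \<inter> K)) sequentially"
    using ev
  proof eventually_elim
    case (elim n)
    have "real (m n) + 1 < \<theta> * real n" using elim unfolding m_def by linarith
    then have "(real (m n) + 1) * D < real n * h" using D(2) by (simp add: \<theta>_def field_simps)
    then show ?case using D(2) by (intro separated_sets_grid_bound[OF N K D(1) _ ST sep x]) auto
  qed
  ultimately show ?thesis unfolding \<theta>_def by (intro tendsto_upperbound) auto
qed

end

section \<open>Neighbourhoods and the lower bound\<close>

text \<open>The set where \<open>F\<close> is positive is convex, so its frontier is null; in its
  interior \<open>F\<close> is continuous, being the exponential of a concave function. Setting
  \<open>F\<close> to 0 outside the interior thus alters it on a null set only and yields a Borel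
  function. Midpoint log-concavity survives because the interior is convex.\<close>

lemma log_concave_density_version:
  fixes F :: "'a::euclidean_space \<Rightarrow> real"
  assumes F: "logconcave_prob_on F K"
  obtains f where "log_concave_density f" "AE y in lebesgue. F y = f y" "\<And>y. y \<notin> K \<Longrightarrow> f y = 0"
proof
  have nn: "0 \<le> F x" for x using F by (auto simp: logconcave_prob_on_def log_concave_fun_def)
  have lc: "F x powr t * F y powr (1 - t) \<le> F (t *\<^sub>R x + (1 - t) *\<^sub>R y)" if "0 \<le> t" "t \<le> 1" for x y t
    using F that by (auto simp: logconcave_prob_on_def log_concave_fun_def)
  define P where "P = {x. 0 < F x}"
  define U where "U = interior P"
  define f where "f y = indicator U y *\<^sub>R F y" for y
  have UP: "U \<subseteq> P" unfolding U_def by (rule interior_subset)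
  have convP: "convex P"
  proof (rule convexI)
    fix x y and u v :: real assume xy: "x \<in> P" "y \<in> P" and uv: "0 \<le> u" "0 \<le> v" "u + v = 1"
    have "0 < F x powr u * F y powr (1 - u)" using xy by (simp add: P_def)
    also have "\<dots> \<le> F (u *\<^sub>R x + (1 - u) *\<^sub>R y)" using uv by (intro lc) auto
    also have "1 - u = v" using uv by simp
    finally show "u *\<^sub>R x + v *\<^sub>R y \<in> P" by (simp add: P_def)
  qed
  then have convU: "convex U" unfolding U_def by (rule convex_interior)
  have "convex_on U (\<lambda>x. - ln (F x))"
  proof (rule convex_onI[OF _ convU])
    fix t :: real and x y assume t: "0 < t" "t < 1" and xy: "x \<in> U" "y \<in> U"
    have pos: "0 < F x" "0 < F y" using xy UP by (auto simp: P_def)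
    have "(1 - t) * ln (F x) + t * ln (F y) = ln (F x powr (1 - t) * F y powr (1 - (1 - t)))"
      using pos by (simp add: ln_mult ln_powr)
    also have "\<dots> \<le> ln (F ((1 - t) *\<^sub>R x + (1 - (1 - t)) *\<^sub>R y))"
      using pos t by (intro ln_mono lc) auto
    finally show "- ln (F ((1 - t) *\<^sub>R x + t *\<^sub>R y)) \<le> (1 - t) * - ln (F x) + t * - ln (F y)" by simp
  qed
  then have "continuous_on U (\<lambda>x. - ln (F x))" by (intro convex_on_continuous) (simp_all add: U_def)
  then have "continuous_on U (\<lambda>x. exp (- (- ln (F x))))" 
    by (rule continuous_on_exp[OF continuous_on_minus])
  then have cont: "continuous_on U F"
    by (rule continuous_on_eq) (use UP in \<open>auto simp: P_def subset_iff\<close>)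
  have "U \<in> sets borel" by (simp add: U_def)
  then have fb: "f \<in> borel_measurable borel" unfolding f_def[abs_def]
    using cont by (rule borel_measurable_continuous_on_indicator)
  show AE: "AE y in lebesgue. F y = f y"
  proof (rule AE_I')
    show "frontier P \<in> null_sets lebesgue"
      using negligible_convex_frontier[OF convP] negligible_iff_null_sets by blast
    show "{y \<in> space lebesgue. \<not> F y = f y} \<subseteq> frontier P"
    proof
      fix y assume "y \<in> {y \<in> space lebesgue. \<not> F y = f y}"
      then have "y \<notin> U" "F y \<noteq> 0" by (auto simp: f_def indicator_def split: if_splits)
      then have "y \<in> P" using nn[of y] by (simp add: P_def)
      then show "y \<in> frontier P" using \<open>y \<notin> U\<close> closure_subset by (auto simp: frontier_def U_def)
    qed
  qed
  show "log_concave_density f"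
  proof
    show "f \<in> borel_measurable borel" by (rule fb)
    show "0 \<le> f x" for x using nn by (simp add: f_def)
    have "integrable lebesgue F" using F by (simp add: logconcave_prob_on_def)
    then show "integrable lebesgue f"
    proof (rule integrable_cong_AE_imp)
      show "f \<in> borel_measurable lebesgue" using fb by (intro measurable_completion) simp
      show "AE y in lebesgue. F y = f y" by (rule AE)
    qed
    fix x y
    show "f x * f y \<le> (f ((1/2) *\<^sub>R (x + y)))\<^sup>2"
    proof (cases "x \<in> U \<and> y \<in> U")
      case True
      then have mU: "(1/2) *\<^sub>R (x + y) \<in> U" using convexD[OF convU, of x y "1/2" "1/2"] by (simp add: scaleR_add_right)
      have "sqrt (F x) * sqrt (F y) \<le> F ((1/2) *\<^sub>R (x + y))"
        using lc[of "1/2" x y] nn by (simp add: powr_half_sqrt scaleR_add_right)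
      then have "(sqrt (F x) * sqrt (F y))\<^sup>2 \<le> (F ((1/2) *\<^sub>R (x + y)))\<^sup>2"
        using nn by (intro power_mono) auto
      then show ?thesis using nn True mU by (simp add: f_def power_mult_distrib)
    qed (auto simp: f_def)
  qed
  show "f y = 0" if "y \<notin> K" for y using F that by (simp add: f_def logconcave_prob_on_def)
qed

lemma diamN_upper:
  fixes N :: "'a::euclidean_space \<Rightarrow> real"
  assumes N: "is_norm N" and K: "bounded K" and yz: "y \<in> K" "z \<in> K"
  shows "N (y - z) \<le> diamN N K"
proof -
  obtain C where C: "C > 0" "\<And>x. N x \<le> C * norm x" using is_norm_upper_bound[OF N] by blast
  obtain R where R: "\<And>x. x \<in> K \<Longrightarrow> norm x \<le> R" using K by (auto simp: bounded_iff)
  have "bdd_above {N (a - b) | a b. a \<in> K \<and> b \<in> K}"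
  proof (rule bdd_aboveI)
    fix u assume "u \<in> {N (a - b) | a b. a \<in> K \<and> b \<in> K}"
    then obtain a b where "u = N (a - b)" "a \<in> K" "b \<in> K" by auto
    then have "u \<le> C * norm (a - b)" "norm (a - b) \<le> R + R"
      using C(2) R[of a] R[of b] norm_triangle_ineq4[of a b] by auto
    then show "u \<le> C * (R + R)" using C(1) by (meson mult_left_mono less_imp_le order_trans)
  qed
  then show ?thesis unfolding diamN_def using yz by (intro cSup_upper) auto
qed

section \<open>Neighbourhoods and good radii\<close>

definition open_nbhd :: "('a \<Rightarrow> real) \<Rightarrow> 'a::real_normed_vector set \<Rightarrow> real \<Rightarrow> 'a set" where
  "open_nbhd N S h = {y. \<exists>s\<in>S. N (y - s) < h}"

lemma open_open_nbhd:
  fixes N :: "'a::euclidean_space \<Rightarrow> real"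
  assumes N: "is_norm N"
  shows "open (open_nbhd N S h)"
proof -
  have "open_nbhd N S h = (\<Union>s\<in>S. {y. N (y - s) < h})" by (auto simp: open_nbhd_def)
  moreover have "open {y. N (y - s) < h}" for s
    by (intro open_Collect_less continuous_on_compose2[OF is_norm_continuous[OF N, of UNIV]] continuous_intros) auto
  ultimately show ?thesis by auto
qed

text \<open>The volume of \<open>open_nbhd N S h \<inter> K\<close> is monotone in \<open>h\<close>, so the sphere-like difference of the
  closed and the open neighbourhood is null for all but countably many \<open>h\<close>. This takes the place of
  measurability of \<open>nbhd N S h\<close>, which is not obvious for an arbitrary measurable \<open>S\<close>.\<close>

lemma countable_bad_radii:
  fixes N :: "'a::euclidean_space \<Rightarrow> real"
  assumes N: "is_norm N" and K: "K \<in> lmeasurable"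
  shows "countable {h. \<not> negligible (nbhd N S h \<inter> K - open_nbhd N S h)}"
proof -
  define \<phi> where "\<phi> h = measure lebesgue (open_nbhd N S h \<inter> K)" for h
  have lm: "open_nbhd N S h \<inter> K \<in> lmeasurable" for h
    using fmeasurable_Int_fmeasurable[OF K, of "open_nbhd N S h"] borel_open[OF open_open_nbhd[OF N, of S h]]
    by (simp add: Int_commute)
  have sub: "open_nbhd N S h \<subseteq> open_nbhd N S h'" if "h \<le> h'" for h h'
    using that by (auto simp: open_nbhd_def intro: less_le_trans)
  have "mono \<phi>" unfolding \<phi>_def using sub lm by (intro monoI measure_mono_fmeasurable) auto
  then have "countable {h. \<not> isCont \<phi> h}" by (rule mono_ctble_discont)
  moreover have "negligible (nbhd N S h \<inter> K - open_nbhd N S h)" if c: "isCont \<phi> h" for h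
    unfolding negligible_outer
  proof (intro allI impI)
    fix e :: real assume e: "e > 0"
    have "(\<phi> \<longlongrightarrow> \<phi> h) (at_right h)" using c by (simp add: isCont_def filterlim_at_split)
    then have "eventually (\<lambda>h'. \<phi> h' < \<phi> h + e) (at_right h)" using e by (intro order_tendstoD) auto
    then obtain b where b: "b > h" "\<And>h'. h < h' \<Longrightarrow> h' < b \<Longrightarrow> \<phi> h' < \<phi> h + e"
      by (auto simp: eventually_at_right_field)
    then obtain h' where h': "h < h'" "h' < b" using dense by blast
    \<comment> \<open>The closed neighbourhood lies in every open one of larger radius, so the
      difference is covered by a set of measure \<open>\<phi> h' - \<phi> h\<close>.\<close>
    let ?T = "(open_nbhd N S h' \<inter> K) - (open_nbhd N S h \<inter> K)"
    have "measure lebesgue ?T = \<phi> h' - \<phi> h"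
      unfolding \<phi>_def using lm sub[of h h'] h' by (intro measurable_measure_Diff) (auto simp: fmeasurableD)
    then have "measure lebesgue ?T < e" using b(2)[OF h'] by simp
    moreover have "nbhd N S h \<inter> K - open_nbhd N S h \<subseteq> ?T"
      using h' by (auto simp: nbhd_def open_nbhd_def intro: le_less_trans)
    moreover have "?T \<in> lmeasurable" using lm by (intro fmeasurable.Diff) auto
    ultimately show "\<exists>T. nbhd N S h \<inter> K - open_nbhd N S h \<subseteq> T \<and> T \<in> lmeasurable \<and> measure lebesgue T < e"
      by blast
  qed
  then have "{h. \<not> negligible (nbhd N S h \<inter> K - open_nbhd N S h)} \<subseteq> {h. \<not> isCont \<phi> h}" by blast
  ultimately show ?thesis by (rule countable_subset[rotated])
qed

lemma good_radii:
  fixes N :: "'a::euclidean_space \<Rightarrow> real"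
  assumes N: "is_norm N" and K: "K \<in> lmeasurable"
  obtains X where "\<And>k. 0 < X k" "X \<longlonglongrightarrow> 0" 
    "\<And>k::nat. negligible (nbhd N S (X k) \<inter> K - open_nbhd N S (X k))"
proof -
  have "\<exists>h. 0 < h \<and> h < 1 / Suc k \<and> negligible (nbhd N S h \<inter> K - open_nbhd N S h)" for k
  proof (rule ccontr)
    assume "\<not> ?thesis"
    then have "{0<..<1 / real (Suc k)} \<subseteq> {h. \<not> negligible (nbhd N S h \<inter> K - open_nbhd N S h)}" by auto
    then have "countable {0<..<1 / real (Suc k)}" using countable_bad_radii[OF N K] countable_subset by blast
    then show False using uncountable_open_interval[of 0 "1 / real (Suc k)"] by simp
  qed
  then obtain X where X: "\<And>k. 0 < X k" "\<And>k. X k < 1 / Suc k" 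
    "\<And>k. negligible (nbhd N S (X k) \<inter> K - open_nbhd N S (X k))" by metis
  have "X \<longlonglongrightarrow> 0"
  proof (rule tendsto_sandwich[of "\<lambda>_. 0" _ _ "\<lambda>k. 1 / real (Suc k)"])
    show "(\<lambda>k. 1 / real (Suc k)) \<longlonglongrightarrow> 0" by real_asymp
  qed (use X(1,2) in \<open>auto intro!: eventuallyI less_imp_le\<close>)
  then show thesis using that[of X] X by blast
qed

text \<open>The limit that defines the Minkowski measure may be taken along good radii, where the
  mass of the neighbourhood is that of an open set. The part of \<open>K\<close> outside this open
  set has distance at least \<open>h\<close> from \<open>S\<close>, and the error factor tends to 1
  with \<open>h\<close>.\<close>

lemma minkowski_lower_bound:
  fixes N :: "'a::euclidean_space \<Rightarrow> real"
  assumes N: "is_norm N" and K: "convex_body K" and F: "logconcave_prob_on F K"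
    and S: "S \<in> sets lebesgue" "S \<subseteq> K" and x: "0 < mu F S" "mu F S \<le> 1/2" and m: "has_minkowski N F S m"
  shows "mu F S * G (1 / mu F S) \<le> diamN N K * m"
proof -
  obtain f where f: "log_concave_density f" and AE: "AE y in lebesgue. F y = f y" and fK: "\<And>y. y \<notin> K \<Longrightarrow> f y = 0"
    using log_concave_density_version[OF F] by blast
  interpret log_concave_density f by (rule f)
  define D where "D = diamN N K"
  define x where "x = mu F S"
  have Kb: "closed K" "bounded K" "convex K" using K by (auto simp: convex_body_def)
  then have Ks: "K \<in> sets borel" "K \<in> lmeasurable" by (auto intro: lmeasurable_compact simp: compact_eq_bounded_closed)
  have Fm [measurable]: "F \<in> borel_measurable lebesgue" and FK: "\<And>y. y \<notin> K \<Longrightarrow> F y = 0" 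
    and F1: "(LINT y|lebesgue. F y) = 1"
    using F by (auto simp: logconcave_prob_on_def)
  have fm [measurable]: "f \<in> borel_measurable lebesgue" using integrable by auto
  \<comment> \<open>Only \<open>A \<inter> K\<close> is taken to be measurable and a null
    discrepancy \<open>Z\<close> is allowed, so that this applies to
    \<open>nbhd N S h - S\<close>.\<close>
  have mu: "mu F A = measure M B" 
    if "A \<inter> K \<in> sets lebesgue" "B \<in> sets lebesgue" and Z: "negligible Z" "\<And>y. y \<notin> Z \<Longrightarrow> y \<in> K \<Longrightarrow> y \<in> A \<longleftrightarrow> y \<in> B" for A B Z
  proof -
    have [measurable]: "A \<inter> K \<in> sets lebesgue" "B \<in> sets lebesgue" by fact+
    have ZAE: "AE y in lebesgue. y \<notin> Z"
      using Z(1) by (intro AE_not_in) (simp add: negligible_iff_null_sets)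
    have "mu F A = (LINT y|lebesgue. F y * indicator (A \<inter> K) y)"
      unfolding mu_def set_lebesgue_integral_def using FK
      by (intro Bochner_Integration.integral_cong) (auto simp: indicator_def)
    also have "\<dots> = (LINT y|lebesgue. f y * indicator B y)"
    proof (rule integral_cong_AE)
      show "AE y in lebesgue. F y * indicator (A \<inter> K) y = f y * indicator B y"
        using AE ZAE
      proof eventually_elim
        case (elim y)
        then show ?case using Z(2)[of y] fK[of y] by (cases "y \<in> K") (auto simp: indicator_def)
      qed
    qed measurable
    finally show ?thesis using measure_M[of B] that by simp
  qed
  have MK: "measure M K = 1"
  proof -
    have "mu F UNIV = 1" using F1 by (simp add: mu_def set_lebesgue_integral_def)
    moreover have "mu F UNIV = measure M K" using Ks by (intro mu[of _ _ "{}"]) auto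
    ultimately show ?thesis by simp
  qed
  have MS: "measure M S = x" unfolding x_def using S Ks by (intro mu[of _ _ "{}", symmetric]) auto
  have Dle: "N (y - z) \<le> D" if "y \<in> K" "z \<in> K" for y z
    unfolding D_def using diamN_upper[OF N Kb(2) that] .
  \<comment> \<open>Otherwise \<open>K\<close> would contain at most one point and carry no
    mass.\<close>
  have D: "D > 0"
  proof (rule ccontr)
    assume nD: "\<not> D > 0"
    have eq: "y = z" if "y \<in> K" "z \<in> K" for y z
      using Dle[OF that] nD is_norm_nonneg[OF N, of "y - z"] is_norm_eq_0[OF N, of "y - z"] by simp
    have "negligible K"
    proof (cases "K = {}")
      case False
      then obtain y where "y \<in> K" by auto
      then have "K = {y}" using eq by auto
      then show ?thesis by simp
    qed simp
    then have "measure M K = mu F {}" using Ks by (intro mu[of _ _ K, symmetric]) auto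
    then show False using MK by (simp add: mu_def set_lebesgue_integral_def)
  qed
  obtain X where X: "\<And>k. 0 < X k" "X \<longlonglongrightarrow> 0" 
    and null: "\<And>k::nat. negligible (nbhd N S (X k) \<inter> K - open_nbhd N S (X k))"
    using good_radii[OF N Ks(2), of S] by blast
  have "filterlim X (at_right 0) sequentially"
    using X by (intro tendsto_imp_filterlim_at_right) auto
  then have lim: "(\<lambda>k. mu F (nbhd N S (X k) - S) / X k) \<longlonglongrightarrow> m"
    using m unfolding has_minkowski_def by (rule filterlim_compose[rotated])
  have low: "1 / D * (1 - 2 * (X k / D)) * iso_prof x \<le> mu F (nbhd N S (X k) - S) / X k" for k
  proof -
    define h where "h = X k"
    have h: "h > 0" using X by (simp add: h_def)
    define U where "U = open_nbhd N S h"
    have "y \<in> U" if "y \<in> S" for y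
      unfolding U_def open_nbhd_def using that h is_norm_eq_0[OF N, of 0] by (auto intro!: bexI[of _ y])
    then have U: "U \<in> sets lebesgue" "S \<subseteq> U" "U \<subseteq> nbhd N S h"
      using borel_open[OF open_open_nbhd[OF N, of S h]]
      by (auto simp: U_def open_nbhd_def nbhd_def intro: less_imp_le)
    define Z where "Z = nbhd N S h \<inter> K - U"
    have Z: "negligible Z" "Z \<in> sets lebesgue" using null[of k] negligible_imp_sets by (auto simp: Z_def U_def h_def)
    have "(nbhd N S h - S) \<inter> K = ((U - S) \<inter> K) \<union> Z" using U S by (auto simp: Z_def)
    moreover have "((U - S) \<inter> K) \<union> Z \<in> sets lebesgue" using U S Z Ks by auto
    ultimately have "mu F (nbhd N S h - S) = measure M (U \<inter> K - S)"
      using U S Ks Z by (intro mu[of _ _ Z]) (auto simp: Z_def)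
    also have "\<dots> = measure M (U \<inter> K) - measure M S"
      using U S Ks by (intro finite_measure_Diff) auto
    also have "measure M (U \<inter> K) = measure M K - measure M (K - U)"
    proof -
      have "measure M (K - (U \<inter> K)) = measure M K - measure M (U \<inter> K)"
        using U Ks by (intro finite_measure_Diff) auto
      moreover have "K - (U \<inter> K) = K - U" by auto
      ultimately show ?thesis by simp
    qed
    finally have eq: "mu F (nbhd N S h - S) = 1 - measure M (K - U) - x" by (simp add: MK MS)
    have "(h / D) * (1 - 2 * (h / D)) * iso_prof x * measure M K \<le> (1 - x) * measure M K - measure M ((K - U) \<inter> K)"
    proof (rule separated_sets_isoperimetry[OF N Kb(3) Ks(1) Kb(2) Dle D S(1)])
      show "K - U \<in> sets lebesgue" using U Ks by auto
      show "measure M (S \<inter> K) = x * measure M K" using S by (simp add: MK MS Int_absorb2)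
      fix y z assume "y \<in> S" "z \<in> K - U"
      then have "\<not> N (z - y) < h" by (auto simp: U_def open_nbhd_def)
      then show "h \<le> N (y - z)" using is_norm_diff_commute[OF N, of y z] by simp
    qed (use x h in \<open>auto simp: x_def\<close>)
    moreover have "(K - U) \<inter> K = K - U" by auto
    ultimately have "h * (1 / D * (1 - 2 * (h / D)) * iso_prof x) \<le> mu F (nbhd N S h - S)"
      unfolding eq by (simp add: MK)
    then show ?thesis unfolding h_def[symmetric] using h by (simp add: field_simps)
  qed
  have "(\<lambda>k. 1 / D * (1 - 2 * (X k / D)) * iso_prof x) \<longlonglongrightarrow> 1 / D * (1 - 2 * (0 / D)) * iso_prof x"
    by (intro tendsto_intros X) (use D in auto)
  then have "1 / D * (1 - 2 * (0 / D)) * iso_prof x \<le> m"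
    using lim low by (intro LIMSEQ_le) auto
  then have "iso_prof x \<le> D * m" using D by (simp add: field_simps)
  then show ?thesis using iso_prof_eq_G[of x] x by (simp add: x_def D_def)
qed

section \<open>Sharpness\<close>

text \<open>\<open>v\<close> maximises a linear form over the compact unit ball of \<open>N\<close>,
  and \<open>a\<close> is the form rescaled to maximum 1. In the norm \<open>N\<close>, level sets
  of \<open>a\<close> then have the difference of their levels as distance, attained along
  \<open>v\<close>.\<close>

lemma norming_functional:
  fixes N :: "'a::euclidean_space \<Rightarrow> real"
  assumes N: "is_norm N"
  obtains a v :: 'a where "a \<bullet> v = 1" "N v = 1" "\<And>y. \<bar>a \<bullet> y\<bar> \<le> N y"
proof -
  obtain b :: 'a where b: "b \<in> Basis" using nonempty_Basis by blast
  then have b0: "b \<noteq> 0" by auto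
  obtain c where c: "c > 0" "\<And>x. c * norm x \<le> N x" using is_norm_lower_bound[OF N] by blast
  define B where "B = {y. N y \<le> 1}"
  have "norm y \<le> 1 / c" if "y \<in> B" for y
    using c(2)[of y] that c(1) by (simp add: B_def field_simps)
  then have "bounded B" by (auto simp: bounded_iff)
  moreover have "closed B"
    unfolding B_def by (intro closed_Collect_le is_norm_continuous[OF N] continuous_intros)
  ultimately have "compact B" by (simp add: compact_eq_bounded_closed)
  have sc: "(1 / N y) *\<^sub>R y \<in> B" if "y \<noteq> 0" for y
    using that is_norm_nonneg[OF N, of y] is_norm_eq_0[OF N, of y] by (simp add: B_def is_norm_scale[OF N])
  then have "B \<noteq> {}" using b0 by blast
  have "continuous_on B (\<lambda>y. b \<bullet> y)" by (intro continuous_intros)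
  from continuous_attains_sup[OF \<open>compact B\<close> \<open>B \<noteq> {}\<close> this]
  obtain v where v: "v \<in> B" "\<And>y. y \<in> B \<Longrightarrow> b \<bullet> y \<le> b \<bullet> v" by blast
  define s where "s = b \<bullet> v"
  have pos: "N y > 0" if "y \<noteq> 0" for y using that is_norm_nonneg[OF N, of y] is_norm_eq_0[OF N, of y] by simp
  have "0 < b \<bullet> ((1 / N b) *\<^sub>R b)" using pos[OF b0] b0 by simp
  also have "\<dots> \<le> s" unfolding s_def by (intro v sc b0)
  finally have s: "s > 0" .
  define a where "a = (1 / s) *\<^sub>R b"
  have le: "a \<bullet> y \<le> N y" for y
  proof (cases "y = 0")
    case False
    have "(b \<bullet> y) / N y \<le> s" using v(2)[OF sc[OF False]] by (simp add: s_def)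
    then show ?thesis using pos[OF False] s by (simp add: a_def field_simps)
  qed (simp add: is_norm_nonneg[OF N])
  have av: "a \<bullet> v = 1" using s by (simp add: a_def s_def)
  show thesis
  proof
    show "a \<bullet> v = 1" by (rule av)
    show "N v = 1" using le[of v] av v(1) by (simp add: B_def)
    show "\<bar>a \<bullet> y\<bar> \<le> N y" for y using le[of y] le[of "- y"] is_norm_minus[OF N, of y] by (simp add: abs_le_iff)
  qed
qed

section \<open>Cylinders with exponential density\<close>

locale cylinder =
  fixes N :: "'a::euclidean_space \<Rightarrow> real" and a v :: 'a and r :: real
  assumes N: "is_norm N" and av: "a \<bullet> v = 1" and Nv: "N v = 1" and dual: "\<And>y. \<bar>a \<bullet> y\<bar> \<le> N y" and r: "0 < r"
begin

text \<open>The radius is proportional to the length, so cylinders are dilates of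
  \<open>cyl 1\<close> and a prescribed diameter is attained exactly by scaling.\<close>

definition cyl :: "real \<Rightarrow> 'a set" where
  "cyl L = {y. 0 \<le> a \<bullet> y \<and> a \<bullet> y \<le> L \<and> N (y - (a \<bullet> y) *\<^sub>R v) \<le> r * L}"

lemma continuous_radial: "continuous_on S (\<lambda>y. N (y - (a \<bullet> y) *\<^sub>R v))"
  by (intro continuous_on_compose2[OF is_norm_continuous[OF N, of UNIV]] continuous_intros) auto

lemma radial_convex:
  assumes "0 \<le> u" "0 \<le> w" 
  shows "N ((u *\<^sub>R x + w *\<^sub>R y) - (a \<bullet> (u *\<^sub>R x + w *\<^sub>R y)) *\<^sub>R v) \<le> u * N (x - (a \<bullet> x) *\<^sub>R v) + w * N (y - (a \<bullet> y) *\<^sub>R v)"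
proof -
  have "(u *\<^sub>R x + w *\<^sub>R y) - (a \<bullet> (u *\<^sub>R x + w *\<^sub>R y)) *\<^sub>R v = u *\<^sub>R (x - (a \<bullet> x) *\<^sub>R v) + w *\<^sub>R (y - (a \<bullet> y) *\<^sub>R v)"
    by (simp add: inner_add_right algebra_simps)
  then show ?thesis
    using is_norm_triangle[OF N, of "u *\<^sub>R (x - (a \<bullet> x) *\<^sub>R v)" "w *\<^sub>R (y - (a \<bullet> y) *\<^sub>R v)"] assms by (simp add: is_norm_scale[OF N])
qed

lemma convex_slice:
  "convex {y. N (y - (a \<bullet> y) *\<^sub>R v) \<le> \<rho>}"
proof (rule convexI)
  fix x y and u w :: real
  assume xy: "x \<in> {y. N (y - (a \<bullet> y) *\<^sub>R v) \<le> \<rho>}" "y \<in> {y. N (y - (a \<bullet> y) *\<^sub>R v) \<le> \<rho>}" and uw: "0 \<le> u" "0 \<le> w" "u + w = 1"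
  have "u * N (x - (a \<bullet> x) *\<^sub>R v) + w * N (y - (a \<bullet> y) *\<^sub>R v) \<le> u * \<rho> + w * \<rho>"
    using xy uw by (intro add_mono mult_left_mono) auto
  also have "\<dots> = \<rho>" using uw by (simp add: distrib_right[symmetric])
  finally show "u *\<^sub>R x + w *\<^sub>R y \<in> {y. N (y - (a \<bullet> y) *\<^sub>R v) \<le> \<rho>}"
    using radial_convex[OF uw(1,2), of x y] by simp
qed

lemma cyl_alt: "cyl L = {y. a \<bullet> y \<ge> 0} \<inter> {y. a \<bullet> y \<le> L} \<inter> {y. N (y - (a \<bullet> y) *\<^sub>R v) \<le> r * L}"
  by (auto simp: cyl_def)

lemma norm_le_cyl:
  assumes "0 \<le> a \<bullet> y" "a \<bullet> y \<le> L" "N (y - (a \<bullet> y) *\<^sub>R v) \<le> \<rho>"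
  shows "N y \<le> L + \<rho>"
proof -
  have "N y \<le> N ((a \<bullet> y) *\<^sub>R v) + N (y - (a \<bullet> y) *\<^sub>R v)"
    using is_norm_triangle[OF N, of "(a \<bullet> y) *\<^sub>R v" "y - (a \<bullet> y) *\<^sub>R v"] by simp
  then show ?thesis using assms by (simp add: is_norm_scale[OF N] Nv)
qed

lemma bounded_cyl: "bounded (cyl L)"
proof -
  obtain c where c: "c > 0" "\<And>x. c * norm x \<le> N x" using is_norm_lower_bound[OF N] by blast
  have "norm y \<le> (L + r * L) / c" if "y \<in> cyl L" for y
    using c(2)[of y] norm_le_cyl[of y L "r * L"] that c(1) by (simp add: cyl_def field_simps)
  then show ?thesis by (auto simp: bounded_iff)
qed

lemma convex_body_cyl: "convex_body (cyl L)"
  unfolding convex_body_def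
proof (intro conjI bounded_cyl)
  show "closed (cyl L)" unfolding cyl_alt
    by (intro closed_Int closed_halfspace_ge closed_halfspace_le closed_Collect_le continuous_radial continuous_intros)
  show "convex (cyl L)" unfolding cyl_alt
    by (intro convex_Int convex_halfspace_ge convex_halfspace_le convex_slice)
qed

lemma diam_cyl_scale_le:
  assumes L: "0 < L" "0 < L'"
  shows "diamN N (cyl L) \<le> L / L' * diamN N (cyl L')"
  unfolding diamN_def[of N "cyl L"]
proof (rule cSup_least)
  have "0 \<in> cyl L" using L r is_norm_eq_0[OF N, of 0] by (simp add: cyl_def)
  then show "{N (y - z) | y z. y \<in> cyl L \<and> z \<in> cyl L} \<noteq> {}" by blast
  fix u assume "u \<in> {N (y - z) | y z. y \<in> cyl L \<and> z \<in> cyl L}"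
  then obtain y z where yz: "u = N (y - z)" "y \<in> cyl L" "z \<in> cyl L" by auto
  have sc: "(L' / L) *\<^sub>R w \<in> cyl L'" if w: "w \<in> cyl L" for w
  proof -
    have "(L' / L) *\<^sub>R w - (a \<bullet> ((L' / L) *\<^sub>R w)) *\<^sub>R v = (L' / L) *\<^sub>R (w - (a \<bullet> w) *\<^sub>R v)"
      by (simp add: algebra_simps)
    then have "N ((L' / L) *\<^sub>R w - (a \<bullet> ((L' / L) *\<^sub>R w)) *\<^sub>R v) = L' / L * N (w - (a \<bullet> w) *\<^sub>R v)"
      using L by (simp only: is_norm_scale[OF N]) simp
    also have "\<dots> \<le> L' / L * (r * L)" using w L by (intro mult_left_mono) (auto simp: cyl_def)
    finally have "N ((L' / L) *\<^sub>R w - (a \<bullet> ((L' / L) *\<^sub>R w)) *\<^sub>R v) \<le> r * L'" using L by (simp add: mult.commute)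
    moreover have "L' / L * (a \<bullet> w) \<le> L' / L * L" using w L by (intro mult_left_mono) (auto simp: cyl_def)
    ultimately show ?thesis using w L by (simp add: cyl_def)
  qed
  have "N (y - z) = L / L' * N ((L' / L) *\<^sub>R y - (L' / L) *\<^sub>R z)"
    using L by (simp add: scaleR_diff_right[symmetric] is_norm_scale[OF N])
  also have "\<dots> \<le> L / L' * diamN N (cyl L')"
    using L yz sc by (intro mult_left_mono diamN_upper[OF N bounded_cyl]) auto
  finally show "u \<le> L / L' * diamN N (cyl L')" using yz by simp
qed

lemma diam_cyl_scale:
  assumes L: "0 < L" shows "diamN N (cyl L) = L * diamN N (cyl 1)"
  using diam_cyl_scale_le[of L 1] diam_cyl_scale_le[of 1 L] L by (simp add: field_simps)

lemma diam_cyl_1: "1 \<le> diamN N (cyl 1)" "diamN N (cyl 1) \<le> 1 + 2 * r"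
proof -
  have in1: "0 \<in> cyl 1" "v \<in> cyl 1" using r av is_norm_eq_0[OF N, of 0] by (auto simp: cyl_def)
  show "1 \<le> diamN N (cyl 1)" using diamN_upper[OF N bounded_cyl in1(2,1)] Nv by simp
  show "diamN N (cyl 1) \<le> 1 + 2 * r"
    unfolding diamN_def
  proof (rule cSup_least)
    show "{N (y - z) | y z. y \<in> cyl 1 \<and> z \<in> cyl 1} \<noteq> {}" using in1 by blast
    fix u assume "u \<in> {N (y - z) | y z. y \<in> cyl 1 \<and> z \<in> cyl 1}"
    then obtain y z where yz: "u = N (y - z)" "y \<in> cyl 1" "z \<in> cyl 1" by auto
    define p where "p w = w - (a \<bullet> w) *\<^sub>R v" for w
    have "y - z = (a \<bullet> y - a \<bullet> z) *\<^sub>R v + (p y + - p z)" by (simp add: p_def algebra_simps)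
    then have "u \<le> N ((a \<bullet> y - a \<bullet> z) *\<^sub>R v) + (N (p y) + N (- p z))"
      using is_norm_triangle[OF N, of "(a \<bullet> y - a \<bullet> z) *\<^sub>R v" "p y + - p z"] is_norm_triangle[OF N, of "p y" "- p z"] yz(1) by simp
    also have "N ((a \<bullet> y - a \<bullet> z) *\<^sub>R v) \<le> 1" using yz by (auto simp: is_norm_scale[OF N] Nv cyl_def abs_le_iff)
    also have "N (p y) \<le> r" using yz by (simp add: p_def cyl_def)
    also have "N (- p z) \<le> r" using yz by (simp add: p_def cyl_def is_norm_minus[OF N] del: minus_diff_eq)
    finally show "u \<le> 1 + 2 * r" by simp
  qed
qed

text \<open>Half-open along the axis, so that adjacent slices are disjoint; unlike for
  \<open>cyl\<close>, the radius stays fixed while the length varies.\<close>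

definition slice :: "real \<Rightarrow> real \<Rightarrow> real \<Rightarrow> 'a set" where
  "slice \<rho> s t = {y. s < a \<bullet> y \<and> a \<bullet> y \<le> t \<and> N (y - (a \<bullet> y) *\<^sub>R v) \<le> \<rho>}"

lemma slice_alt: "slice \<rho> s t = {y. a \<bullet> y > s} \<inter> {y. a \<bullet> y \<le> t} \<inter> {y. N (y - (a \<bullet> y) *\<^sub>R v) \<le> \<rho>}"
  by (auto simp: slice_def)

lemma slice_borel [measurable]: "slice \<rho> s t \<in> sets borel"
proof -
  have "closed {y. N (y - (a \<bullet> y) *\<^sub>R v) \<le> \<rho>}" by (intro closed_Collect_le continuous_radial continuous_intros)
  then show ?thesis unfolding slice_alt
    by (simp add: sets.Int borel_closed borel_open closed_halfspace_le open_halfspace_gt)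
qed

lemma convex_slice_set: "convex (slice \<rho> s t)"
  unfolding slice_alt by (intro convex_Int convex_halfspace_gt convex_halfspace_le convex_slice)

lemma bounded_slice: "0 \<le> s \<Longrightarrow> bounded (slice \<rho> s t)"
proof -
  assume s: "0 \<le> s"
  obtain c where c: "c > 0" "\<And>x. c * norm x \<le> N x" using is_norm_lower_bound[OF N] by blast
  have "norm y \<le> (t + \<rho>) / c" if "y \<in> slice \<rho> s t" for y
    using c(2)[of y] norm_le_cyl[of y t "\<rho>"] that c(1) s by (simp add: slice_def field_simps)
  then show ?thesis by (auto simp: bounded_iff)
qed

lemma integrable_exp_slice:
  assumes "0 \<le> s" "0 \<le> g"
  shows "integrable lborel (\<lambda>y. exp (g * (a \<bullet> y)) * indicator (slice \<rho> s t) y)"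
proof (rule integrableI_bounded_set[where A = "slice \<rho> s t" and B = "exp (g * t)"])
  show "emeasure lborel (slice \<rho> s t) < \<infinity>" using bounded_slice[OF assms(1)] by (rule emeasure_bounded_finite)
  show "AE y\<in>slice \<rho> s t in lborel. norm (exp (g * (a \<bullet> y)) * indicator (slice \<rho> s t) y) \<le> exp (g * t)"
    using assms by (auto simp: slice_def indicator_def intro!: mult_left_mono)
qed (auto simp: indicator_def)

definition slice_mass :: "real \<Rightarrow> real \<Rightarrow> real \<Rightarrow> real \<Rightarrow> real" where
  "slice_mass g \<rho> s t = (LINT y|lborel. exp (g * (a \<bullet> y)) * indicator (slice \<rho> s t) y)"

lemma slice_mass_split:
  assumes "0 \<le> s" "s \<le> t" "t \<le> u" "0 \<le> g"
  shows "slice_mass g \<rho> s u = slice_mass g \<rho> s t + slice_mass g \<rho> t u"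
proof -
  have "slice_mass g \<rho> s t + slice_mass g \<rho> t u = 
     (LINT y|lborel. exp (g * (a \<bullet> y)) * indicator (slice \<rho> s t) y + exp (g * (a \<bullet> y)) * indicator (slice \<rho> t u) y)"
    unfolding slice_mass_def using assms by (intro Bochner_Integration.integral_add[symmetric] integrable_exp_slice) auto
  also have "\<dots> = slice_mass g \<rho> s u"
    unfolding slice_mass_def using assms by (intro Bochner_Integration.integral_cong) (auto simp: indicator_def slice_def)
  finally show ?thesis ..
qed

text \<open>Translation by \<open>s *\<^sub>R v\<close> preserves Lebesgue measure, raises
  \<open>a \<bullet> y\<close> by \<open>s\<close> and leaves the radial part unchanged.\<close>

lemma slice_mass_shift: "slice_mass g \<rho> s (s + t) = exp (g * s) * slice_mass g \<rho> 0 t"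
proof -
  have "slice_mass g \<rho> s (s + t) = (LINT y|distr lborel borel ((+) (s *\<^sub>R v)). exp (g * (a \<bullet> y)) * indicator (slice \<rho> s (s + t)) y)"
    unfolding slice_mass_def lborel_distr_plus ..
  also have "\<dots> = (LINT y|lborel. exp (g * (a \<bullet> (s *\<^sub>R v + y))) * indicator (slice \<rho> s (s + t)) (s *\<^sub>R v + y))"
    by (intro integral_distr) auto
  also have "\<dots> = (LINT y|lborel. exp (g * s) * (exp (g * (a \<bullet> y)) * indicator (slice \<rho> 0 t) y))"
  proof (intro Bochner_Integration.integral_cong refl)
    fix y
    have e1: "a \<bullet> (s *\<^sub>R v + y) = s + a \<bullet> y" by (simp add: inner_add_right av)
    then have e2: "s *\<^sub>R v + y - (a \<bullet> (s *\<^sub>R v + y)) *\<^sub>R v = y - (a \<bullet> y) *\<^sub>R v" by (simp add: algebra_simps)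
    have "s *\<^sub>R v + y \<in> slice \<rho> s (s + t) \<longleftrightarrow> y \<in> slice \<rho> 0 t"
      unfolding slice_def mem_Collect_eq unfolding e2 unfolding e1 by auto
    then show "exp (g * (a \<bullet> (s *\<^sub>R v + y))) * indicator (slice \<rho> s (s + t)) (s *\<^sub>R v + y) =
       exp (g * s) * (exp (g * (a \<bullet> y)) * indicator (slice \<rho> 0 t) y)"
      by (simp add: e1 indicator_def exp_add distrib_left)
  qed
  also have "\<dots> = exp (g * s) * slice_mass g \<rho> 0 t" unfolding slice_mass_def by (rule integral_mult_right_zero)
  finally show ?thesis .
qed

text \<open>Computing the mass of \<open>slice \<rho> 0 (s + t)\<close> in both orders determines the mass up to
  a constant without any disintegration.\<close>

lemma slice_mass_ratio:
  assumes "0 \<le> s" "0 \<le> t" "0 \<le> g"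
  shows "slice_mass g \<rho> 0 s * (exp (g * t) - 1) = slice_mass g \<rho> 0 t * (exp (g * s) - 1)"
proof -
  have "slice_mass g \<rho> 0 s + exp (g * s) * slice_mass g \<rho> 0 t = slice_mass g \<rho> 0 (s + t)"
    using slice_mass_split[of 0 s "s + t" g \<rho>] slice_mass_shift[of g \<rho> s t] assms by simp
  moreover have "slice_mass g \<rho> 0 t + exp (g * t) * slice_mass g \<rho> 0 s = slice_mass g \<rho> 0 (s + t)"
    using slice_mass_split[of 0 t "s + t" g \<rho>] slice_mass_shift[of g \<rho> t s] assms by (simp add: add.commute)
  ultimately show ?thesis by (simp add: algebra_simps)
qed

lemma slice_mass_pos:
  assumes "0 < t" "0 < \<rho>" "0 \<le> g"
  shows "0 < slice_mass g \<rho> 0 t"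
proof -
  define W where "W = {y. a \<bullet> y > 0} \<inter> {y. a \<bullet> y < t} \<inter> {y. N (y - (a \<bullet> y) *\<^sub>R v) < \<rho>}"
  have opn: "open W" unfolding W_def
    by (intro open_Int open_halfspace_gt open_halfspace_lt open_Collect_less continuous_radial continuous_intros)
  have sub: "W \<subseteq> slice \<rho> 0 t" by (auto simp: W_def slice_def)
  have "(t / 2) *\<^sub>R v \<in> W" using assms av is_norm_eq_0[OF N, of 0] by (simp add: W_def)
  then have "\<not> negligible W" using open_not_negligible[OF opn] by blast
  moreover have lm: "W \<in> lmeasurable" 
    using opn bounded_subset[OF bounded_slice[of 0 \<rho> t] sub] by (intro lmeasurable_open) auto
  ultimately have "0 < measure lebesgue W" using negligible_iff_measure0[OF lm] by (simp add: zero_less_measure_iff)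
  also have "measure lebesgue W = measure lborel W" using opn by simp
  also have "\<dots> = (LINT y|lborel. indicator W y)" by simp
  also have "\<dots> \<le> slice_mass g \<rho> 0 t"
    unfolding slice_mass_def
  proof (rule integral_mono)
    show "integrable lborel (\<lambda>y. indicator W y :: real)"
      using opn emeasure_bounded_finite[OF bounded_subset[OF bounded_slice[of 0 \<rho> t] sub]] by (intro integrable_real_indicator) auto
    show "indicator W y \<le> exp (g * (a \<bullet> y)) * indicator (slice \<rho> 0 t) y" for y
      using sub assms(3) by (auto simp: indicator_def W_def)
  qed (rule integrable_exp_slice, use assms in auto)
  finally show ?thesis .
qed

text \<open>Along the axis the measure is exponential with rate \<gamma> relative to the length
  \<open>L\<close>. The thickness makes the diameter \<open>D\<close> exceed \<open>L\<close> by a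
  factor of at most \<open>1 + 2 * r\<close>, and this is the only loss.\<close>

lemma near_extremal_example:
  assumes x: "0 < x" "x \<le> 1/2" and D: "0 < D" and \<gamma>: "0 < \<gamma>"
  shows "\<exists>F K S m. convex_body K \<and> logconcave_prob_on F K \<and> S \<in> sets lebesgue \<and> S \<subseteq> K
     \<and> has_minkowski N F S m \<and> mu F S = x \<and> diamN N K = D \<and> D * m / x \<le> (1 + 2 * r) * (affine_prof \<gamma> x / x)"
proof -
  define d where "d = diamN N (cyl 1)"
  have d: "1 \<le> d" "d \<le> 1 + 2 * r" using diam_cyl_1 by (auto simp: d_def)
  define L where "L = D / d"
  have L: "L > 0" "L * d = D" using D d by (auto simp: L_def)
  define \<rho> where "\<rho> = r * L"
  have \<rho>: "\<rho> > 0" using r L by (simp add: \<rho>_def)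
  define g where "g = \<gamma> / L"
  have g: "g > 0" "g * L = \<gamma>" using \<gamma> L by (auto simp: g_def)
  define H where "H t = slice_mass g \<rho> 0 t" for t
  have HL: "H L > 0" unfolding H_def using L \<rho> g by (intro slice_mass_pos) auto
  have e1: "exp \<gamma> - 1 > 0" using \<gamma> by simp
  have H: "H t / H L = (exp (g * t) - 1) / (exp \<gamma> - 1)" if "0 \<le> t" for t
    using slice_mass_ratio[of t L g \<rho>] that L g HL e1 by (simp add: H_def field_simps)
  define F where "F y = exp (g * (a \<bullet> y)) * indicator (slice \<rho> 0 L) y / H L" for y
  define K where "K = cyl L"
  have sK: "slice \<rho> 0 L \<subseteq> K" by (auto simp: K_def slice_def cyl_def \<rho>_def)
  \<comment> \<open>Solves \<open>H \<alpha> / H L = x\<close>: the level below which the mass is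
    \<open>x\<close>.\<close>
  define \<alpha> where "\<alpha> = ln (1 + x * (exp \<gamma> - 1)) / g"
  have ln: "0 < ln (1 + x * (exp \<gamma> - 1))" using x e1 by (intro ln_gt_zero) simp
  have "1 + x * (exp \<gamma> - 1) < 1 + 1 * (exp \<gamma> - 1)" using x e1 by (intro add_strict_left_mono mult_strict_right_mono) auto
  then have "ln (1 + x * (exp \<gamma> - 1)) < ln (exp \<gamma>)" 
    using x e1 by (subst ln_less_cancel_iff) (auto intro: add_pos_pos)
  then have "g * \<alpha> < g * L" using g by (simp add: \<alpha>_def)
  then have "\<alpha> < L" using g(1) by (simp only: mult_less_cancel_left_pos)
  moreover have "0 < \<alpha>" using ln g(1) by (simp add: \<alpha>_def)
  ultimately have \<alpha>: "0 < \<alpha>" "\<alpha> < L" by auto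
  have "0 < 1 + x * (exp \<gamma> - 1)" using x e1 by (intro add_pos_pos) auto
  then have e\<alpha>: "exp (g * \<alpha>) = 1 + x * (exp \<gamma> - 1)" using g by (simp add: \<alpha>_def)
  define S where "S = {y\<in>K. a \<bullet> y \<le> \<alpha>}"
  have intF: "integrable lborel F" unfolding F_def[abs_def] using g by (intro integrable_divide integrable_exp_slice) auto
  have Fb [measurable]: "F \<in> borel_measurable borel" using borel_measurable_integrable[OF intF] by simp
  have muF: "mu F A = slice_mass g \<rho> s t / H L" 
    if A: "A \<inter> slice \<rho> 0 L = slice \<rho> s t" for A s t
  proof -
    have eq: "indicator A y *\<^sub>R F y = exp (g * (a \<bullet> y)) * indicator (slice \<rho> s t) y / H L" for y
      unfolding A[symmetric] by (auto simp: F_def indicator_def)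
    have [measurable]: "(\<lambda>y. exp (g * (a \<bullet> y)) * indicator (slice \<rho> s t) y / H L) \<in> borel_measurable lborel" by measurable
    show ?thesis
      unfolding mu_def set_lebesgue_integral_def eq slice_mass_def by (subst integral_completion) auto
  qed
  have Fprob: "logconcave_prob_on F K"
    unfolding logconcave_prob_on_def
  proof (intro conjI allI impI)
    show "F \<in> borel_measurable lebesgue" by (intro measurable_completion) simp
    show "integrable lebesgue F" using intF by (simp add: integrable_completion)
    have "UNIV \<inter> slice \<rho> 0 L = slice \<rho> 0 L" by simp
    from muF[OF this] have "mu F UNIV = H L / H L" by (simp only: H_def)
    then show "(LINT x|lebesgue. F x) = 1" using HL by (simp add: mu_def set_lebesgue_integral_def)
    show "F y = 0" if "y \<notin> K" for y using that sK by (auto simp: F_def indicator_def)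
    show "log_concave_fun F"
      unfolding log_concave_fun_def
    proof (intro conjI allI impI)
      show "0 \<le> F y" for y using HL by (simp add: F_def)
      fix y z and t :: real assume t: "0 \<le> t \<and> t \<le> 1"
      show "F y powr t * F z powr (1 - t) \<le> F (t *\<^sub>R y + (1 - t) *\<^sub>R z)"
      proof (cases "y \<in> slice \<rho> 0 L \<and> z \<in> slice \<rho> 0 L")
        case True
        then have m: "t *\<^sub>R y + (1 - t) *\<^sub>R z \<in> slice \<rho> 0 L" using t by (intro convexD[OF convex_slice_set]) auto
        have Fe: "F w = exp (g * (a \<bullet> w) - ln (H L))" if "w \<in> slice \<rho> 0 L" for w
          using that HL by (simp add: F_def exp_diff)
        have "F y powr t * F z powr (1 - t) = F (t *\<^sub>R y + (1 - t) *\<^sub>R z)"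
          unfolding Fe[OF m] Fe[OF conjunct1[OF True]] Fe[OF conjunct2[OF True]]
          by (simp add: powr_def exp_add[symmetric] inner_add_right algebra_simps)
        then show ?thesis by simp
      next
        case False
        then have "F y = 0 \<or> F z = 0" by (auto simp: F_def)
        then have "F y powr t * F z powr (1 - t) = 0" by auto
        moreover have "0 \<le> F (t *\<^sub>R y + (1 - t) *\<^sub>R z)" using HL by (simp add: F_def)
        ultimately show ?thesis by (simp only:)
      qed
    qed
  qed
  have muS: "mu F S = x"
  proof -
    have "S \<inter> slice \<rho> 0 L = slice \<rho> 0 \<alpha>" using \<alpha> sK by (auto simp: S_def) (auto simp: slice_def)
    from muF[OF this] have "mu F S = H \<alpha> / H L" by (simp only: H_def)
    then show ?thesis using H[of \<alpha>] \<alpha> e\<alpha> e1 by simp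
  qed
  \<comment> \<open>\<open>a\<close> is 1-Lipschitz for \<open>N\<close>, so a point within
    \<open>h\<close> of \<open>S\<close> has level at most \<open>\<alpha> + h\<close>. Conversely,
    moving a point of the layer back along \<open>v\<close>, which has norm 1, reaches level
    \<alpha> without changing the radial part. Hence the layer is exact.\<close>
  have nb: "(nbhd N S h - S) \<inter> slice \<rho> 0 L = slice \<rho> \<alpha> (\<alpha> + h)" if h: "0 < h" "h < L - \<alpha>" for h
  proof (rule set_eqI, rule iffI)
    fix y assume y: "y \<in> (nbhd N S h - S) \<inter> slice \<rho> 0 L"
    then obtain s where s: "s \<in> S" "N (y - s) \<le> h" by (auto simp: nbhd_def)
    have "a \<bullet> y - a \<bullet> s \<le> h" using dual[of "y - s"] s by (simp add: inner_diff_right)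
    then have "a \<bullet> y \<le> \<alpha> + h" using s by (simp add: S_def)
    moreover have "\<alpha> < a \<bullet> y" using y sK by (auto simp: S_def)
    ultimately show "y \<in> slice \<rho> \<alpha> (\<alpha> + h)" using y by (simp add: slice_def)
  next
    fix y assume y: "y \<in> slice \<rho> \<alpha> (\<alpha> + h)"
    then have ys: "y \<in> slice \<rho> 0 L" using \<alpha> h by (auto simp: slice_def)
    define s where "s = y - (a \<bullet> y - \<alpha>) *\<^sub>R v"
    have as: "a \<bullet> s = \<alpha>" by (simp add: s_def inner_diff_right av)
    have "s - (a \<bullet> s) *\<^sub>R v = y - (a \<bullet> y) *\<^sub>R v" unfolding as by (simp add: s_def algebra_simps)
    then have "s \<in> S" using y \<alpha> as by (simp add: S_def K_def cyl_def slice_def \<rho>_def)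
    moreover have "N (y - s) \<le> h" using y by (simp add: s_def is_norm_scale[OF N] Nv slice_def)
    ultimately have "y \<in> nbhd N S h" by (auto simp: nbhd_def)
    moreover have "y \<notin> S" using y by (auto simp: S_def slice_def)
    ultimately show "y \<in> (nbhd N S h - S) \<inter> slice \<rho> 0 L" using ys by simp
  qed
  \<comment> \<open>The derivative at 0 of the layer mass
    \<open>exp (g * \<alpha>) * (H h / H L)\<close> in \<open>h\<close>.\<close>
  define m where "m = g * exp (g * \<alpha>) / (exp \<gamma> - 1)"
  have "has_minkowski N F S m"
    unfolding has_minkowski_def
  proof (rule Lim_transform_eventually)
    show "((\<lambda>h. exp (g * \<alpha>) / (exp \<gamma> - 1) * ((exp (g * h) - 1) / h)) \<longlongrightarrow> m) (at_right 0)"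
      unfolding m_def using g(1) e1 by real_asymp
    have "eventually (\<lambda>h. h \<in> {0<..<L - \<alpha>}) (at_right 0)" using \<alpha> by (intro eventually_at_right_real) auto
    then show "eventually (\<lambda>h. exp (g * \<alpha>) / (exp \<gamma> - 1) * ((exp (g * h) - 1) / h) = mu F (nbhd N S h - S) / h) (at_right 0)"
    proof eventually_elim
      case (elim h)
      then have h: "0 < h" "h < L - \<alpha>" by auto
      have "mu F (nbhd N S h - S) = exp (g * \<alpha>) * (H h / H L)"
        using muF[OF nb[OF h]] by (simp add: slice_mass_shift H_def)
      also have "H h / H L = (exp (g * h) - 1) / (exp \<gamma> - 1)" using h by (intro H) simp
      finally show ?case by simp
    qed
  qed
  moreover have "D * m / x \<le> (1 + 2 * r) * (affine_prof \<gamma> x / x)"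
  proof -
    have "D * m = d * (L * g) * exp (g * \<alpha>) / (exp \<gamma> - 1)" using L by (simp add: m_def ac_simps)
    also have "\<dots> = d * affine_prof \<gamma> x"
      unfolding e\<alpha> using g e1 by (simp add: affine_prof_def field_simps)
    finally have "D * m / x = d * (affine_prof \<gamma> x / x)" by simp
    also have "\<dots> \<le> (1 + 2 * r) * (affine_prof \<gamma> x / x)"
      using d x \<gamma> affine_prof_nonneg[of \<gamma> x] by (intro mult_right_mono) auto
    finally show ?thesis .
  qed
  moreover have "diamN N K = D" unfolding K_def diam_cyl_scale[OF L(1)] using L by (simp add: d_def)
  moreover have "S \<in> sets lebesgue"
  proof -
    have "closed (cyl L)" using convex_body_cyl by (simp add: convex_body_def)
    moreover have "S = cyl L \<inter> {y. a \<bullet> y \<le> \<alpha>}" by (auto simp: S_def K_def)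
    ultimately have "closed S" by (simp add: closed_Int closed_halfspace_le)
    then show ?thesis by (simp add: borel_closed)
  qed
  moreover have "S \<subseteq> K" "convex_body K" using convex_body_cyl by (auto simp: S_def K_def)
  ultimately show ?thesis using Fprob muS by blast
qed

end

theorem theorem1:
  fixes N :: "'a::euclidean_space \<Rightarrow> real"
  assumes "is_norm N"
  shows "(\<forall>F K S m. convex_body K \<and> logconcave_prob_on F K \<and> S \<in> sets lebesgue \<and> S \<subseteq> K
            \<and> 0 < mu F S \<and> mu F S \<le> 1/2 \<and> has_minkowski N F S m
          \<longrightarrow> diamN N K * m \<ge> mu F S * G (1 / mu F S))
       \<and> (\<forall>x D. 0 < x \<and> x \<le> 1/2 \<and> 0 < D \<longrightarrow>
            Inf {diamN N K * m / mu F S | F K S m.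
                   convex_body K \<and> logconcave_prob_on F K \<and> S \<in> sets lebesgue \<and> S \<subseteq> K
                   \<and> has_minkowski N F S m \<and> mu F S = x \<and> diamN N K = D} = G (1 / x))"
proof (intro conjI allI impI)
  fix F K S m
  assume "convex_body K \<and> logconcave_prob_on F K \<and> S \<in> sets lebesgue \<and> S \<subseteq> K
            \<and> 0 < mu F S \<and> mu F S \<le> 1/2 \<and> has_minkowski N F S m"
  then show "mu F S * G (1 / mu F S) \<le> diamN N K * m"
    using minkowski_lower_bound[OF assms] by blast
next
  fix x D :: real assume *: "0 < x \<and> x \<le> 1/2 \<and> 0 < D"
  then have x: "0 < x" "x \<le> 1/2" and D: "0 < D" by auto
  let ?X = "{diamN N K * m / mu F S | F K S m.
                   convex_body K \<and> logconcave_prob_on F K \<and> S \<in> sets lebesgue \<and> S \<subseteq> K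
                   \<and> has_minkowski N F S m \<and> mu F S = x \<and> diamN N K = D}"
  have lower: "G (1 / x) \<le> q" if q: "q \<in> ?X" for q
  proof -
    obtain F K S m where "q = diamN N K * m / x" "convex_body K" "logconcave_prob_on F K" "S \<in> sets lebesgue" "S \<subseteq> K"
      "has_minkowski N F S m" "mu F S = x"
      using q by auto
    then have "x * G (1 / x) \<le> diamN N K * m" "q = diamN N K * m / x"
      using minkowski_lower_bound[OF assms, of K F S m] x by auto
    then show ?thesis using x by (simp add: pos_le_divide_eq mult.commute)
  qed
  have bdd: "bdd_below ?X" using lower by (intro bdd_belowI)
  obtain a v :: 'a where av: "a \<bullet> v = 1" "N v = 1" "\<And>y. \<bar>a \<bullet> y\<bar> \<le> N y"
    using norming_functional[OF assms] by blast
  have upper: "\<exists>q\<in>?X. q \<le> (1 + 2 * r) * (affine_prof \<gamma> x / x)" if r: "0 < r" and \<gamma>: "0 < \<gamma>" for r \<gamma>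
  proof -
    interpret cylinder N a v r using assms av r by unfold_locales
    obtain F K S m where e: "convex_body K" "logconcave_prob_on F K" "S \<in> sets lebesgue" "S \<subseteq> K"
      "has_minkowski N F S m" "mu F S = x" "diamN N K = D" "D * m / x \<le> (1 + 2 * r) * (affine_prof \<gamma> x / x)"
      using near_extremal_example[OF x D \<gamma>] by blast
    then have "D * m / x \<in> ?X" by blast
    then show ?thesis using e by blast
  qed
  \<comment> \<open>The rate is fixed while the relative radius \<open>r\<close> of the cylinders
    tends to 0.\<close>
  have le1: "Inf ?X * x \<le> affine_prof \<gamma> x" if "0 < \<gamma>" for \<gamma>
  proof -
    have "Inf ?X \<le> (1 + 2 * r) * (affine_prof \<gamma> x / x)" if "0 < r" for r
      using upper[OF that \<open>0 < \<gamma>\<close>] cInf_lower2[OF _ _ bdd] by blast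
    then have "eventually (\<lambda>r. Inf ?X \<le> (1 + 2 * r) * (affine_prof \<gamma> x / x)) (at_right 0)"
      by (intro eventually_at_rightI[of 0 1]) auto
    moreover have "((\<lambda>r. (1 + 2 * r) * (affine_prof \<gamma> x / x)) \<longlongrightarrow> (1 + 2 * 0) * (affine_prof \<gamma> x / x)) (at_right 0)"
      by (intro tendsto_intros)
    ultimately have "Inf ?X \<le> (1 + 2 * 0) * (affine_prof \<gamma> x / x)" by (intro tendsto_lowerbound) auto
    then show ?thesis using x by (simp add: field_simps)
  qed
  \<comment> \<open>The examples have positive rates; for \<open>x \<le> 1/2\<close> negative rates
    give no smaller value, so the bound extends to the infimum over all rates.\<close>
  have "Inf ?X * x \<le> iso_prof x"
  proof (rule iso_prof_greatest)
    fix \<gamma> :: real assume "\<gamma> \<noteq> 0"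
    then consider "\<gamma> > 0" | "- \<gamma> > 0" by linarith
    then show "Inf ?X * x \<le> affine_prof \<gamma> x"
    proof cases
      case 2
      then show ?thesis using le1[of "- \<gamma>"] affine_prof_le_minus[of "- \<gamma>" x] x by auto
    qed (rule le1)
  qed
  then have "Inf ?X \<le> G (1 / x)" using iso_prof_eq_G[OF x] x by (simp add: mult.commute)
  moreover have "G (1 / x) \<le> Inf ?X"
  proof (rule cInf_greatest)
    show "?X \<noteq> {}" using upper[of 1 1] by (intro notI) auto
  qed (rule lower)
  ultimately show "Inf ?X = G (1 / x)" by (rule antisym)
qed

end
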